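(* Let $(M,J,g)$ be a quasi Kähler manifold. Then $S^c\le S^*$ at every point of $M$. Moreover, if $S^c=S^*$ at every point of $M$, then $R_{i\bar j kl}=0$ for all $i,j,k,l\in\{1,\dots,n\}$ at every point of $M$ (components with respect to local unitary $(1,0)$-frames). If $(M,J,g)$ is almost Kähler and $S^c=S^*$ at every point of $M$, then $(M,J,g)$ is Kähler.
   Context: An almost Hermitian manifold $(M,J,g)$ is a manifold $M$ of real dimension $2n$ with an almost complex structure $J$ and a Riemannian metric $g$ satisfying $g(JX,JY)=g(X,Y)$. Its fundamental form is $\omega_g(X,Y)=g(JX,Y)$. It is almost Kähler if $d\omega_g=0$; quasi Kähler if $\bar\partial\omega_g=0$, where $\bar\partial\omega_g$ is the $(1,2)$-part of $d\omega_g$; Kähler if $J$ is integrable and $d\omega_g=0$. Write $\langle\cdot,\cdot\rangle$ for the complex bilinear extension of $g$ to $TM\otimes\mathbb C$. The torsion of a connection $\nabla$ is $\tau(X,Y)=\nabla_XY-\nabla_YX-[X,Y]$. The canonical connection $\nabla$ is the unique connection with $\nabla g=0$, $\nabla J=0$ and $\tau(X,\overline Y)=0$ for all $(1,0)$-vectors $X,Y$ (tensors and connections are extended complex linearly). Curvature convention: $R(X,Y)Z=\nabla_X\nabla_YZ-\nabla_Y\nabla_XZ-\nabla_{[X,Y]}Z$ and $R(X,Y,Z,W)=\langle R(Z,W)X,Y\rangle$. $R$ denotes the curvature tensor of the canonical connection and $R^L$ the curvature tensor of the Levi-Civita connection $D$ (same conventions). A local unitary $(1,0)$-frame $(e_1,\dots,e_n)$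 is a local frame of $T^{1,0}M$ with $\langle e_i,\overline{e_j}\rangle=\delta_{ij}$; $e_{\bar i}=\overline{e_i}$; and $R_{ABCD}=R(e_A,e_B,e_C,e_D)$, $R^L_{ABCD}=R^L(e_A,e_B,e_C,e_D)$ for $A,B,C,D\in\{1,\bar1,\dots,n,\bar n\}$. The $*$-scalar curvature of the Levi-Civita connection is $S^*=\sum_{\lambda,\mu=1}^nR^L_{\lambda\bar\lambda\mu\bar\mu}$, and the scalar curvature of the canonical connection is $S^c=\sum_{\lambda,\mu=1}^nR_{\lambda\bar\lambda\mu\bar\mu}$, in a local unitary $(1,0)$-frame. *)

theory Defs
  imports "HOL-Analysis.Analysis"
begin

section \<open>Smooth manifolds\<close>

text \<open>For a map on an open subset of a finite-dimensional space this is the usual \<open>C\<^sup>k\<close>: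
  existence and continuity of all iterated directional derivatives up to order \<open>k\<close>.\<close>

primrec Ck_on :: "nat \<Rightarrow> 'e::real_normed_vector set \<Rightarrow> ('e \<Rightarrow> 'f::real_normed_vector) \<Rightarrow> bool" where
  "Ck_on 0 S f \<longleftrightarrow> continuous_on S f"
| "Ck_on (Suc k) S f \<longleftrightarrow>
     (\<forall>x\<in>S. f differentiable (at x)) \<and> (\<forall>w. Ck_on k S (\<lambda>x. frechet_derivative f (at x) w))"

definition smooth_on :: "'e::real_normed_vector set \<Rightarrow> ('e \<Rightarrow> 'f::real_normed_vector) \<Rightarrow> bool" where
  "smooth_on S f \<longleftrightarrow> (\<forall>k. Ck_on k S f)"

text \<open>A chart is a pair of its domain and its coordinate map; the values of the coordinate map
  outside the domain are irrelevant.  The atlas need not be maximal.\<close>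

record ('a, 'e) mfd =
  mtop :: "'a topology"
  atlas :: "('a set \<times> ('a \<Rightarrow> 'e)) set"

abbreviation points :: "('a, 'e) mfd \<Rightarrow> 'a set" where
  "points M \<equiv> topspace (mtop M)"

definition smooth_manifold :: "('a, 'e::euclidean_space) mfd \<Rightarrow> bool" where
  "smooth_manifold M \<longleftrightarrow>
     Hausdorff_space (mtop M) \<and> second_countable (mtop M) \<and>
     (\<Union>(U, \<phi>)\<in>atlas M. U) = points M \<and>
     (\<forall>(U, \<phi>)\<in>atlas M. openin (mtop M) U \<and> open (\<phi> ` U) \<and>
        homeomorphic_map (subtopology (mtop M) U) (top_of_set (\<phi> ` U)) \<phi>) \<and>
     (\<forall>(U, \<phi>)\<in>atlas M. \<forall>(V, \<psi>)\<in>atlas M. smooth_on (\<phi> ` (U \<inter> V)) (\<psi> \<circ> inv_into U \<phi>))"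

definition smooth_fun :: "('a, 'e::euclidean_space) mfd \<Rightarrow> 'a set \<Rightarrow> ('a \<Rightarrow> real) \<Rightarrow> bool" where
  "smooth_fun M W f \<longleftrightarrow> (\<forall>(U, \<phi>)\<in>atlas M. smooth_on (\<phi> ` (U \<inter> W)) (f \<circ> inv_into U \<phi>))"

definition smooth_near :: "('a, 'e::euclidean_space) mfd \<Rightarrow> 'a \<Rightarrow> ('a \<Rightarrow> real) \<Rightarrow> bool" where
  "smooth_near M p f \<longleftrightarrow> (\<exists>W. openin (mtop M) W \<and> p \<in> W \<and> smooth_fun M W f)"


section \<open>Tangent vectors and vector fields\<close>

text \<open>A tangent vector at \<open>p\<close> is a directional derivative operator on functions that are smooth near
  \<open>p\<close>.  It is set to \<open>0\<close> on all other functions, so that equality of tangent vectors is equality of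
  HOL functions.  A complex tangent vector \<open>u + \<i> w\<close> (\<open>u\<close>, \<open>w\<close> real) is the
  operator \<open>f \<mapsto> u f + \<i> w f\<close>, still on real functions.\<close>

type_synonym 'a tvec = "('a \<Rightarrow> real) \<Rightarrow> real"
type_synonym 'a ctvec = "('a \<Rightarrow> real) \<Rightarrow> complex"

definition dir_deriv ::
    "('a, 'e::euclidean_space) mfd \<Rightarrow> 'a set \<times> ('a \<Rightarrow> 'e) \<Rightarrow> 'a \<Rightarrow> 'e \<Rightarrow> 'a tvec" where
  "dir_deriv M c p w = (\<lambda>f. if smooth_near M p f
     then frechet_derivative (f \<circ> inv_into (fst c) (snd c)) (at (snd c p)) w else 0)"

definition tangent_space :: "('a, 'e::euclidean_space) mfd \<Rightarrow> 'a \<Rightarrow> 'a tvec set" where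
  "tangent_space M p = {dir_deriv M c p w | c w. c \<in> atlas M \<and> p \<in> fst c}"

definition vRe :: "'a ctvec \<Rightarrow> 'a tvec" where "vRe v = (\<lambda>f. Re (v f))"
definition vIm :: "'a ctvec \<Rightarrow> 'a tvec" where "vIm v = (\<lambda>f. Im (v f))"
definition vcnj :: "'a ctvec \<Rightarrow> 'a ctvec" where "vcnj v = (\<lambda>f. cnj (v f))"

definition ctangent_space :: "('a, 'e::euclidean_space) mfd \<Rightarrow> 'a \<Rightarrow> 'a ctvec set" where
  "ctangent_space M p = {v. vRe v \<in> tangent_space M p \<and> vIm v \<in> tangent_space M p}"

text \<open>Local vector fields are total functions of which only the values on the open set under
  consideration matter.\<close>

definition smooth_field ::
    "('a, 'e::euclidean_space) mfd \<Rightarrow> 'a set \<Rightarrow> ('a \<Rightarrow> 'a tvec) \<Rightarrow> bool" where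
  "smooth_field M U X \<longleftrightarrow> (\<forall>p\<in>U. X p \<in> tangent_space M p) \<and>
     (\<forall>V f. openin (mtop M) V \<and> V \<subseteq> U \<and> smooth_fun M V f \<longrightarrow> smooth_fun M V (\<lambda>p. X p f))"

definition smooth_cfield ::
    "('a, 'e::euclidean_space) mfd \<Rightarrow> 'a set \<Rightarrow> ('a \<Rightarrow> 'a ctvec) \<Rightarrow> bool" where
  "smooth_cfield M U X \<longleftrightarrow>
     smooth_field M U (\<lambda>p. vRe (X p)) \<and> smooth_field M U (\<lambda>p. vIm (X p))"

text \<open>The derivative of a complex-valued function along a complex tangent vector.\<close>

definition vapply :: "'a ctvec \<Rightarrow> ('a \<Rightarrow> complex) \<Rightarrow> complex" where
  "vapply v h = v (\<lambda>q. Re (h q)) + \<i> * v (\<lambda>q. Im (h q))"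

definition lie_bracket :: "('a, 'e::euclidean_space) mfd \<Rightarrow>
    ('a \<Rightarrow> 'a ctvec) \<Rightarrow> ('a \<Rightarrow> 'a ctvec) \<Rightarrow> 'a \<Rightarrow> 'a ctvec" where
  "lie_bracket M X Y p = (\<lambda>f. if smooth_near M p f
     then vapply (X p) (\<lambda>q. Y q f) - vapply (Y p) (\<lambda>q. X q f) else 0)"


section \<open>Almost Hermitian structures\<close>

definition almost_complex_structure ::
    "('a, 'e::euclidean_space) mfd \<Rightarrow> ('a \<Rightarrow> 'a tvec \<Rightarrow> 'a tvec) \<Rightarrow> bool" where
  "almost_complex_structure M J \<longleftrightarrow>
     (\<forall>p\<in>points M. \<forall>u\<in>tangent_space M p.
        J p u \<in> tangent_space M p \<and> J p (J p u) = (\<lambda>f. - u f) \<and>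
        (\<forall>v\<in>tangent_space M p. \<forall>a b.
           J p (\<lambda>f. a * u f + b * v f) = (\<lambda>f. a * J p u f + b * J p v f))) \<and>
     (\<forall>U X. openin (mtop M) U \<and> smooth_field M U X \<longrightarrow> smooth_field M U (\<lambda>p. J p (X p)))"

definition riemannian_metric ::
    "('a, 'e::euclidean_space) mfd \<Rightarrow> ('a \<Rightarrow> 'a tvec \<Rightarrow> 'a tvec \<Rightarrow> real) \<Rightarrow> bool" where
  "riemannian_metric M g \<longleftrightarrow>
     (\<forall>p\<in>points M. \<forall>u\<in>tangent_space M p.
        (u \<noteq> (\<lambda>f. 0) \<longrightarrow> g p u u > 0) \<and>
        (\<forall>v\<in>tangent_space M p. g p u v = g p v u \<and>
           (\<forall>w\<in>tangent_space M p. \<forall>a b.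
              g p (\<lambda>f. a * u f + b * v f) w = a * g p u w + b * g p v w))) \<and>
     (\<forall>U X Y. openin (mtop M) U \<and> smooth_field M U X \<and> smooth_field M U Y \<longrightarrow>
        smooth_fun M U (\<lambda>p. g p (X p) (Y p)))"

definition almost_hermitian :: "nat \<Rightarrow> ('a, 'e::euclidean_space) mfd \<Rightarrow>
    ('a \<Rightarrow> 'a tvec \<Rightarrow> 'a tvec) \<Rightarrow> ('a \<Rightarrow> 'a tvec \<Rightarrow> 'a tvec \<Rightarrow> real) \<Rightarrow> bool" where
  "almost_hermitian n M J g \<longleftrightarrow>
     smooth_manifold M \<and> DIM('e) = 2 * n \<and>
     almost_complex_structure M J \<and> riemannian_metric M g \<and>
     (\<forall>p\<in>points M. \<forall>u\<in>tangent_space M p. \<forall>v\<in>tangent_space M p. g p (J p u) (J p v) = g p u v)"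

text \<open>The complex (bi)linear extensions of \<open>J\<close> and \<open>g\<close>.\<close>

definition cJ :: "('a \<Rightarrow> 'a tvec \<Rightarrow> 'a tvec) \<Rightarrow> 'a \<Rightarrow> 'a ctvec \<Rightarrow> 'a ctvec" where
  "cJ J p v = (\<lambda>f. Complex (J p (vRe v) f) (J p (vIm v) f))"

definition cmetric ::
    "('a \<Rightarrow> 'a tvec \<Rightarrow> 'a tvec \<Rightarrow> real) \<Rightarrow> 'a \<Rightarrow> 'a ctvec \<Rightarrow> 'a ctvec \<Rightarrow> complex" where
  "cmetric g p u v =
     Complex (g p (vRe u) (vRe v) - g p (vIm u) (vIm v)) (g p (vRe u) (vIm v) + g p (vIm u) (vRe v))"

definition fundamental_form :: "('a \<Rightarrow> 'a tvec \<Rightarrow> 'a tvec) \<Rightarrow>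
    ('a \<Rightarrow> 'a tvec \<Rightarrow> 'a tvec \<Rightarrow> real) \<Rightarrow> 'a \<Rightarrow> 'a ctvec \<Rightarrow> 'a ctvec \<Rightarrow> complex" where
  "fundamental_form J g p u v = cmetric g p (cJ J p u) v"

definition T10 :: "('a, 'e::euclidean_space) mfd \<Rightarrow>
    ('a \<Rightarrow> 'a tvec \<Rightarrow> 'a tvec) \<Rightarrow> 'a \<Rightarrow> 'a ctvec set" where
  "T10 M J p = {v \<in> ctangent_space M p. cJ J p v = (\<lambda>f. \<i> * v f)}"

definition smooth_field10 :: "('a, 'e::euclidean_space) mfd \<Rightarrow>
    ('a \<Rightarrow> 'a tvec \<Rightarrow> 'a tvec) \<Rightarrow> 'a set \<Rightarrow> ('a \<Rightarrow> 'a ctvec) \<Rightarrow> bool" where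
  "smooth_field10 M J U X \<longleftrightarrow> smooth_cfield M U X \<and> (\<forall>p\<in>U. X p \<in> T10 M J p)"

definition proj10 :: "('a \<Rightarrow> 'a tvec \<Rightarrow> 'a tvec) \<Rightarrow> ('a \<Rightarrow> 'a ctvec) \<Rightarrow> 'a \<Rightarrow> 'a ctvec" where
  "proj10 J X p = (\<lambda>f. (X p f - \<i> * cJ J p (X p) f) / 2)"

definition proj01 :: "('a \<Rightarrow> 'a tvec \<Rightarrow> 'a tvec) \<Rightarrow> ('a \<Rightarrow> 'a ctvec) \<Rightarrow> 'a \<Rightarrow> 'a ctvec" where
  "proj01 J X p = (\<lambda>f. (X p f + \<i> * cJ J p (X p) f) / 2)"

text \<open>The exterior derivative of the fundamental form, evaluated on complex vector fields by the
  invariant formula (normalised without the factor 1/3).\<close>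

definition d_omega :: "('a, 'e::euclidean_space) mfd \<Rightarrow> ('a \<Rightarrow> 'a tvec \<Rightarrow> 'a tvec) \<Rightarrow>
    ('a \<Rightarrow> 'a tvec \<Rightarrow> 'a tvec \<Rightarrow> real) \<Rightarrow>
    ('a \<Rightarrow> 'a ctvec) \<Rightarrow> ('a \<Rightarrow> 'a ctvec) \<Rightarrow> ('a \<Rightarrow> 'a ctvec) \<Rightarrow> 'a \<Rightarrow> complex" where
  "d_omega M J g X Y Z p =
     (let \<omega> = fundamental_form J g in
        vapply (X p) (\<lambda>q. \<omega> q (Y q) (Z q))
      + vapply (Y p) (\<lambda>q. \<omega> q (Z q) (X q))
      + vapply (Z p) (\<lambda>q. \<omega> q (X q) (Y q))
      - \<omega> p (lie_bracket M X Y p) (Z p)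
      - \<omega> p (lie_bracket M Y Z p) (X p)
      - \<omega> p (lie_bracket M Z X p) (Y p))"

text \<open>The (1,2)-part of \<open>d\<omega>\<close>.\<close>

definition dbar_omega :: "('a, 'e::euclidean_space) mfd \<Rightarrow> ('a \<Rightarrow> 'a tvec \<Rightarrow> 'a tvec) \<Rightarrow>
    ('a \<Rightarrow> 'a tvec \<Rightarrow> 'a tvec \<Rightarrow> real) \<Rightarrow>
    ('a \<Rightarrow> 'a ctvec) \<Rightarrow> ('a \<Rightarrow> 'a ctvec) \<Rightarrow> ('a \<Rightarrow> 'a ctvec) \<Rightarrow> 'a \<Rightarrow> complex" where
  "dbar_omega M J g X Y Z p =
       d_omega M J g (proj10 J X) (proj01 J Y) (proj01 J Z) p
     + d_omega M J g (proj01 J X) (proj10 J Y) (proj01 J Z) p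
     + d_omega M J g (proj01 J X) (proj01 J Y) (proj10 J Z) p"

definition omega_closed :: "('a, 'e::euclidean_space) mfd \<Rightarrow> ('a \<Rightarrow> 'a tvec \<Rightarrow> 'a tvec) \<Rightarrow>
    ('a \<Rightarrow> 'a tvec \<Rightarrow> 'a tvec \<Rightarrow> real) \<Rightarrow> bool" where
  "omega_closed M J g \<longleftrightarrow>
     (\<forall>U X Y Z. openin (mtop M) U \<and> smooth_cfield M U X \<and> smooth_cfield M U Y \<and> smooth_cfield M U Z
        \<longrightarrow> (\<forall>p\<in>U. d_omega M J g X Y Z p = 0))"

text \<open>Integrability of \<open>J\<close> is taken in the sense of a vanishing Nijenhuis tensor.\<close>

definition nijenhuis :: "('a, 'e::euclidean_space) mfd \<Rightarrow> ('a \<Rightarrow> 'a tvec \<Rightarrow> 'a tvec) \<Rightarrow>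
    ('a \<Rightarrow> 'a ctvec) \<Rightarrow> ('a \<Rightarrow> 'a ctvec) \<Rightarrow> 'a \<Rightarrow> 'a ctvec" where
  "nijenhuis M J X Y p =
     (let JX = (\<lambda>q. cJ J q (X q)); JY = (\<lambda>q. cJ J q (Y q)) in
      (\<lambda>f. lie_bracket M JX JY p f - cJ J p (lie_bracket M JX Y p) f
         - cJ J p (lie_bracket M X JY p) f - lie_bracket M X Y p f))"

definition J_integrable ::
    "('a, 'e::euclidean_space) mfd \<Rightarrow> ('a \<Rightarrow> 'a tvec \<Rightarrow> 'a tvec) \<Rightarrow> bool" where
  "J_integrable M J \<longleftrightarrow>
     (\<forall>U X Y. openin (mtop M) U \<and> smooth_cfield M U X \<and> smooth_cfield M U Y
        \<longrightarrow> (\<forall>p\<in>U. nijenhuis M J X Y p = (\<lambda>f. 0)))"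

definition almost_kaehler :: "nat \<Rightarrow> ('a, 'e::euclidean_space) mfd \<Rightarrow>
    ('a \<Rightarrow> 'a tvec \<Rightarrow> 'a tvec) \<Rightarrow> ('a \<Rightarrow> 'a tvec \<Rightarrow> 'a tvec \<Rightarrow> real) \<Rightarrow> bool" where
  "almost_kaehler n M J g \<longleftrightarrow> almost_hermitian n M J g \<and> omega_closed M J g"

definition quasi_kaehler :: "nat \<Rightarrow> ('a, 'e::euclidean_space) mfd \<Rightarrow>
    ('a \<Rightarrow> 'a tvec \<Rightarrow> 'a tvec) \<Rightarrow> ('a \<Rightarrow> 'a tvec \<Rightarrow> 'a tvec \<Rightarrow> real) \<Rightarrow> bool" where
  "quasi_kaehler n M J g \<longleftrightarrow> almost_hermitian n M J g \<and>
     (\<forall>U X Y Z. openin (mtop M) U \<and> smooth_cfield M U X \<and> smooth_cfield M U Y \<and> smooth_cfield M U Z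
        \<longrightarrow> (\<forall>p\<in>U. dbar_omega M J g X Y Z p = 0))"

definition kaehler :: "nat \<Rightarrow> ('a, 'e::euclidean_space) mfd \<Rightarrow>
    ('a \<Rightarrow> 'a tvec \<Rightarrow> 'a tvec) \<Rightarrow> ('a \<Rightarrow> 'a tvec \<Rightarrow> 'a tvec \<Rightarrow> real) \<Rightarrow> bool" where
  "kaehler n M J g \<longleftrightarrow> almost_hermitian n M J g \<and> J_integrable M J \<and> omega_closed M J g"


section \<open>Connections and curvature\<close>

text \<open>\<open>C p v Y\<close> is the covariant derivative at \<open>p\<close>, in the direction \<open>v\<close>, of a vector field \<open>Y\<close> that is
  smooth near \<open>p\<close>.  Connections are given on local vector fields, hence the explicit locality axiom.\<close>

type_synonym 'a conn = "'a \<Rightarrow> 'a tvec \<Rightarrow> ('a \<Rightarrow> 'a tvec) \<Rightarrow> 'a tvec"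

definition connection :: "('a, 'e::euclidean_space) mfd \<Rightarrow> 'a conn \<Rightarrow> bool" where
  "connection M C \<longleftrightarrow>
     (\<forall>U Y. openin (mtop M) U \<and> smooth_field M U Y \<longrightarrow>
        (\<forall>p\<in>U. \<forall>v\<in>tangent_space M p.
            C p v Y \<in> tangent_space M p
          \<and> (\<forall>w\<in>tangent_space M p. \<forall>a b.
               C p (\<lambda>f. a * v f + b * w f) Y = (\<lambda>f. a * C p v Y f + b * C p w Y f))
          \<and> (\<forall>Z. smooth_field M U Z \<longrightarrow>
               C p v (\<lambda>q f. Y q f + Z q f) = (\<lambda>f. C p v Y f + C p v Z f))
          \<and> (\<forall>h. smooth_fun M U h \<longrightarrow>
               C p v (\<lambda>q f. h q * Y q f) = (\<lambda>f. v h * Y p f + h p * C p v Y f))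
          \<and> (\<forall>Z. (\<forall>q\<in>U. Z q = Y q) \<longrightarrow> C p v Z = C p v Y))
      \<and> (\<forall>X. smooth_field M U X \<longrightarrow> smooth_field M U (\<lambda>p. C p (X p) Y)))"

definition cconn :: "'a conn \<Rightarrow> 'a \<Rightarrow> 'a ctvec \<Rightarrow> ('a \<Rightarrow> 'a ctvec) \<Rightarrow> 'a ctvec" where
  "cconn C p v Y =
     (\<lambda>f. Complex (C p (vRe v) (\<lambda>q. vRe (Y q)) f - C p (vIm v) (\<lambda>q. vIm (Y q)) f)
                  (C p (vRe v) (\<lambda>q. vIm (Y q)) f + C p (vIm v) (\<lambda>q. vRe (Y q)) f))"

definition torsion :: "('a, 'e::euclidean_space) mfd \<Rightarrow> 'a conn \<Rightarrow>
    ('a \<Rightarrow> 'a ctvec) \<Rightarrow> ('a \<Rightarrow> 'a ctvec) \<Rightarrow> 'a \<Rightarrow> 'a ctvec" where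
  "torsion M C X Y p =
     (\<lambda>f. cconn C p (X p) Y f - cconn C p (Y p) X f - lie_bracket M X Y p f)"

definition metric_connection :: "('a, 'e::euclidean_space) mfd \<Rightarrow>
    ('a \<Rightarrow> 'a tvec \<Rightarrow> 'a tvec \<Rightarrow> real) \<Rightarrow> 'a conn \<Rightarrow> bool" where
  "metric_connection M g C \<longleftrightarrow>
     (\<forall>U Y Z. openin (mtop M) U \<and> smooth_field M U Y \<and> smooth_field M U Z \<longrightarrow>
        (\<forall>p\<in>U. \<forall>v\<in>tangent_space M p.
           v (\<lambda>q. g q (Y q) (Z q)) = g p (C p v Y) (Z p) + g p (Y p) (C p v Z)))"

definition complex_connection :: "('a, 'e::euclidean_space) mfd \<Rightarrow>
    ('a \<Rightarrow> 'a tvec \<Rightarrow> 'a tvec) \<Rightarrow> 'a conn \<Rightarrow> bool" where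
  "complex_connection M J C \<longleftrightarrow>
     (\<forall>U Y. openin (mtop M) U \<and> smooth_field M U Y \<longrightarrow>
        (\<forall>p\<in>U. \<forall>v\<in>tangent_space M p. C p v (\<lambda>q. J q (Y q)) = J p (C p v Y)))"

definition canonical_connection :: "('a, 'e::euclidean_space) mfd \<Rightarrow>
    ('a \<Rightarrow> 'a tvec \<Rightarrow> 'a tvec) \<Rightarrow> ('a \<Rightarrow> 'a tvec \<Rightarrow> 'a tvec \<Rightarrow> real) \<Rightarrow> 'a conn \<Rightarrow> bool" where
  "canonical_connection M J g C \<longleftrightarrow>
     connection M C \<and> metric_connection M g C \<and> complex_connection M J C \<and>
     (\<forall>U X Y. openin (mtop M) U \<and> smooth_field10 M J U X \<and> smooth_field10 M J U Y \<longrightarrow>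
        (\<forall>p\<in>U. torsion M C X (\<lambda>q. vcnj (Y q)) p = (\<lambda>f. 0)))"

definition levi_civita_connection :: "('a, 'e::euclidean_space) mfd \<Rightarrow>
    ('a \<Rightarrow> 'a tvec \<Rightarrow> 'a tvec \<Rightarrow> real) \<Rightarrow> 'a conn \<Rightarrow> bool" where
  "levi_civita_connection M g C \<longleftrightarrow>
     connection M C \<and> metric_connection M g C \<and>
     (\<forall>U X Y. openin (mtop M) U \<and> smooth_cfield M U X \<and> smooth_cfield M U Y \<longrightarrow>
        (\<forall>p\<in>U. torsion M C X Y p = (\<lambda>f. 0)))"

definition curvature :: "('a, 'e::euclidean_space) mfd \<Rightarrow> 'a conn \<Rightarrow>
    ('a \<Rightarrow> 'a ctvec) \<Rightarrow> ('a \<Rightarrow> 'a ctvec) \<Rightarrow> ('a \<Rightarrow> 'a ctvec) \<Rightarrow> 'a \<Rightarrow> 'a ctvec" where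
  "curvature M C X Y Z p =
     (\<lambda>f. cconn C p (X p) (\<lambda>q. cconn C q (Y q) Z) f
        - cconn C p (Y p) (\<lambda>q. cconn C q (X q) Z) f
        - cconn C p (lie_bracket M X Y p) Z f)"

text \<open>The argument order is \<open>R(X,Y,Z,W) = \<langle>R(Z,W)X,Y\<rangle>\<close>.\<close>

definition curv4 :: "('a, 'e::euclidean_space) mfd \<Rightarrow> ('a \<Rightarrow> 'a tvec \<Rightarrow> 'a tvec \<Rightarrow> real) \<Rightarrow>
    'a conn \<Rightarrow> ('a \<Rightarrow> 'a ctvec) \<Rightarrow> ('a \<Rightarrow> 'a ctvec) \<Rightarrow> ('a \<Rightarrow> 'a ctvec) \<Rightarrow> ('a \<Rightarrow> 'a ctvec) \<Rightarrow>
    'a \<Rightarrow> complex" where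
  "curv4 M g C X Y Z W p = cmetric g p (curvature M C Z W X p) (Y p)"

definition unitary_frame :: "nat \<Rightarrow> ('a, 'e::euclidean_space) mfd \<Rightarrow>
    ('a \<Rightarrow> 'a tvec \<Rightarrow> 'a tvec) \<Rightarrow> ('a \<Rightarrow> 'a tvec \<Rightarrow> 'a tvec \<Rightarrow> real) \<Rightarrow>
    'a set \<Rightarrow> (nat \<Rightarrow> 'a \<Rightarrow> 'a ctvec) \<Rightarrow> bool" where
  "unitary_frame n M J g U e \<longleftrightarrow> openin (mtop M) U \<and>
     (\<forall>i\<in>{1..n}. smooth_field10 M J U (e i)) \<and>
     (\<forall>p\<in>U.
        (\<forall>v\<in>T10 M J p. \<exists>a. v = (\<lambda>f. \<Sum>i=1..n. a i * e i p f)) \<and>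
        (\<forall>i\<in>{1..n}. \<forall>j\<in>{1..n}. cmetric g p (e i p) (vcnj (e j p)) = (if i = j then 1 else 0)))"

definition bar :: "('a \<Rightarrow> 'a ctvec) \<Rightarrow> 'a \<Rightarrow> 'a ctvec" where "bar X p = vcnj (X p)"

text \<open>Each summand of the trace is real, because curvature and metric come from real tensors and
  the connection is metric.  The sum does not depend on the unitary frame, so any frame around \<open>p\<close>
  may be used.  For the canonical connection this is the scalar curvature
  \<open>S\<^sup>c\<close>, for the Levi-Civita connection the *-scalar curvature \<open>S\<^sup>*\<close>.\<close>

definition frame_trace :: "nat \<Rightarrow> ('a, 'e::euclidean_space) mfd \<Rightarrow>
    ('a \<Rightarrow> 'a tvec \<Rightarrow> 'a tvec \<Rightarrow> real) \<Rightarrow> 'a conn \<Rightarrow> (nat \<Rightarrow> 'a \<Rightarrow> 'a ctvec) \<Rightarrow> 'a \<Rightarrow> complex" where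
  "frame_trace n M g C e p =
     (\<Sum>l=1..n. \<Sum>m=1..n. curv4 M g C (e l) (bar (e l)) (e m) (bar (e m)) p)"

definition scalar_curv :: "nat \<Rightarrow> ('a, 'e::euclidean_space) mfd \<Rightarrow>
    ('a \<Rightarrow> 'a tvec \<Rightarrow> 'a tvec) \<Rightarrow> ('a \<Rightarrow> 'a tvec \<Rightarrow> 'a tvec \<Rightarrow> real) \<Rightarrow> 'a conn \<Rightarrow> 'a \<Rightarrow> real" where
  "scalar_curv n M J g C p =
     Re (frame_trace n M g C (SOME e. \<exists>U. p \<in> U \<and> unitary_frame n M J g U e) p)"

end

(* Write E(X,Y) = D_X Y - nabla_X Y for the difference of the Levi-Civita and the canonical
   connection and A(X,Y,Z) = <E(X,Y),Z>.  Both connections are metric, so A is skew in Y and Z and is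
   determined by its antisymmetrisation in X and Y, which is minus the torsion of nabla.  The defining
   property of nabla and the quasi Kaehler condition leave only the components of A in which all three
   arguments have the same type.  Differentiating <nabla_X Y, conj Y> and <D_X Y, conj Y> then gives,
   for (1,0)-fields X and Y,
     <R^L(X, conj X)Y, conj Y> - <R(X, conj X)Y, conj Y> = <E(X,Y), conj E(X,Y)> >= 0,
   and the sum over a unitary frame is S^* - S^c.  If S^* = S^c everywhere, then E = 0, so D = nabla
   is torsion free and J is D-parallel: the Nijenhuis tensor vanishes, and the first Bianchi identity
   shows that R(e_k,e_l) conj e_j is of type (1,0), hence R_{i jbar k l} = 0. *)

theory Submission
  imports Defs
begin

section \<open>Calculus of \<open>C\<^sup>k\<close> maps\<close>

text \<open>For (1,0)-fields X and Y the surviving part of E(X,Y) is of type (0,1): neither the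
  condition on mixed torsion nor the (1,2)-part of d omega constrains the component of A with three
  arguments of equal type. This is why the curvature difference is a square. The function <nabla_X
  Y, conj Y> and its derivatives do not notice E, and the cross terms of <D_X Y, conj(D_X Y)> vanish
  because (0,1)-vectors are isotropic; only |E(X,Y)|^2 is left. An obstacle lies in
  \<open>scalar_curv\<close>, which picks its frame by \<open>SOME\<close>: it has the intended
  meaning only once smooth unitary frames are known to exist near every point. The C^k calculus, the
  charts and the Gram-Schmidt process serve mainly this end. Connections act on local fields rather
  than on vectors, so every identity that is differentiated later has to be proved on an open set
  and not just at the point.\<close>

lemma Ck_on_cong:
  assumes "open S" "\<And>x. x \<in> S \<Longrightarrow> f x = g x" "Ck_on k S f"
  shows "Ck_on k S g"
  using assms(2,3)
proof (induction k arbitrary: f g)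
  case 0
  then show ?case using continuous_on_cong[of S S f g] by simp
next
  case (Suc k)
  have fd: "f differentiable at x" if "x \<in> S" for x
    using Suc.prems that by simp
  have eq: "frechet_derivative f (at x) = frechet_derivative g (at x)" if "x \<in> S" for x
    using frechet_derivative_transform_within_open[OF fd[OF that] assms(1) that] Suc.prems by blast
  have "g differentiable at x" if "x \<in> S" for x
    using fd[OF that] has_derivative_transform_within_open[OF _ assms(1) that, of f _ UNIV g] Suc.prems(1)
    unfolding differentiable_def by blast
  moreover have "Ck_on k S (\<lambda>x. frechet_derivative g (at x) w)" for w
    using Suc.IH[of "\<lambda>x. frechet_derivative f (at x) w" "\<lambda>x. frechet_derivative g (at x) w"] eq Suc.prems
    by simp
  ultimately show ?case by simp
qed

text \<open>Lets the inductions below work with an explicit derivative formula, so that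
  \<open>frechet_derivative\<close> of a compound expression never has to be computed.\<close>

lemma Ck_on_SucI:
  assumes "open S" "\<And>x. x \<in> S \<Longrightarrow> (f has_derivative F x) (at x)"
    and "\<And>w. Ck_on k S (\<lambda>x. F x w)"
  shows "Ck_on (Suc k) S f"
proof -
  have "frechet_derivative f (at x) = F x" if "x \<in> S" for x
    using frechet_derivative_at[OF assms(2)[OF that]] by simp
  then have "Ck_on k S (\<lambda>x. frechet_derivative f (at x) w)" for w
    using Ck_on_cong[OF assms(1) _ assms(3)[of w]] by simp
  then show ?thesis using assms(2) by (auto simp: differentiable_def)
qed

lemma Ck_on_Suc_has_derivative:
  "Ck_on (Suc k) S f \<Longrightarrow> x \<in> S \<Longrightarrow> (f has_derivative frechet_derivative f (at x)) (at x)"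
  by (simp add: frechet_derivative_works[symmetric])

lemma Ck_on_Suc_imp: "Ck_on (Suc k) S f \<Longrightarrow> Ck_on k S f"
proof (induction k arbitrary: f)
  case 0
  then show ?case
    by (auto intro!: continuous_at_imp_continuous_on differentiable_imp_continuous_within)
next
  case (Suc k)
  then show ?case by (metis Ck_on.simps(2))
qed

lemma Ck_on_subset: "Ck_on k S f \<Longrightarrow> T \<subseteq> S \<Longrightarrow> Ck_on k T f"
  by (induction k arbitrary: f) (auto intro: continuous_on_subset)

lemma Ck_on_const [simp]: "open S \<Longrightarrow> Ck_on k S (\<lambda>x. c)"
  by (induction k arbitrary: c) simp_all

lemma Ck_on_linear:
  assumes "open S" "bounded_linear L" "Ck_on k S f"
  shows "Ck_on k S (\<lambda>x. L (f x))"
  using assms(3)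
proof (induction k arbitrary: f)
  case 0
  then show ?case using bounded_linear.continuous_on[OF assms(2)] by auto
next
  case (Suc k)
  show ?case
  proof (rule Ck_on_SucI[OF assms(1)])
    show "((\<lambda>x. L (f x)) has_derivative (\<lambda>w. L (frechet_derivative f (at x) w))) (at x)"
      if "x \<in> S" for x
      using bounded_linear.has_derivative[OF assms(2) Ck_on_Suc_has_derivative[OF Suc.prems that]] .
  qed (use Suc in auto)
qed

lemma Ck_on_add:
  assumes "open S" "Ck_on k S f" "Ck_on k S g"
  shows "Ck_on k S (\<lambda>x. f x + g x)"
  using assms(2,3)
proof (induction k arbitrary: f g)
  case 0
  then show ?case by (auto intro: continuous_intros)
next
  case (Suc k)
  show ?case
    by (rule Ck_on_SucI[OF assms(1)
        has_derivative_add[OF Ck_on_Suc_has_derivative[OF Suc.prems(1)]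
          Ck_on_Suc_has_derivative[OF Suc.prems(2)]]]) (use Suc in auto)
qed

lemma Ck_on_scaleR:
  fixes f :: "'e::real_normed_vector \<Rightarrow> real"
  assumes "open S" "Ck_on k S f" "Ck_on k S g"
  shows "Ck_on k S (\<lambda>x. f x *\<^sub>R g x)"
  using assms(2,3)
proof (induction k arbitrary: f g)
  case 0
  then show ?case by (auto intro: continuous_intros)
next
  case (Suc k)
  note low = Suc.prems[THEN Ck_on_Suc_imp]
  show ?case
    by (rule Ck_on_SucI[OF assms(1)
        has_derivative_scaleR[OF Ck_on_Suc_has_derivative[OF Suc.prems(1)]
          Ck_on_Suc_has_derivative[OF Suc.prems(2)]]])
      (use Suc low in \<open>auto intro!: Ck_on_add assms(1)\<close>)
qed

lemma Ck_on_sum: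
  assumes "open S" "\<And>i. i \<in> I \<Longrightarrow> Ck_on k S (f i)"
  shows "Ck_on k S (\<lambda>x. \<Sum>i\<in>I. f i x)"
  using assms(2) by (induction I rule: infinite_finite_induct) (auto intro: Ck_on_add simp: assms(1))

lemma Ck_on_compose:
  fixes G :: "'d::real_normed_vector \<Rightarrow> 'e::euclidean_space"
  assumes "open S" "open T" "G ` S \<subseteq> T" "Ck_on k S G" "Ck_on k T F"
  shows "Ck_on k S (\<lambda>x. F (G x))"
  using assms(4,5)
proof (induction k arbitrary: F)
  case 0
  then show ?case using continuous_on_compose2[of T F S G] assms(3) by simp
next
  case (Suc k)
  note low = Ck_on_Suc_imp[OF Suc.prems(1)]
  let ?DF = "\<lambda>x. frechet_derivative F (at x)" and ?DG = "\<lambda>x. frechet_derivative G (at x)"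
  show ?case
  \<comment> \<open>In the chain rule the direction in which \<open>F\<close> is differentiated
    moves with the point, whereas \<open>Ck_on\<close> speaks of fixed directions only. Expanding
    this direction in \<open>Basis\<close> leaves sums of products with fixed directions, to which
    the induction hypothesis applies.\<close>
  proof (rule Ck_on_SucI[OF assms(1), where F="\<lambda>x w. \<Sum>b\<in>Basis. (?DG x w \<bullet> b) *\<^sub>R ?DF (G x) b"])
    fix x assume x: "x \<in> S"
    have F: "(F has_derivative ?DF (G x)) (at (G x))"
      using Ck_on_Suc_has_derivative[OF Suc.prems(2)] x assms(3) by blast
    have "((\<lambda>x. F (G x)) has_derivative (\<lambda>w. ?DF (G x) (?DG x w))) (at x)"
      using has_derivative_compose[OF Ck_on_Suc_has_derivative[OF Suc.prems(1) x] F] .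
    moreover have "?DF (G x) v = (\<Sum>b\<in>Basis. (v \<bullet> b) *\<^sub>R ?DF (G x) b)" for v
      using linear_sum[OF has_derivative_linear[OF F], of "\<lambda>b. (v \<bullet> b) *\<^sub>R b" Basis]
        linear_scale[OF has_derivative_linear[OF F]] by (simp add: euclidean_representation)
    ultimately show "((\<lambda>x. F (G x)) has_derivative
        (\<lambda>w. \<Sum>b\<in>Basis. (?DG x w \<bullet> b) *\<^sub>R ?DF (G x) b)) (at x)"
      by (rule has_derivative_eq_rhs[OF _ ext])
  next
    fix w
    show "Ck_on k S (\<lambda>x. \<Sum>b\<in>Basis. (?DG x w \<bullet> b) *\<^sub>R ?DF (G x) b)"
    proof (intro Ck_on_sum Ck_on_scaleR assms(1))
      show "Ck_on k S (\<lambda>x. ?DG x w \<bullet> b)" for b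
        by (rule Ck_on_linear[OF assms(1) bounded_linear_inner_left]) (use Suc.prems in simp)
      show "Ck_on k S (\<lambda>x. ?DF (G x) b)" for b
        using Suc.IH[OF low, of "\<lambda>x. ?DF x b"] Suc.prems(2) by simp
    qed
  qed
qed

text \<open>With h = f^(-1/2) the derivative is -1/2 h^3 Df, a polynomial in h and Df, so the
  induction on the order closes. It provides the normalising factor of the Gram-Schmidt
  process.\<close>

lemma Ck_on_inverse_sqrt:
  fixes f :: "'e::real_normed_vector \<Rightarrow> real"
  assumes "open S" "\<And>x. x \<in> S \<Longrightarrow> 0 < f x" "Ck_on k S f"
  shows "Ck_on k S (\<lambda>x. inverse (sqrt (f x)))"
  using assms(3)
proof (induction k)
  case 0
  then show ?case using assms(2)
    by (auto intro!: continuous_intros dest!: less_imp_neq[OF assms(2)])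
next
  case (Suc k)
  let ?h = "\<lambda>x. inverse (sqrt (f x))" and ?Df = "\<lambda>x. frechet_derivative f (at x)"
  have h: "Ck_on k S ?h" by (rule Suc.IH[OF Ck_on_Suc_imp[OF Suc.prems]])
  show ?case
  proof (rule Ck_on_SucI[OF assms(1), where F="\<lambda>x w. (- 1/2) *\<^sub>R (?h x *\<^sub>R ?h x *\<^sub>R ?h x *\<^sub>R ?Df x w)"])
    fix x assume x: "x \<in> S"
    have "((\<lambda>y. inverse (sqrt y)) has_field_derivative - (inverse (sqrt (f x)) * (inverse (sqrt (f x)) / 2) * inverse (sqrt (f x)))) (at (f x))"
      using assms(2)[OF x] by (auto intro!: derivative_eq_intros)
    from has_derivative_compose[OF Ck_on_Suc_has_derivative[OF Suc.prems x], OF this[unfolded has_field_derivative_def]]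
    show "(?h has_derivative (\<lambda>w. (- 1/2) *\<^sub>R (?h x *\<^sub>R ?h x *\<^sub>R ?h x *\<^sub>R ?Df x w))) (at x)"
      by (simp add: mult_ac)
  next
    fix w
    show "Ck_on k S (\<lambda>x. (- 1/2) *\<^sub>R (?h x *\<^sub>R ?h x *\<^sub>R ?h x *\<^sub>R ?Df x w))"
      using Suc.prems by (intro Ck_on_scaleR assms(1) h) (simp_all add: assms(1))
  qed
qed

section \<open>Charts, smooth functions and tangent vectors\<close>

locale smooth_mfd =
  fixes M :: "('a, 'e::euclidean_space) mfd"
  assumes smooth_manifold: "smooth_manifold M"
begin

lemma chart_openin: "(U, \<phi>) \<in> atlas M \<Longrightarrow> openin (mtop M) U"
  and chart_homeomorphic: "(U, \<phi>) \<in> atlas M \<Longrightarrow>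
    homeomorphic_map (subtopology (mtop M) U) (top_of_set (\<phi> ` U)) \<phi>"
  and chart_open_image: "(U, \<phi>) \<in> atlas M \<Longrightarrow> open (\<phi> ` U)"
  using smooth_manifold unfolding smooth_manifold_def by blast+

lemma chart_transition:
  "(U, \<phi>) \<in> atlas M \<Longrightarrow> (V, \<psi>) \<in> atlas M \<Longrightarrow> smooth_on (\<phi> ` (U \<inter> V)) (\<psi> \<circ> inv_into U \<phi>)"
  using smooth_manifold unfolding smooth_manifold_def by blast

lemma chart_at:
  assumes "p \<in> points M"
  obtains U \<phi> where "(U, \<phi>) \<in> atlas M" "p \<in> U"
  using smooth_manifold assms unfolding smooth_manifold_def by blast

lemma chart_inj_on: "(U, \<phi>) \<in> atlas M \<Longrightarrow> inj_on \<phi> U"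
  using homeomorphic_imp_injective_map[OF chart_homeomorphic] chart_openin[THEN openin_subset]
  by (metis topspace_subtopology_subset)

lemma chart_inv [simp]: "(U, \<phi>) \<in> atlas M \<Longrightarrow> p \<in> U \<Longrightarrow> inv_into U \<phi> (\<phi> p) = p"
  by (simp add: chart_inj_on)

lemma chart_image_open:
  assumes "(U, \<phi>) \<in> atlas M" "openin (mtop M) W"
  shows "open (\<phi> ` (U \<inter> W))"
proof -
  have "openin (subtopology (mtop M) U) (U \<inter> W)"
    using assms(2) by (auto simp: openin_subtopology)
  then have "openin (top_of_set (\<phi> ` U)) (\<phi> ` (U \<inter> W))"
    using homeomorphic_imp_open_map[OF chart_homeomorphic[OF assms(1)]] by (simp add: open_map_def)
  then show ?thesis
    using chart_open_image[OF assms(1)] by (simp add: openin_open_eq)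
qed

lemma chart_preimage_openin:
  assumes "(U, \<phi>) \<in> atlas M" "open S"
  shows "openin (mtop M) {q \<in> U. \<phi> q \<in> S}"
proof -
  have "continuous_map (subtopology (mtop M) U) (top_of_set (\<phi> ` U)) \<phi>"
    using chart_homeomorphic[OF assms(1)] homeomorphic_imp_continuous_map by blast
  then have "continuous_map (subtopology (mtop M) U) euclidean \<phi>"
    by (simp add: continuous_map_in_subtopology)
  then have "openin (subtopology (mtop M) U) {x \<in> topspace (subtopology (mtop M) U). \<phi> x \<in> S}"
    using assms(2) openin_continuous_map_preimage by fastforce
  then show ?thesis
    using chart_openin[OF assms(1)] openin_subset openin_trans_full
    by (metis (no_types, lifting) Collect_cong topspace_subtopology_subset)
qed

lemma smooth_fun_cong:
  assumes "openin (mtop M) W" "\<And>q. q \<in> W \<Longrightarrow> f q = h q" "smooth_fun M W f"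
  shows "smooth_fun M W h"
  unfolding smooth_fun_def smooth_on_def
proof clarify
  fix U \<phi> k assume c: "(U, \<phi>) \<in> atlas M"
  then have "Ck_on k (\<phi> ` (U \<inter> W)) (f \<circ> inv_into U \<phi>)"
    using assms(3) by (auto simp: smooth_fun_def smooth_on_def)
  then show "Ck_on k (\<phi> ` (U \<inter> W)) (h \<circ> inv_into U \<phi>)"
    by (rule Ck_on_cong[OF chart_image_open[OF c assms(1)], rotated]) (use c assms(2) in auto)
qed

lemma smooth_fun_subset: "smooth_fun M W f \<Longrightarrow> V \<subseteq> W \<Longrightarrow> smooth_fun M V f"
  unfolding smooth_fun_def smooth_on_def by (blast intro: Ck_on_subset)

lemma smooth_fun_const [simp]: "openin (mtop M) W \<Longrightarrow> smooth_fun M W (\<lambda>q. c)"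
  unfolding smooth_fun_def smooth_on_def by (auto simp: o_def chart_image_open)

lemma smooth_fun_add:
  "openin (mtop M) W \<Longrightarrow> smooth_fun M W f \<Longrightarrow> smooth_fun M W h \<Longrightarrow> smooth_fun M W (\<lambda>q. f q + h q)"
  unfolding smooth_fun_def smooth_on_def by (fastforce simp: o_def chart_image_open intro!: Ck_on_add)

lemma smooth_fun_mult:
  assumes "openin (mtop M) W" "smooth_fun M W f" "smooth_fun M W h"
  shows "smooth_fun M W (\<lambda>q. f q * h q)"
  using assms unfolding smooth_fun_def smooth_on_def real_scaleR_def[symmetric]
  by (fastforce simp: o_def chart_image_open simp del: real_scaleR_def intro!: Ck_on_scaleR)

lemma smooth_fun_diff:
  assumes "openin (mtop M) W" "smooth_fun M W f" "smooth_fun M W h"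
  shows "smooth_fun M W (\<lambda>q. f q - h q)"
  using smooth_fun_add[OF assms(1,2) smooth_fun_mult[OF assms(1) smooth_fun_const[OF assms(1), of "-1"] assms(3)]]
  by simp

lemma smooth_fun_inverse_sqrt:
  assumes "openin (mtop M) W" "smooth_fun M W f" "\<And>q. q \<in> W \<Longrightarrow> 0 < f q"
  shows "smooth_fun M W (\<lambda>q. inverse (sqrt (f q)))"
  unfolding smooth_fun_def smooth_on_def
proof clarify
  fix U \<phi> k assume c: "(U, \<phi>) \<in> atlas M"
  then have "Ck_on k (\<phi> ` (U \<inter> W)) (f \<circ> inv_into U \<phi>)"
    using assms(2) by (auto simp: smooth_fun_def smooth_on_def)
  then show "Ck_on k (\<phi> ` (U \<inter> W)) ((\<lambda>q. inverse (sqrt (f q))) \<circ> inv_into U \<phi>)"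
    using Ck_on_inverse_sqrt[OF chart_image_open[OF c assms(1)] _, of "f \<circ> inv_into U \<phi>" k] c assms(3)
    by (force simp: o_def)
qed

text \<open>Used to shrink a neighbourhood until a squared length that is positive at one point is
  positive throughout.\<close>

lemma openin_pos:
  assumes W: "openin (mtop M) W" and f: "smooth_fun M W f"
  shows "openin (mtop M) {q \<in> W. 0 < f q}"
proof (subst openin_subopen, intro ballI)
  fix p assume p: "p \<in> {q \<in> W. 0 < f q}"
  then have "p \<in> points M" using openin_subset[OF W] by auto
  then obtain U \<phi> where c: "(U, \<phi>) \<in> atlas M" "p \<in> U" by (rule chart_at)
  let ?S = "\<phi> ` (U \<inter> W)" and ?F = "f \<circ> inv_into U \<phi>"
  have S: "open ?S" by (rule chart_image_open[OF c(1) W])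
  have "continuous_on ?S ?F"
    using f c(1) unfolding smooth_fun_def smooth_on_def
    by (metis (no_types, lifting) Ck_on.simps(1) case_prodD)
  then have "open {x \<in> ?S. 0 < ?F x}"
    using continuous_openin_preimage_gen[of ?S ?F "{0<..}"] openin_open_eq[OF S]
    by (simp add: vimage_def Collect_conj_eq[symmetric] Int_def)
  then have "openin (mtop M) {q \<in> U. \<phi> q \<in> {x \<in> ?S. 0 < ?F x}}"
    by (rule chart_preimage_openin[OF c(1)])
  moreover have "{q \<in> U. \<phi> q \<in> {x \<in> ?S. 0 < ?F x}} \<subseteq> {q \<in> W. 0 < f q}"
    using c(1) by (auto dest!: inj_onD[OF chart_inj_on[OF c(1)]])
  moreover have "p \<in> {q \<in> U. \<phi> q \<in> {x \<in> ?S. 0 < ?F x}}" using c p by auto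
  ultimately show "\<exists>T. openin (mtop M) T \<and> p \<in> T \<and> T \<subseteq> {q \<in> W. 0 < f q}" by blast
qed

lemma smooth_nearI: "openin (mtop M) W \<Longrightarrow> p \<in> W \<Longrightarrow> smooth_fun M W f \<Longrightarrow> smooth_near M p f"
  unfolding smooth_near_def by blast

lemma smooth_near2:
  assumes "smooth_near M p f" "smooth_near M p h"
  obtains W where "openin (mtop M) W" "p \<in> W" "smooth_fun M W f" "smooth_fun M W h"
proof -
  obtain V W where *: "openin (mtop M) V" "p \<in> V" "smooth_fun M V f"
    "openin (mtop M) W" "p \<in> W" "smooth_fun M W h"
    using assms unfolding smooth_near_def by blast
  show thesis
    using * by (intro that[of "V \<inter> W"] openin_Int) (auto intro: smooth_fun_subset)
qed

lemma chart_derivative: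
  assumes "(U, \<phi>) \<in> atlas M" "p \<in> U" "smooth_near M p f"
  shows "((f \<circ> inv_into U \<phi>) has_derivative frechet_derivative (f \<circ> inv_into U \<phi>) (at (\<phi> p))) (at (\<phi> p))"
proof -
  obtain W where W: "openin (mtop M) W" "p \<in> W" "smooth_fun M W f"
    using assms(3) unfolding smooth_near_def by blast
  have "Ck_on (Suc 0) (\<phi> ` (U \<inter> W)) (f \<circ> inv_into U \<phi>)"
    using W(3) assms(1) unfolding smooth_fun_def smooth_on_def by blast
  then show ?thesis
    by (rule Ck_on_Suc_has_derivative) (use assms W in auto)
qed

lemma dir_deriv_add:
  assumes "(U, \<phi>) \<in> atlas M" "p \<in> U" "smooth_near M p f" "smooth_near M p h"
  shows "dir_deriv M (U, \<phi>) p w (\<lambda>q. f q + h q) = dir_deriv M (U, \<phi>) p w f + dir_deriv M (U, \<phi>) p w h"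
proof -
  have "smooth_near M p (\<lambda>q. f q + h q)"
    by (rule smooth_near2[OF assms(3,4)]) (auto intro: smooth_nearI smooth_fun_add)
  moreover have "frechet_derivative ((\<lambda>q. f q + h q) \<circ> inv_into U \<phi>) (at (\<phi> p)) =
     (\<lambda>w. frechet_derivative (f \<circ> inv_into U \<phi>) (at (\<phi> p)) w + frechet_derivative (h \<circ> inv_into U \<phi>) (at (\<phi> p)) w)"
    using frechet_derivative_at[OF has_derivative_add[OF chart_derivative[OF assms(1-3)] chart_derivative[OF assms(1,2,4)]]]
    by (simp add: o_def)
  ultimately show ?thesis using assms by (simp add: dir_deriv_def)
qed

lemma tangent_space_cases:
  assumes "v \<in> tangent_space M p"
  obtains U \<phi> w where "(U, \<phi>) \<in> atlas M" "p \<in> U" "v = dir_deriv M (U, \<phi>) p w"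
  using assms unfolding tangent_space_def by auto

lemma tangent_add:
  assumes "v \<in> tangent_space M p" "smooth_near M p f" "smooth_near M p h"
  shows "v (\<lambda>q. f q + h q) = v f + v h"
  using assms by (elim tangent_space_cases) (simp add: dir_deriv_add)

lemma smooth_near_const [simp]: "p \<in> points M \<Longrightarrow> smooth_near M p (\<lambda>q. c)"
  by (rule smooth_nearI[OF openin_topspace]) auto

lemma tangent_points: "v \<in> tangent_space M p \<Longrightarrow> p \<in> points M"
  using chart_openin openin_subset by (elim tangent_space_cases) blast

lemma tangent_const:
  assumes "v \<in> tangent_space M p"
  shows "v (\<lambda>q. c) = 0"
  using assms tangent_points[OF assms]
  by (elim tangent_space_cases) (simp add: dir_deriv_def o_def)

lemma tangent_diff:
  assumes "v \<in> tangent_space M p" "smooth_near M p f" "smooth_near M p h"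
  shows "v (\<lambda>q. f q - h q) = v f - v h"
proof -
  obtain W where W: "openin (mtop M) W" "p \<in> W" "smooth_fun M W f" "smooth_fun M W h"
    by (rule smooth_near2[OF assms(2,3)])
  have "smooth_near M p (\<lambda>q. f q - h q)"
    using W by (intro smooth_nearI smooth_fun_diff)
  then have "v (\<lambda>q. (f q - h q) + h q) = v (\<lambda>q. f q - h q) + v h"
    by (intro tangent_add[OF assms(1) _ assms(3)])
  then show ?thesis by simp
qed

lemma smooth_near_cong:
  assumes "openin (mtop M) W" "p \<in> W" "\<And>q. q \<in> W \<Longrightarrow> f q = h q" "smooth_near M p f"
  shows "smooth_near M p h"
proof -
  obtain V where V: "openin (mtop M) V" "p \<in> V" "smooth_fun M V f"
    using assms(4) unfolding smooth_near_def by blast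
  have VW: "openin (mtop M) (V \<inter> W)" using V(1) assms(1) by blast
  have "smooth_fun M (V \<inter> W) h"
    by (rule smooth_fun_cong[OF VW _ smooth_fun_subset[OF V(3)]]) (use assms(3) in auto)
  then show ?thesis using V VW assms(2) by (auto intro: smooth_nearI)
qed

lemma dir_deriv_cong:
  assumes "(U, \<phi>) \<in> atlas M" "p \<in> U" "openin (mtop M) W" "p \<in> W" "\<And>q. q \<in> W \<Longrightarrow> f q = h q"
  shows "dir_deriv M (U, \<phi>) p w f = dir_deriv M (U, \<phi>) p w h"
proof (cases "smooth_near M p f")
  case True
  have O: "open (\<phi> ` (U \<inter> W))" by (rule chart_image_open[OF assms(1,3)])
  have "frechet_derivative (f \<circ> inv_into U \<phi>) (at (\<phi> p)) = frechet_derivative (h \<circ> inv_into U \<phi>) (at (\<phi> p))"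
    by (rule frechet_derivative_transform_within_open[OF _ O])
      (use assms chart_derivative[OF assms(1,2) True] in \<open>auto simp: differentiable_def\<close>)
  then show ?thesis
    using True smooth_near_cong[OF assms(3-5) True] by (simp add: dir_deriv_def)
next
  \<comment> \<open>Smoothness near \<open>p\<close> depends only on the values near
    \<open>p\<close>, so \<open>h\<close> is not smooth there either and both sides take the default
    value 0.\<close>
  case False
  then show ?thesis
    using smooth_near_cong[OF assms(3,4), of h f] assms(5) by (auto simp: dir_deriv_def)
qed

lemma tangent_cong:
  assumes "v \<in> tangent_space M p" "openin (mtop M) W" "p \<in> W" "\<And>q. q \<in> W \<Longrightarrow> f q = h q"
  shows "v f = v h"
  using assms by (elim tangent_space_cases) (simp add: dir_deriv_cong[of _ _ p W f h])

text \<open>Chain rule for the transition map. The definition of \<open>tangent_space\<close> lets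
  the chart vary with the vector; with this rule all vectors at a point can be written in one chart,
  which makes sums of tangent vectors tangent.\<close>

lemma dir_deriv_change_chart:
  assumes c: "(U, \<phi>) \<in> atlas M" "p \<in> U" and c': "(V, \<psi>) \<in> atlas M" "p \<in> V"
  shows "dir_deriv M (V, \<psi>) p w =
    dir_deriv M (U, \<phi>) p (frechet_derivative (\<phi> \<circ> inv_into V \<psi>) (at (\<psi> p)) w)"
proof
  fix f
  show "dir_deriv M (V, \<psi>) p w f =
    dir_deriv M (U, \<phi>) p (frechet_derivative (\<phi> \<circ> inv_into V \<psi>) (at (\<psi> p)) w) f"
  proof (cases "smooth_near M p f")
    case True
    let ?G = "\<phi> \<circ> inv_into V \<psi>" and ?F = "f \<circ> inv_into U \<phi>"
    have S: "open (\<psi> ` (V \<inter> U))" by (rule chart_image_open[OF c'(1) chart_openin[OF c(1)]])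
    have "Ck_on (Suc 0) (\<psi> ` (V \<inter> U)) ?G"
      using chart_transition[OF c'(1) c(1)] unfolding smooth_on_def by blast
    then have G: "(?G has_derivative frechet_derivative ?G (at (\<psi> p))) (at (\<psi> p))"
      by (rule Ck_on_Suc_has_derivative) (use c c' in auto)
    have Gp: "?G (\<psi> p) = \<phi> p" using c' by simp
    have "((\<lambda>x. ?F (?G x)) has_derivative
        (\<lambda>w. frechet_derivative ?F (at (\<phi> p)) (frechet_derivative ?G (at (\<psi> p)) w))) (at (\<psi> p))"
      by (rule has_derivative_compose[OF G]) (use chart_derivative[OF c True] Gp in \<open>simp only:\<close>)
    then have "((f \<circ> inv_into V \<psi>) has_derivative
        (\<lambda>w. frechet_derivative ?F (at (\<phi> p)) (frechet_derivative ?G (at (\<psi> p)) w))) (at (\<psi> p))"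
      by (rule has_derivative_transform_within_open[OF _ S]) (use c c' in auto)
    from fun_cong[OF frechet_derivative_at[OF this], of w] show ?thesis
      using True by (simp add: dir_deriv_def)
  qed (simp add: dir_deriv_def)
qed

lemma tangent_space_chart:
  assumes "(U, \<phi>) \<in> atlas M" "p \<in> U"
  shows "tangent_space M p = range (dir_deriv M (U, \<phi>) p)"
proof
  show "tangent_space M p \<subseteq> range (dir_deriv M (U, \<phi>) p)"
    using dir_deriv_change_chart[OF assms] by (auto elim!: tangent_space_cases)
  show "range (dir_deriv M (U, \<phi>) p) \<subseteq> tangent_space M p"
    using assms unfolding tangent_space_def by fastforce
qed

lemma dir_deriv_lincomb:
  assumes "(U, \<phi>) \<in> atlas M" "p \<in> U"
  shows "dir_deriv M (U, \<phi>) p (a *\<^sub>R u + b *\<^sub>R w) =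
    (\<lambda>f. a * dir_deriv M (U, \<phi>) p u f + b * dir_deriv M (U, \<phi>) p w f)"
proof
  fix f
  show "dir_deriv M (U, \<phi>) p (a *\<^sub>R u + b *\<^sub>R w) f =
    a * dir_deriv M (U, \<phi>) p u f + b * dir_deriv M (U, \<phi>) p w f"
  proof (cases "smooth_near M p f")
    case True
    have "linear (frechet_derivative (f \<circ> inv_into U \<phi>) (at (\<phi> p)))"
      using chart_derivative[OF assms True] has_derivative_linear by blast
    then show ?thesis using True by (simp add: dir_deriv_def linear_add linear_scale)
  qed (simp add: dir_deriv_def)
qed

lemma tangent_lincomb:
  assumes "u \<in> tangent_space M p" "v \<in> tangent_space M p"
  shows "(\<lambda>f. a * u f + b * v f) \<in> tangent_space M p"
proof -
  obtain U \<phi> where c: "(U, \<phi>) \<in> atlas M" "p \<in> U"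
    using chart_at[OF tangent_points[OF assms(1)]] .
  show ?thesis
    using assms unfolding tangent_space_chart[OF c] by (auto simp flip: dir_deriv_lincomb[OF c])
qed

lemma tangent_zero: "p \<in> points M \<Longrightarrow> (\<lambda>f. 0) \<in> tangent_space M p"
proof -
  assume "p \<in> points M"
  then obtain U \<phi> where c: "(U, \<phi>) \<in> atlas M" "p \<in> U" by (rule chart_at)
  show ?thesis
    using tangent_lincomb[of "dir_deriv M (U, \<phi>) p 0" p "dir_deriv M (U, \<phi>) p 0" 0 0]
      tangent_space_chart[OF c] by simp
qed

section \<open>Coordinate functions and coordinate fields\<close>

lemma coordinate_smooth:
  assumes "(U, \<phi>) \<in> atlas M"
  shows "smooth_fun M U (\<lambda>q. \<phi> q \<bullet> b)"
  unfolding smooth_fun_def smooth_on_def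
proof clarify
  fix V \<psi> k assume c: "(V, \<psi>) \<in> atlas M"
  have "Ck_on k (\<psi> ` (V \<inter> U)) (\<lambda>x. (\<phi> \<circ> inv_into V \<psi>) x \<bullet> b)"
    using chart_transition[OF c assms] chart_image_open[OF c chart_openin[OF assms]]
    by (intro Ck_on_linear[OF _ bounded_linear_inner_left]) (simp_all add: smooth_on_def o_def)
  then show "Ck_on k (\<psi> ` (V \<inter> U)) ((\<lambda>q. \<phi> q \<bullet> b) \<circ> inv_into V \<psi>)" by (simp add: o_def)
qed

lemma dir_deriv_coordinate:
  assumes c: "(U, \<phi>) \<in> atlas M" "p \<in> U"
  shows "dir_deriv M (U, \<phi>) p w (\<lambda>q. \<phi> q \<bullet> b) = w \<bullet> b"
proof -
  have "smooth_near M p (\<lambda>q. \<phi> q \<bullet> b)"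
    using smooth_nearI[OF chart_openin[OF c(1)] c(2) coordinate_smooth[OF c(1)]] .
  moreover have "((\<lambda>x. x \<bullet> b) has_derivative (\<lambda>w. w \<bullet> b)) (at (\<phi> p))"
    by (auto intro!: derivative_eq_intros)
  then have "(((\<lambda>q. \<phi> q \<bullet> b) \<circ> inv_into U \<phi>) has_derivative (\<lambda>w. w \<bullet> b)) (at (\<phi> p))"
    by (rule has_derivative_transform_within_open[OF _ chart_open_image[OF c(1)]]) (use c in \<open>auto simp: f_inv_into_f\<close>)
  from frechet_derivative_at[OF this]
  have "frechet_derivative ((\<lambda>q. \<phi> q \<bullet> b) \<circ> inv_into U \<phi>) (at (\<phi> p)) = (\<lambda>w. w \<bullet> b)" ..
  ultimately show ?thesis by (simp add: dir_deriv_def)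
qed

text \<open>The coordinate functions read off the components of the direction. Injectivity is what
  makes the tangent space as large as the model space in the later dimension count.\<close>

lemma dir_deriv_inj:
  assumes "(U, \<phi>) \<in> atlas M" "p \<in> U"
  shows "inj (dir_deriv M (U, \<phi>) p)"
proof (rule injI)
  fix u w assume "dir_deriv M (U, \<phi>) p u = dir_deriv M (U, \<phi>) p w"
  then have "u \<bullet> b = w \<bullet> b" for b
    using dir_deriv_coordinate[OF assms] by metis
  then show "u = w" by (rule euclidean_eqI)
qed

lemma smooth_fieldD: "smooth_field M U X \<Longrightarrow> p \<in> U \<Longrightarrow> X p \<in> tangent_space M p"
  by (simp add: smooth_field_def)

lemma smooth_field_apply:
  "smooth_field M U X \<Longrightarrow> openin (mtop M) V \<Longrightarrow> V \<subseteq> U \<Longrightarrow> smooth_fun M V f \<Longrightarrow> smooth_fun M V (\<lambda>p. X p f)"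
  by (simp add: smooth_field_def)

lemma smooth_field_subset: "smooth_field M U X \<Longrightarrow> V \<subseteq> U \<Longrightarrow> smooth_field M V X"
  by (auto simp: smooth_field_def)

lemma smooth_field_cong:
  assumes "\<And>q. q \<in> U \<Longrightarrow> X q = Y q" "smooth_field M U X"
  shows "smooth_field M U Y"
  unfolding smooth_field_def
proof (intro conjI ballI allI impI)
  fix p assume "p \<in> U" then show "Y p \<in> tangent_space M p" using assms smooth_fieldD by metis
next
  fix V f assume V: "openin (mtop M) V \<and> V \<subseteq> U \<and> smooth_fun M V f"
  then show "smooth_fun M V (\<lambda>p. Y p f)"
    using smooth_fun_cong[of V "\<lambda>p. X p f" "\<lambda>p. Y p f"] smooth_field_apply[OF assms(2)] assms(1)
    by (simp add: subset_iff)
qed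

lemma smooth_field_lincomb:
  assumes "openin (mtop M) U" "smooth_fun M U a" "smooth_fun M U b" "smooth_field M U X" "smooth_field M U Y"
  shows "smooth_field M U (\<lambda>p f. a p * X p f + b p * Y p f)"
  unfolding smooth_field_def
proof (intro conjI ballI allI impI)
  fix p assume "p \<in> U"
  then show "(\<lambda>f. a p * X p f + b p * Y p f) \<in> tangent_space M p"
    using assms(4,5) by (intro tangent_lincomb smooth_fieldD) 
next
  fix V f assume V: "openin (mtop M) V \<and> V \<subseteq> U \<and> smooth_fun M V f"
  then show "smooth_fun M V (\<lambda>p. a p * X p f + b p * Y p f)"
    using assms(2-5) by (intro smooth_fun_add smooth_fun_mult) (auto intro: smooth_fun_subset smooth_field_apply)
qed

lemma smooth_field_coordinate:
  assumes c: "(U, \<phi>) \<in> atlas M"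
  shows "smooth_field M U (\<lambda>q. dir_deriv M (U, \<phi>) q w)"
  unfolding smooth_field_def
proof (intro conjI ballI allI impI)
  fix p assume "p \<in> U" then show "dir_deriv M (U, \<phi>) p w \<in> tangent_space M p"
    using tangent_space_chart[OF c] by blast
next
  fix V f assume "openin (mtop M) V \<and> V \<subseteq> U \<and> smooth_fun M V f"
  then have V: "openin (mtop M) V" "V \<subseteq> U" "smooth_fun M V f" by auto
  let ?F = "\<lambda>y. frechet_derivative (f \<circ> inv_into U \<phi>) (at y) w"
  have "smooth_fun M V (\<lambda>q. ?F (\<phi> q))"
    unfolding smooth_fun_def smooth_on_def
  proof clarify
    fix U' \<psi> k assume c': "(U', \<psi>) \<in> atlas M"
    \<comment> \<open>\<open>f\<close> is smooth of every order, so one order can be spent on the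
      derivative in direction \<open>w\<close>.\<close>
    have "Ck_on (Suc k) (\<phi> ` (U \<inter> V)) (f \<circ> inv_into U \<phi>)"
      using V(3) c unfolding smooth_fun_def smooth_on_def by blast
    then have F: "Ck_on k (\<phi> ` (U \<inter> V)) ?F" by simp
    have G: "Ck_on k (\<psi> ` (U' \<inter> V)) (\<phi> \<circ> inv_into U' \<psi>)"
      using chart_transition[OF c' c] V(2) unfolding smooth_on_def
      by (meson Ck_on_subset Int_mono image_mono order_refl)
    show "Ck_on k (\<psi> ` (U' \<inter> V)) ((\<lambda>q. ?F (\<phi> q)) \<circ> inv_into U' \<psi>)"
      unfolding o_def
      by (rule Ck_on_compose[OF chart_image_open[OF c' V(1)] chart_image_open[OF c V(1)] _ G F,
            unfolded o_def]) (use V(2) c' in auto)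
  qed
  then show "smooth_fun M V (\<lambda>p. dir_deriv M (U, \<phi>) p w f)"
    by (rule smooth_fun_cong[OF V(1), rotated]) (use V smooth_nearI in \<open>auto simp: dir_deriv_def\<close>)
qed

text \<open>Fields are local, so constant coefficients in a chart do and no cut-off function is
  involved.\<close>

lemma tangent_extend:
  assumes "v \<in> tangent_space M p"
  obtains U X where "openin (mtop M) U" "p \<in> U" "smooth_field M U X" "X p = v"
proof -
  obtain U \<phi> w where c: "(U, \<phi>) \<in> atlas M" "p \<in> U" "v = dir_deriv M (U, \<phi>) p w"
    using assms by (rule tangent_space_cases)
  show thesis
    by (rule that[OF chart_openin[OF c(1)] c(2) smooth_field_coordinate[OF c(1), of w]]) (simp add: c(3))
qed

end

section \<open>Complex vector fields and connections\<close>

lemma vRe_vcnj [simp]: "vRe (vcnj v) = vRe v" and vIm_vcnj: "vIm (vcnj v) = (\<lambda>f. - vIm v f)"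
  and vcnj_vcnj [simp]: "vcnj (vcnj v) = v"
  by (simp_all add: vRe_def vIm_def vcnj_def)

lemma ctvec_eqI: "vRe u = vRe v \<Longrightarrow> vIm u = vIm v \<Longrightarrow> u = v"
  by (auto simp: vRe_def vIm_def fun_eq_iff complex_eq_iff)

lemma vRe_cJ [simp]: "vRe (cJ J p v) = J p (vRe v)" and vIm_cJ [simp]: "vIm (cJ J p v) = J p (vIm v)"
  by (simp_all add: vRe_def vIm_def cJ_def)

lemma vRe_zero [simp]: "vRe (\<lambda>f. 0) = (\<lambda>f. 0)" and vIm_zero [simp]: "vIm (\<lambda>f. 0) = (\<lambda>f. 0)"
  by (simp_all add: vRe_def vIm_def)

text \<open>The factors 1 keep the right sides nested instances of the two-term pattern
  \<open>a * u f + b * v f\<close>, in which linearity of connections, of \<open>J\<close> and of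
  \<open>g\<close> is stated; rewriting can then take them apart.\<close>

lemma vRe_lincomb: "vRe (\<lambda>f. a * u f + b * v f) =
    (\<lambda>f. 1 * (Re a * vRe u f + (- Im a) * vIm u f) + 1 * (Re b * vRe v f + (- Im b) * vIm v f))"
  and vIm_lincomb: "vIm (\<lambda>f. a * u f + b * v f) =
    (\<lambda>f. 1 * (Re a * vIm u f + Im a * vRe u f) + 1 * (Re b * vIm v f + Im b * vRe v f))"
  by (simp_all add: vRe_def vIm_def)

lemma vRe_cconn: "vRe (cconn C p v Y) =
    (\<lambda>f. 1 * C p (vRe v) (\<lambda>q. vRe (Y q)) f + (-1) * C p (vIm v) (\<lambda>q. vIm (Y q)) f)"
  and vIm_cconn: "vIm (cconn C p v Y) =
    (\<lambda>f. 1 * C p (vRe v) (\<lambda>q. vIm (Y q)) f + 1 * C p (vIm v) (\<lambda>q. vRe (Y q)) f)"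
  by (simp_all add: vRe_def vIm_def cconn_def)

definition T01 :: "('a, 'e::euclidean_space) mfd \<Rightarrow>
    ('a \<Rightarrow> 'a tvec \<Rightarrow> 'a tvec) \<Rightarrow> 'a \<Rightarrow> 'a ctvec set" where
  "T01 M J p = {v \<in> ctangent_space M p. cJ J p v = (\<lambda>f. - \<i> * v f)}"

definition csmooth_fun :: "('a, 'e::euclidean_space) mfd \<Rightarrow> 'a set \<Rightarrow> ('a \<Rightarrow> complex) \<Rightarrow> bool" where
  "csmooth_fun M U h \<longleftrightarrow> smooth_fun M U (\<lambda>q. Re (h q)) \<and> smooth_fun M U (\<lambda>q. Im (h q))"

context smooth_mfd
begin

lemma ctangent_lincomb:
  "u \<in> ctangent_space M p \<Longrightarrow> v \<in> ctangent_space M p \<Longrightarrow> (\<lambda>f. a * u f + b * v f) \<in> ctangent_space M p"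
  unfolding ctangent_space_def mem_Collect_eq vRe_lincomb vIm_lincomb
  by (intro conjI tangent_lincomb) auto

lemma ctangent_zero: "p \<in> points M \<Longrightarrow> (\<lambda>f. 0) \<in> ctangent_space M p"
  by (simp add: ctangent_space_def tangent_zero)

lemma ctangent_add:
  "u \<in> ctangent_space M p \<Longrightarrow> v \<in> ctangent_space M p \<Longrightarrow> (\<lambda>f. u f + v f) \<in> ctangent_space M p"
  using ctangent_lincomb[of u p v 1 1] by simp

lemma ctangent_diff:
  "u \<in> ctangent_space M p \<Longrightarrow> v \<in> ctangent_space M p \<Longrightarrow> (\<lambda>f. u f - v f) \<in> ctangent_space M p"
  using ctangent_lincomb[of u p v 1 "-1"] by simp

lemma ctangent_scale: "u \<in> ctangent_space M p \<Longrightarrow> (\<lambda>f. a * u f) \<in> ctangent_space M p"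
  using ctangent_lincomb[of u p u a 0] by simp

lemma tangent_minus: "u \<in> tangent_space M p \<Longrightarrow> (\<lambda>f. - u f) \<in> tangent_space M p"
  using tangent_lincomb[of u p u "-1" 0] by simp

lemma ctangent_vcnj: "u \<in> ctangent_space M p \<Longrightarrow> vcnj u \<in> ctangent_space M p"
  by (auto simp: ctangent_space_def vIm_vcnj tangent_minus)

lemma ctangent_points: "u \<in> ctangent_space M p \<Longrightarrow> p \<in> points M"
  by (auto simp: ctangent_space_def tangent_points)

lemma csmooth_fun_const [simp]: "openin (mtop M) U \<Longrightarrow> csmooth_fun M U (\<lambda>q. c)"
  by (simp add: csmooth_fun_def)

lemma csmooth_fun_uminus: "openin (mtop M) U \<Longrightarrow> csmooth_fun M U h \<Longrightarrow> csmooth_fun M U (\<lambda>q. - h q)"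
  using smooth_fun_diff[of U "\<lambda>q. 0"] by (simp add: csmooth_fun_def)

lemma csmooth_fun_add:
  "openin (mtop M) U \<Longrightarrow> csmooth_fun M U h \<Longrightarrow> csmooth_fun M U k \<Longrightarrow> csmooth_fun M U (\<lambda>q. h q + k q)"
  by (simp add: csmooth_fun_def smooth_fun_add)

lemma csmooth_fun_i: "openin (mtop M) U \<Longrightarrow> csmooth_fun M U h \<Longrightarrow> csmooth_fun M U (\<lambda>q. \<i> * h q)"
  using smooth_fun_diff[of U "\<lambda>q. 0"] by (simp add: csmooth_fun_def)

lemma smooth_cfield_ctangent: "smooth_cfield M U X \<Longrightarrow> p \<in> U \<Longrightarrow> X p \<in> ctangent_space M p"
  using smooth_fieldD[of U "\<lambda>p. vRe (X p)" p] smooth_fieldD[of U "\<lambda>p. vIm (X p)" p]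
  by (simp add: smooth_cfield_def ctangent_space_def)

lemma smooth_cfield_subset: "smooth_cfield M U X \<Longrightarrow> V \<subseteq> U \<Longrightarrow> smooth_cfield M V X"
  by (auto simp: smooth_cfield_def intro: smooth_field_subset)

lemma smooth_cfield_cong:
  "(\<And>q. q \<in> U \<Longrightarrow> X q = Y q) \<Longrightarrow> smooth_cfield M U X \<Longrightarrow> smooth_cfield M U Y"
  using smooth_field_cong[of U "\<lambda>p. vRe (X p)" "\<lambda>p. vRe (Y p)"]
    smooth_field_cong[of U "\<lambda>p. vIm (X p)" "\<lambda>p. vIm (Y p)"]
  by (simp add: smooth_cfield_def)

lemma smooth_cfield_lincomb:
  assumes "openin (mtop M) U" "csmooth_fun M U a" "csmooth_fun M U b" "smooth_cfield M U X" "smooth_cfield M U Y"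
  shows "smooth_cfield M U (\<lambda>p f. a p * X p f + b p * Y p f)"
proof -
  have "smooth_fun M U (\<lambda>q. - Im (a q))" "smooth_fun M U (\<lambda>q. - Im (b q))"
    using csmooth_fun_uminus[OF assms(1,2)] csmooth_fun_uminus[OF assms(1,3)] by (auto simp: csmooth_fun_def)
  then show ?thesis
    using assms(2-5) unfolding smooth_cfield_def vRe_lincomb vIm_lincomb csmooth_fun_def
    by (intro conjI smooth_field_lincomb smooth_fun_const assms(1)) auto
qed

lemma smooth_cfield_add:
  "openin (mtop M) U \<Longrightarrow> smooth_cfield M U X \<Longrightarrow> smooth_cfield M U Y \<Longrightarrow> smooth_cfield M U (\<lambda>p f. X p f + Y p f)"
  using smooth_cfield_lincomb[of U "\<lambda>q. 1" "\<lambda>q. 1" X Y] by simp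

lemma smooth_cfield_diff:
  "openin (mtop M) U \<Longrightarrow> smooth_cfield M U X \<Longrightarrow> smooth_cfield M U Y \<Longrightarrow> smooth_cfield M U (\<lambda>p f. X p f - Y p f)"
  using smooth_cfield_lincomb[of U "\<lambda>q. 1" "\<lambda>q. -1" X Y] by simp

lemma smooth_cfield_scale:
  "openin (mtop M) U \<Longrightarrow> csmooth_fun M U a \<Longrightarrow> smooth_cfield M U X \<Longrightarrow> smooth_cfield M U (\<lambda>p f. a p * X p f)"
  using smooth_cfield_lincomb[of U a "\<lambda>q. 0" X X] by simp

lemma smooth_field_minus: "openin (mtop M) U \<Longrightarrow> smooth_field M U X \<Longrightarrow> smooth_field M U (\<lambda>p f. - X p f)"
  using smooth_field_lincomb[of U "\<lambda>q. -1" "\<lambda>q. 0" X X] by simp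

lemma smooth_cfield_vcnj:
  "openin (mtop M) U \<Longrightarrow> smooth_cfield M U X \<Longrightarrow> smooth_cfield M U (\<lambda>p. vcnj (X p))"
  by (simp add: smooth_cfield_def vIm_vcnj smooth_field_minus)

lemma smooth_cfield_real:
  assumes "openin (mtop M) U" "smooth_field M U X"
  shows "smooth_cfield M U (\<lambda>p f. complex_of_real (X p f))"
  using smooth_field_lincomb[of U "\<lambda>q. 0" "\<lambda>q. 0" X X] assms
  by (simp add: smooth_cfield_def vRe_def vIm_def)

lemma ctangent_extend:
  assumes "v \<in> ctangent_space M p"
  obtains U X where "openin (mtop M) U" "p \<in> U" "smooth_cfield M U X" "X p = v"
proof -
  obtain U X where X: "openin (mtop M) U" "p \<in> U" "smooth_field M U X" "X p = vRe v"
    using assms unfolding ctangent_space_def by (blast elim: tangent_extend)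
  obtain V Y where Y: "openin (mtop M) V" "p \<in> V" "smooth_field M V Y" "Y p = vIm v"
    using assms unfolding ctangent_space_def by (blast elim: tangent_extend)
  have UV: "openin (mtop M) (U \<inter> V)" using X Y by blast
  show thesis
  proof
    show "smooth_cfield M (U \<inter> V) (\<lambda>q f. 1 * complex_of_real (X q f) + \<i> * complex_of_real (Y q f))"
      using X Y by (intro smooth_cfield_lincomb smooth_cfield_real UV csmooth_fun_const)
        (auto intro: smooth_field_subset)
    show "(\<lambda>f. 1 * complex_of_real (X p f) + \<i> * complex_of_real (Y p f)) = v"
      by (auto simp: X Y vRe_def vIm_def complex_eq_iff)
  qed (use X Y UV in auto)
qed

section \<open>Derivatives of complex-valued functions\<close>

lemma vapply_cong:
  assumes "v \<in> ctangent_space M p" "openin (mtop M) W" "p \<in> W" "\<And>q. q \<in> W \<Longrightarrow> h q = k q"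
  shows "vapply v h = vapply v k"
proof -
  have "v f = v f'" if "\<And>q. q \<in> W \<Longrightarrow> f q = f' q" for f f'
    using tangent_cong[OF _ assms(2,3) that, of "vRe v"] tangent_cong[OF _ assms(2,3) that, of "vIm v"] assms(1)
    by (simp add: ctangent_space_def vRe_def vIm_def complex_eq_iff)
  from this[of "\<lambda>q. Re (h q)" "\<lambda>q. Re (k q)"] this[of "\<lambda>q. Im (h q)" "\<lambda>q. Im (k q)"]
  show ?thesis by (simp add: vapply_def assms(4))
qed

lemma ctangent_apply_add:
  assumes "v \<in> ctangent_space M p" "smooth_near M p f" "smooth_near M p h"
  shows "v (\<lambda>q. f q + h q) = v f + v h"
  using assms tangent_add[of "vRe v" p f h] tangent_add[of "vIm v" p f h]
  by (simp add: ctangent_space_def vRe_def vIm_def complex_eq_iff)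

lemma ctangent_apply_diff:
  assumes "v \<in> ctangent_space M p" "smooth_near M p f" "smooth_near M p h"
  shows "v (\<lambda>q. f q - h q) = v f - v h"
  using assms tangent_diff[of "vRe v" p f h] tangent_diff[of "vIm v" p f h]
  by (simp add: ctangent_space_def vRe_def vIm_def complex_eq_iff)

lemma ctangent_apply_const: "v \<in> ctangent_space M p \<Longrightarrow> v (\<lambda>q. c) = 0"
  using tangent_const[of "vRe v" p c] tangent_const[of "vIm v" p c]
  by (simp add: ctangent_space_def vRe_def vIm_def complex_eq_iff)

lemma vapply_diff:
  assumes "v \<in> ctangent_space M p" "openin (mtop M) W" "p \<in> W" "csmooth_fun M W h" "csmooth_fun M W k"
  shows "vapply v (\<lambda>q. h q - k q) = vapply v h - vapply v k"
proof -
  have "smooth_near M p (\<lambda>q. Re (h q))" "smooth_near M p (\<lambda>q. Re (k q))"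
      "smooth_near M p (\<lambda>q. Im (h q))" "smooth_near M p (\<lambda>q. Im (k q))"
    using assms by (auto simp: csmooth_fun_def intro: smooth_nearI)
  then show ?thesis
    by (simp add: vapply_def ctangent_apply_diff[OF assms(1)] algebra_simps)
qed

lemma vapply_i:
  assumes "v \<in> ctangent_space M p" "openin (mtop M) W" "p \<in> W" "csmooth_fun M W h"
  shows "vapply v (\<lambda>q. \<i> * h q) = \<i> * vapply v h"
proof -
  have "v (\<lambda>q. 0 - Im (h q)) = v (\<lambda>q. 0) - v (\<lambda>q. Im (h q))"
    using assms by (intro ctangent_apply_diff smooth_near_const) (auto simp: csmooth_fun_def ctangent_points intro: smooth_nearI)
  then show ?thesis
    by (simp add: vapply_def ctangent_apply_const[OF assms(1)] algebra_simps)
qed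

lemma vapply_add:
  assumes "v \<in> ctangent_space M p" "openin (mtop M) W" "p \<in> W" "csmooth_fun M W h" "csmooth_fun M W k"
  shows "vapply v (\<lambda>q. h q + k q) = vapply v h + vapply v k"
proof -
  have "smooth_near M p (\<lambda>q. Re (h q))" "smooth_near M p (\<lambda>q. Re (k q))"
      "smooth_near M p (\<lambda>q. Im (h q))" "smooth_near M p (\<lambda>q. Im (k q))"
    using assms by (auto simp: csmooth_fun_def intro: smooth_nearI)
  then show ?thesis
    by (simp add: vapply_def ctangent_apply_add[OF assms(1)] algebra_simps)
qed

lemma csmooth_fun_apply:
  assumes "openin (mtop M) V" "V \<subseteq> U" "smooth_cfield M U X" "smooth_fun M V f"
  shows "csmooth_fun M V (\<lambda>q. X q f)"
  using assms smooth_field_apply[of U "\<lambda>p. vRe (X p)" V f] smooth_field_apply[of U "\<lambda>p. vIm (X p)" V f]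
  by (simp add: csmooth_fun_def smooth_cfield_def vRe_def vIm_def)

lemma csmooth_fun_vapply:
  assumes "openin (mtop M) V" "V \<subseteq> U" "smooth_cfield M U X" "csmooth_fun M V h"
  shows "csmooth_fun M V (\<lambda>q. vapply (X q) h)"
  unfolding vapply_def using assms(4)
  by (intro csmooth_fun_add[OF assms(1) csmooth_fun_apply[OF assms(1-3)]
        csmooth_fun_i[OF assms(1) csmooth_fun_apply[OF assms(1-3)]]]) (auto simp: csmooth_fun_def)

section \<open>Connections and their complex extension\<close>

lemma connectionD:
  assumes "connection M C" "openin (mtop M) U" "smooth_field M U Y" "p \<in> U" "v \<in> tangent_space M p"
  shows connection_tangent: "C p v Y \<in> tangent_space M p"
    and connection_dir: "w \<in> tangent_space M p \<Longrightarrow>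
      C p (\<lambda>f. a * v f + b * w f) Y = (\<lambda>f. a * C p v Y f + b * C p w Y f)"
    and connection_add: "smooth_field M U Z \<Longrightarrow>
      C p v (\<lambda>q f. Y q f + Z q f) = (\<lambda>f. C p v Y f + C p v Z f)"
    and connection_leibniz: "smooth_fun M U h \<Longrightarrow>
      C p v (\<lambda>q f. h q * Y q f) = (\<lambda>f. v h * Y p f + h p * C p v Y f)"
    and connection_cong: "(\<And>q. q \<in> U \<Longrightarrow> Z q = Y q) \<Longrightarrow> C p v Z = C p v Y"
proof -
  note * = assms(1)[unfolded connection_def, THEN spec, THEN spec, THEN mp, OF conjI[OF assms(2,3)],
      THEN conjunct1, THEN bspec, OF assms(4), THEN bspec, OF assms(5)]
  note c2 = *[THEN conjunct2] and c3 = *[THEN conjunct2, THEN conjunct2]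
    and c4 = *[THEN conjunct2, THEN conjunct2, THEN conjunct2]
  show "C p v Y \<in> tangent_space M p" using *[THEN conjunct1] .
  show "C p (\<lambda>f. a * v f + b * w f) Y = (\<lambda>f. a * C p v Y f + b * C p w Y f)"
    if "w \<in> tangent_space M p"
    using c2[THEN conjunct1, THEN bspec, OF that, THEN spec, THEN spec] .
  show "C p v (\<lambda>q f. Y q f + Z q f) = (\<lambda>f. C p v Y f + C p v Z f)" if "smooth_field M U Z"
    using c3[THEN conjunct1, THEN spec, THEN mp, OF that] .
  show "C p v (\<lambda>q f. h q * Y q f) = (\<lambda>f. v h * Y p f + h p * C p v Y f)" if "smooth_fun M U h"
    using c4[THEN conjunct1, THEN spec, THEN mp, OF that] .
  show "C p v Z = C p v Y" if "\<And>q. q \<in> U \<Longrightarrow> Z q = Y q"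
    using c4[THEN conjunct2, THEN spec, THEN mp] that by blast
qed

lemma connection_smooth:
  assumes "connection M C" "openin (mtop M) U" "smooth_field M U Y" "smooth_field M U X"
  shows "smooth_field M U (\<lambda>p. C p (X p) Y)"
  using assms(1)[unfolded connection_def, THEN spec, THEN spec, THEN mp, OF conjI[OF assms(2,3)],
      THEN conjunct2, THEN spec, THEN mp, OF assms(4)] .

text \<open>A constant coefficient is a constant smooth function, whose derivative term in the
  Leibniz rule is zero.\<close>

lemma connection_lincomb:
  assumes "connection M C" "openin (mtop M) U" "smooth_field M U Y" "smooth_field M U Z"
    "p \<in> U" "v \<in> tangent_space M p"
  shows "C p v (\<lambda>q f. a * Y q f + b * Z q f) = (\<lambda>f. a * C p v Y f + b * C p v Z f)"
proof -
  have scale: "smooth_field M U (\<lambda>q f. c * X q f)"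
      "C p v (\<lambda>q f. c * X q f) = (\<lambda>f. c * C p v X f)" if X: "smooth_field M U X" for X c
    using smooth_field_lincomb[OF assms(2) _ _ X X, of "\<lambda>q. c" "\<lambda>q. 0"] assms(2)
      connection_leibniz[OF assms(1,2) X assms(5,6), of "\<lambda>q. c"]
    by (simp_all add: tangent_const[OF assms(6)])
  have "C p v (\<lambda>q f. a * Y q f + b * Z q f) =
      (\<lambda>f. C p v (\<lambda>q f. a * Y q f) f + C p v (\<lambda>q f. b * Z q f) f)"
    using connection_add[OF assms(1,2) scale(1)[OF assms(3)] assms(5,6) scale(1)[OF assms(4)]] .
  then show ?thesis by (simp add: scale(2) assms)
qed

lemma cconn_ctangent:
  assumes "connection M C" "openin (mtop M) U" "smooth_cfield M U Y" "p \<in> U" "v \<in> ctangent_space M p"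
  shows "cconn C p v Y \<in> ctangent_space M p"
proof -
  have "C p w Z \<in> tangent_space M p" if "w \<in> {vRe v, vIm v}" "Z \<in> {\<lambda>q. vRe (Y q), \<lambda>q. vIm (Y q)}" for w Z
    using assms(3,5) that by (intro connection_tangent[OF assms(1,2) _ assms(4)])
      (auto simp: smooth_cfield_def ctangent_space_def)
  then show ?thesis
    unfolding ctangent_space_def mem_Collect_eq vRe_cconn vIm_cconn
    by (intro conjI tangent_lincomb) blast+
qed

lemma smooth_cfield_cconn:
  assumes "connection M C" "openin (mtop M) U" "smooth_cfield M U X" "smooth_cfield M U Y"
  shows "smooth_cfield M U (\<lambda>q. cconn C q (X q) Y)"
proof -
  have "smooth_field M U (\<lambda>q. C q (W q) Z)"
    if "W \<in> {\<lambda>q. vRe (X q), \<lambda>q. vIm (X q)}" "Z \<in> {\<lambda>q. vRe (Y q), \<lambda>q. vIm (Y q)}" for W Z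
    using assms(3,4) that by (intro connection_smooth[OF assms(1,2)]) (auto simp: smooth_cfield_def)
  from this[of "\<lambda>q. vRe (X q)" "\<lambda>q. vRe (Y q)"] this[of "\<lambda>q. vIm (X q)" "\<lambda>q. vIm (Y q)"]
    this[of "\<lambda>q. vRe (X q)" "\<lambda>q. vIm (Y q)"] this[of "\<lambda>q. vIm (X q)" "\<lambda>q. vRe (Y q)"]
  show ?thesis
    unfolding smooth_cfield_def vRe_cconn vIm_cconn
    by (intro conjI smooth_field_lincomb smooth_fun_const assms(2)) simp_all
qed

lemma cconn_cong:
  assumes "connection M C" "openin (mtop M) U" "smooth_cfield M U Y" "p \<in> U" "v \<in> ctangent_space M p"
    "\<And>q. q \<in> U \<Longrightarrow> Z q = Y q"
  shows "cconn C p v Z = cconn C p v Y"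
  using connection_cong[OF assms(1,2) _ assms(4), of "\<lambda>q. vRe (Y q)" _ "\<lambda>q. vRe (Z q)"]
    connection_cong[OF assms(1,2) _ assms(4), of "\<lambda>q. vIm (Y q)" _ "\<lambda>q. vIm (Z q)"]
    assms(3,5,6)
  by (simp add: cconn_def smooth_cfield_def ctangent_space_def)

lemma cconn_dir:
  assumes "connection M C" "openin (mtop M) U" "smooth_cfield M U Y" "p \<in> U"
    "v \<in> ctangent_space M p" "w \<in> ctangent_space M p"
  shows "cconn C p (\<lambda>f. a * v f + b * w f) Y = (\<lambda>f. a * cconn C p v Y f + b * cconn C p w Y f)"
proof -
  have T: "vRe v \<in> tangent_space M p" "vIm v \<in> tangent_space M p"
      "vRe w \<in> tangent_space M p" "vIm w \<in> tangent_space M p"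
    using assms(5,6) by (auto simp: ctangent_space_def)
  have *: "C p (\<lambda>f. 1 * (a1 * u1 f + a2 * u2 f) + 1 * (a3 * u3 f + a4 * u4 f)) Z =
      (\<lambda>f. a1 * C p u1 Z f + a2 * C p u2 Z f + (a3 * C p u3 Z f + a4 * C p u4 Z f))"
    if "smooth_field M U Z" "u1 \<in> tangent_space M p" "u2 \<in> tangent_space M p"
       "u3 \<in> tangent_space M p" "u4 \<in> tangent_space M p" for Z a1 a2 a3 a4 u1 u2 u3 u4
    by (simp only: connection_dir[OF assms(1,2) that(1) assms(4)] that tangent_lincomb) simp
  show ?thesis
    using assms(3)[unfolded smooth_cfield_def, THEN conjunct1] assms(3)[unfolded smooth_cfield_def, THEN conjunct2]
    by (simp only: cconn_def vRe_lincomb vIm_lincomb * T) (simp add: fun_eq_iff complex_eq_iff algebra_simps)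
qed

lemma cconn_lincomb:
  assumes "connection M C" "openin (mtop M) U" "smooth_cfield M U Y" "smooth_cfield M U Z" "p \<in> U"
    "v \<in> ctangent_space M p"
  shows "cconn C p v (\<lambda>q f. a * Y q f + b * Z q f) = (\<lambda>f. a * cconn C p v Y f + b * cconn C p v Z f)"
proof -
  have F: "smooth_field M U (\<lambda>q. vRe (Y q))" "smooth_field M U (\<lambda>q. vIm (Y q))"
      "smooth_field M U (\<lambda>q. vRe (Z q))" "smooth_field M U (\<lambda>q. vIm (Z q))"
    using assms(3,4) by (auto simp: smooth_cfield_def)
  have *: "C p w (\<lambda>q f. 1 * (a1 * u1 q f + a2 * u2 q f) + 1 * (a3 * u3 q f + a4 * u4 q f)) =
      (\<lambda>f. a1 * C p w u1 f + a2 * C p w u2 f + (a3 * C p w u3 f + a4 * C p w u4 f))"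
    if "w \<in> tangent_space M p" "smooth_field M U u1" "smooth_field M U u2"
       "smooth_field M U u3" "smooth_field M U u4" for w a1 a2 a3 a4 u1 u2 u3 u4
    by (simp only: connection_lincomb[OF assms(1,2) _ _ assms(5) that(1)] that assms(2)
      smooth_field_lincomb[OF assms(2) smooth_fun_const smooth_fun_const]) simp
  show ?thesis
    using assms(6)[unfolded ctangent_space_def mem_Collect_eq, THEN conjunct1]
      assms(6)[unfolded ctangent_space_def mem_Collect_eq, THEN conjunct2]
    by (simp only: cconn_def vRe_lincomb vIm_lincomb * F) (simp add: fun_eq_iff complex_eq_iff algebra_simps)
qed

text \<open>\<open>cconn\<close> is the complexification of a real operator. Conjugation therefore
  turns each statement about types into the one with (1,0) and (0,1) exchanged.\<close>

lemma cconn_cnj: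
  assumes "connection M C" "openin (mtop M) U" "smooth_cfield M U Y" "p \<in> U" "v \<in> ctangent_space M p"
  shows "cconn C p (vcnj v) (\<lambda>q. vcnj (Y q)) = vcnj (cconn C p v Y)"
proof -
  have T: "vRe v \<in> tangent_space M p" "vIm v \<in> tangent_space M p"
    and F: "smooth_field M U (\<lambda>q. vRe (Y q))" "smooth_field M U (\<lambda>q. vIm (Y q))"
    using assms by (auto simp: smooth_cfield_def ctangent_space_def)
  have 1: "C p (\<lambda>f. - u f) Z = (\<lambda>f. - C p u Z f)" if "u \<in> tangent_space M p" "smooth_field M U Z" for u Z
    using connection_dir[OF assms(1,2) that(2) assms(4) that(1) that(1), of "-1" 0] by simp
  have 2: "C p u (\<lambda>q f. - Z q f) = (\<lambda>f. - C p u Z f)" if "u \<in> tangent_space M p" "smooth_field M U Z" for u Z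
    using connection_lincomb[OF assms(1,2) that(2) that(2) assms(4) that(1), of "-1" 0] by simp
  have 3: "vcnj (cconn C p v Y) = (\<lambda>f. cnj (cconn C p v Y f))" by (simp add: vcnj_def)
  show ?thesis
    using T F unfolding 3
    by (simp add: cconn_def vIm_vcnj 1 2 tangent_minus complex_eq_iff smooth_field_minus[OF assms(2)] fun_eq_iff)
qed

end

section \<open>Hermitian linear algebra and unitary frames\<close>

locale almost_herm =
  fixes M :: "('a, 'e::euclidean_space) mfd"
    and n :: nat
    and J :: "'a \<Rightarrow> 'a tvec \<Rightarrow> 'a tvec"
    and g :: "'a \<Rightarrow> 'a tvec \<Rightarrow> 'a tvec \<Rightarrow> real"
  assumes almost_hermitian: "almost_hermitian n M J g"

sublocale almost_herm \<subseteq> smooth_mfd M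
  using almost_hermitian by unfold_locales (simp add: almost_hermitian_def)

context almost_herm
begin

lemma dim_eq: "DIM('e) = 2 * n"
  using almost_hermitian by (simp add: almost_hermitian_def)

lemma J_structure: "almost_complex_structure M J"
  using almost_hermitian by (simp add: almost_hermitian_def)

lemma g_metric: "riemannian_metric M g"
  using almost_hermitian by (simp add: almost_hermitian_def)

context
  fixes p u
  assumes u: "u \<in> tangent_space M p"
begin

lemma J_tangent: "J p u \<in> tangent_space M p"
  and J_J: "J p (J p u) = (\<lambda>f. - u f)"
  using J_structure u tangent_points[OF u] unfolding almost_complex_structure_def by blast+

lemma J_lincomb: "v \<in> tangent_space M p \<Longrightarrow>
    J p (\<lambda>f. a * u f + b * v f) = (\<lambda>f. a * J p u f + b * J p v f)"
  using J_structure u tangent_points[OF u] unfolding almost_complex_structure_def by blast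

lemma J_minus: "J p (\<lambda>f. - u f) = (\<lambda>f. - J p u f)"
  using J_lincomb[OF u, of "-1" 0] by simp

lemma g_pos: "u \<noteq> (\<lambda>f. 0) \<Longrightarrow> g p u u > 0"
  and g_sym: "v \<in> tangent_space M p \<Longrightarrow> g p u v = g p v u"
  and g_lincomb: "v \<in> tangent_space M p \<Longrightarrow> w \<in> tangent_space M p \<Longrightarrow>
    g p (\<lambda>f. a * u f + b * v f) w = a * g p u w + b * g p v w"
  using g_metric u tangent_points[OF u] unfolding riemannian_metric_def by blast+

lemma g_J: "v \<in> tangent_space M p \<Longrightarrow> g p (J p u) (J p v) = g p u v"
  using almost_hermitian u tangent_points[OF u] unfolding almost_hermitian_def by blast

end

lemma g_minus: "u \<in> tangent_space M p \<Longrightarrow> w \<in> tangent_space M p \<Longrightarrow> g p (\<lambda>f. - u f) w = - g p u w"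
  using g_lincomb[of u p u w "-1" 0] by simp

lemma g_add: "u \<in> tangent_space M p \<Longrightarrow> v \<in> tangent_space M p \<Longrightarrow> w \<in> tangent_space M p \<Longrightarrow>
    g p (\<lambda>f. u f + v f) w = g p u w + g p v w"
  using g_lincomb[of u p v w 1 1] by simp

lemma g_scale: "u \<in> tangent_space M p \<Longrightarrow> w \<in> tangent_space M p \<Longrightarrow> g p (\<lambda>f. a * u f) w = a * g p u w"
  using g_lincomb[of u p u w a 0] by simp

lemma g_zero: "w \<in> tangent_space M p \<Longrightarrow> g p (\<lambda>f. 0) w = 0"
  using g_lincomb[of w p w w 0 0] by simp

lemma g_minus_right: "u \<in> tangent_space M p \<Longrightarrow> w \<in> tangent_space M p \<Longrightarrow> g p u (\<lambda>f. - w f) = - g p u w"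
  using g_minus[of w p u] g_sym tangent_minus by metis

lemma g_nonneg: "u \<in> tangent_space M p \<Longrightarrow> g p u u \<ge> 0"
  using g_pos[of u p] g_zero[of u p] by fastforce

lemma cmetric_lincomb:
  assumes "u \<in> ctangent_space M p" "v \<in> ctangent_space M p" "w \<in> ctangent_space M p"
  shows "cmetric g p (\<lambda>f. a * u f + b * v f) w = a * cmetric g p u w + b * cmetric g p v w"
proof -
  have *: "g p (\<lambda>f. 1 * (a1 * u1 f + a2 * u2 f) + 1 * (a3 * u3 f + a4 * u4 f)) z =
      a1 * g p u1 z + a2 * g p u2 z + (a3 * g p u3 z + a4 * g p u4 z)"
    if "z \<in> tangent_space M p" "u1 \<in> tangent_space M p" "u2 \<in> tangent_space M p"
       "u3 \<in> tangent_space M p" "u4 \<in> tangent_space M p" for z a1 a2 a3 a4 u1 u2 u3 u4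
    by (simp only: that g_lincomb tangent_lincomb) simp
  have T: "vRe u \<in> tangent_space M p" "vIm u \<in> tangent_space M p"
      "vRe v \<in> tangent_space M p" "vIm v \<in> tangent_space M p"
      "vRe w \<in> tangent_space M p" "vIm w \<in> tangent_space M p"
    using assms by (auto simp: ctangent_space_def)
  show ?thesis
    by (simp only: cmetric_def vRe_lincomb vIm_lincomb * T) (simp add: complex_eq_iff algebra_simps)
qed

lemma cmetric_sym: "u \<in> ctangent_space M p \<Longrightarrow> v \<in> ctangent_space M p \<Longrightarrow> cmetric g p u v = cmetric g p v u"
  using g_sym by (simp add: cmetric_def ctangent_space_def)

lemma cmetric_add: "u \<in> ctangent_space M p \<Longrightarrow> v \<in> ctangent_space M p \<Longrightarrow> w \<in> ctangent_space M p \<Longrightarrow>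
    cmetric g p (\<lambda>f. u f + v f) w = cmetric g p u w + cmetric g p v w"
  using cmetric_lincomb[of u p v w 1 1] by simp

lemma cmetric_diff: "u \<in> ctangent_space M p \<Longrightarrow> v \<in> ctangent_space M p \<Longrightarrow> w \<in> ctangent_space M p \<Longrightarrow>
    cmetric g p (\<lambda>f. u f - v f) w = cmetric g p u w - cmetric g p v w"
  using cmetric_lincomb[of u p v w 1 "-1"] by simp

lemma cmetric_scale: "u \<in> ctangent_space M p \<Longrightarrow> w \<in> ctangent_space M p \<Longrightarrow>
    cmetric g p (\<lambda>f. a * u f) w = a * cmetric g p u w"
  using cmetric_lincomb[of u p u w a 0] by simp

lemma cmetric_scale_right: "u \<in> ctangent_space M p \<Longrightarrow> w \<in> ctangent_space M p \<Longrightarrow>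
    cmetric g p u (\<lambda>f. a * w f) = a * cmetric g p u w"
  using cmetric_scale[of w p u a] by (simp add: cmetric_sym ctangent_scale)

lemma cmetric_add_right: "u \<in> ctangent_space M p \<Longrightarrow> v \<in> ctangent_space M p \<Longrightarrow> w \<in> ctangent_space M p \<Longrightarrow>
    cmetric g p w (\<lambda>f. u f + v f) = cmetric g p w u + cmetric g p w v"
  by (simp add: cmetric_sym[of w] ctangent_add cmetric_add)

lemma cmetric_zero: "w \<in> ctangent_space M p \<Longrightarrow> cmetric g p (\<lambda>f. 0) w = 0"
  using cmetric_scale[of w p w 0] by simp

lemma cmetric_cnj:
  assumes "u \<in> ctangent_space M p" "v \<in> ctangent_space M p"
  shows "cmetric g p (vcnj u) (vcnj v) = cnj (cmetric g p u v)"
  using assms by (simp add: cmetric_def ctangent_space_def vIm_vcnj g_minus g_minus_right tangent_minus complex_eq_iff)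

text \<open>The two mixed terms cancel by symmetry of \<open>g\<close>. All positivity in the proof
  comes from this formula.\<close>

lemma cmetric_vcnj_eq:
  assumes "u \<in> ctangent_space M p"
  shows "cmetric g p u (vcnj u) = complex_of_real (g p (vRe u) (vRe u) + g p (vIm u) (vIm u))"
  using assms g_sym[of "vRe u" p "vIm u"]
  by (simp add: cmetric_def ctangent_space_def vIm_vcnj g_minus_right complex_eq_iff)

lemma cmetric_vcnj_nonneg:
  assumes "u \<in> ctangent_space M p"
  shows "0 \<le> Re (cmetric g p u (vcnj u))"
  using assms by (simp add: cmetric_vcnj_eq ctangent_space_def g_nonneg)

lemma cmetric_vcnj_pos:
  assumes "u \<in> ctangent_space M p" "u \<noteq> (\<lambda>f. 0)"
  shows "0 < Re (cmetric g p u (vcnj u))"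
proof -
  have T: "vRe u \<in> tangent_space M p" "vIm u \<in> tangent_space M p"
    using assms(1) by (auto simp: ctangent_space_def)
  have "vRe u \<noteq> (\<lambda>f. 0) \<or> vIm u \<noteq> (\<lambda>f. 0)"
    using assms(2) ctvec_eqI[of u "\<lambda>f. 0"] by auto
  then have "0 < g p (vRe u) (vRe u) + g p (vIm u) (vIm u)"
    using g_pos[OF T(1)] g_pos[OF T(2)] g_nonneg[OF T(1)] g_nonneg[OF T(2)] by linarith
  then show ?thesis using assms(1) by (simp add: cmetric_vcnj_eq)
qed

lemma cmetric_vcnj_zero:
  assumes "u \<in> ctangent_space M p" "cmetric g p u (vcnj u) = 0"
  shows "u = (\<lambda>f. 0)"
  using cmetric_vcnj_pos[OF assms(1)] assms(2) by auto

lemma cJ_ctangent: "u \<in> ctangent_space M p \<Longrightarrow> cJ J p u \<in> ctangent_space M p"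
  by (simp add: ctangent_space_def J_tangent)

lemma cJ_cJ: "u \<in> ctangent_space M p \<Longrightarrow> cJ J p (cJ J p u) = (\<lambda>f. - u f)"
  by (rule ctvec_eqI) (simp_all add: ctangent_space_def J_J, simp_all add: vRe_def vIm_def)

lemma cJ_lincomb:
  assumes "u \<in> ctangent_space M p" "v \<in> ctangent_space M p"
  shows "cJ J p (\<lambda>f. a * u f + b * v f) = (\<lambda>f. a * cJ J p u f + b * cJ J p v f)"
proof -
  have *: "J p (\<lambda>f. 1 * (a1 * u1 f + a2 * u2 f) + 1 * (a3 * u3 f + a4 * u4 f)) =
      (\<lambda>f. a1 * J p u1 f + a2 * J p u2 f + (a3 * J p u3 f + a4 * J p u4 f))"
    if "u1 \<in> tangent_space M p" "u2 \<in> tangent_space M p"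
       "u3 \<in> tangent_space M p" "u4 \<in> tangent_space M p" for a1 a2 a3 a4 u1 u2 u3 u4
    by (simp only: that J_lincomb tangent_lincomb) simp
  have T: "vRe u \<in> tangent_space M p" "vIm u \<in> tangent_space M p"
      "vRe v \<in> tangent_space M p" "vIm v \<in> tangent_space M p"
    using assms by (auto simp: ctangent_space_def)
  show ?thesis
    by (simp only: cJ_def vRe_lincomb vIm_lincomb * T) (simp add: fun_eq_iff complex_eq_iff algebra_simps)
qed

lemma cJ_scale: "u \<in> ctangent_space M p \<Longrightarrow> cJ J p (\<lambda>f. a * u f) = (\<lambda>f. a * cJ J p u f)"
  using cJ_lincomb[of u p u a 0] by simp

lemma cJ_vcnj: "u \<in> ctangent_space M p \<Longrightarrow> cJ J p (vcnj u) = vcnj (cJ J p u)"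
  by (rule ctvec_eqI) (auto simp: ctangent_space_def vIm_vcnj J_minus)

lemma cmetric_cJ: "u \<in> ctangent_space M p \<Longrightarrow> v \<in> ctangent_space M p \<Longrightarrow>
    cmetric g p (cJ J p u) (cJ J p v) = cmetric g p u v"
  by (simp add: cmetric_def ctangent_space_def g_J)

lemma cmetric_cJ_skew:
  assumes "u \<in> ctangent_space M p" "v \<in> ctangent_space M p"
  shows "cmetric g p (cJ J p u) v = - cmetric g p u (cJ J p v)"
  using cmetric_cJ[OF cJ_ctangent[OF assms(1)] assms(2)] cmetric_scale[OF assms(1) cJ_ctangent[OF assms(2)], of "-1"]
  by (simp add: cJ_cJ assms)

lemma T10_ctangent: "v \<in> T10 M J p \<Longrightarrow> v \<in> ctangent_space M p"
  and T10_cJ: "v \<in> T10 M J p \<Longrightarrow> cJ J p v = (\<lambda>f. \<i> * v f)"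
  and T01_cJ: "v \<in> T01 M J p \<Longrightarrow> cJ J p v = (\<lambda>f. - \<i> * v f)"
  by (auto simp: T10_def T01_def)

lemma T10_vcnj: "v \<in> T10 M J p \<Longrightarrow> vcnj v \<in> T01 M J p"
  by (auto simp: T10_def T01_def cJ_vcnj ctangent_vcnj) (auto simp: vcnj_def)

lemma T01_vcnj: "v \<in> T01 M J p \<Longrightarrow> vcnj v \<in> T10 M J p"
  by (auto simp: T10_def T01_def cJ_vcnj ctangent_vcnj) (auto simp: vcnj_def)

lemma T10_lincomb: "u \<in> T10 M J p \<Longrightarrow> v \<in> T10 M J p \<Longrightarrow> (\<lambda>f. a * u f + b * v f) \<in> T10 M J p"
  by (auto simp: T10_def ctangent_lincomb cJ_lincomb algebra_simps)

text \<open>\<open>J\<close> is an isometry and multiplies both arguments by \<i>, so the product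
  equals its own negative.\<close>

lemma cmetric_T10:
  assumes "u \<in> T10 M J p" "v \<in> T10 M J p"
  shows "cmetric g p u v = 0"
proof -
  note uv = T10_ctangent[OF assms(1)] T10_ctangent[OF assms(2)]
  have "cmetric g p u v = \<i> * (\<i> * cmetric g p u v)"
    using cmetric_cJ[OF uv] by (simp add: T10_cJ assms cmetric_scale cmetric_scale_right ctangent_scale uv)
  then show ?thesis by (simp flip: mult.assoc)
qed

lemma proj10_alt: "proj10 J X p = (\<lambda>f. (1/2) * X p f + (- \<i>/2) * cJ J p (X p) f)"
  and proj01_alt: "proj01 J X p = (\<lambda>f. (1/2) * X p f + (\<i>/2) * cJ J p (X p) f)"
  by (auto simp: proj10_def proj01_def field_simps)

lemma proj10_T10: "X p \<in> ctangent_space M p \<Longrightarrow> proj10 J X p \<in> T10 M J p"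
  unfolding proj10_alt T10_def mem_Collect_eq
  by (simp only: ctangent_lincomb cJ_ctangent cJ_lincomb cJ_cJ) (auto simp: algebra_simps)

lemma proj01_T01: "X p \<in> ctangent_space M p \<Longrightarrow> proj01 J X p \<in> T01 M J p"
  unfolding proj01_alt T01_def mem_Collect_eq
  by (simp only: ctangent_lincomb cJ_ctangent cJ_lincomb cJ_cJ) (auto simp: algebra_simps)

lemma proj_sum: "(\<lambda>f. proj10 J X p f + proj01 J X p f) = X p"
  by (auto simp: proj10_def proj01_def field_simps)

lemma proj_T10: "X p \<in> T10 M J p \<Longrightarrow> proj10 J X p = X p" "X p \<in> T10 M J p \<Longrightarrow> proj01 J X p = (\<lambda>f. 0)"
  by (auto simp: proj10_def proj01_def T10_cJ)

lemma proj_T01: "X p \<in> T01 M J p \<Longrightarrow> proj01 J X p = X p" "X p \<in> T01 M J p \<Longrightarrow> proj10 J X p = (\<lambda>f. 0)"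
  by (auto simp: proj10_def proj01_def T01_cJ)

lemma smooth_cfield_cJ:
  assumes "openin (mtop M) U" "smooth_cfield M U X"
  shows "smooth_cfield M U (\<lambda>q. cJ J q (X q))"
  using assms J_structure by (simp add: smooth_cfield_def almost_complex_structure_def)

lemma smooth_cfield_proj:
  assumes "openin (mtop M) U" "smooth_cfield M U X"
  shows smooth_cfield_proj10: "smooth_cfield M U (proj10 J X)"
    and smooth_cfield_proj01: "smooth_cfield M U (proj01 J X)"
  unfolding proj10_alt[abs_def] proj01_alt[abs_def]
  by (intro smooth_cfield_lincomb csmooth_fun_const smooth_cfield_cJ assms)+

lemma csmooth_fun_cmetric:
  assumes "openin (mtop M) U" "smooth_cfield M U X" "smooth_cfield M U Y"
  shows "csmooth_fun M U (\<lambda>q. cmetric g q (X q) (Y q))"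
proof -
  have "smooth_fun M U (\<lambda>q. g q (A q) (B q))" if "smooth_field M U A" "smooth_field M U B" for A B
    using g_metric assms(1) that unfolding riemannian_metric_def by blast
  then show ?thesis
    using assms(2,3) unfolding csmooth_fun_def cmetric_def complex.sel smooth_cfield_def
    by (intro conjI smooth_fun_diff[OF assms(1)] smooth_fun_add[OF assms(1)]) blast+
qed


lemma ctangent_sum:
  assumes "p \<in> points M" "\<And>i. i \<in> I \<Longrightarrow> u i \<in> ctangent_space M p"
  shows "(\<lambda>f. \<Sum>i\<in>I. a i * u i f) \<in> ctangent_space M p"
  using assms(2)
  by (induction I rule: infinite_finite_induct)
    (simp_all add: ctangent_zero[OF assms(1)] ctangent_add ctangent_scale)

lemma cmetric_sum:
  assumes w: "w \<in> ctangent_space M p" and "\<And>i. i \<in> I \<Longrightarrow> u i \<in> ctangent_space M p"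
  shows "cmetric g p (\<lambda>f. \<Sum>i\<in>I. a i * u i f) w = (\<Sum>i\<in>I. a i * cmetric g p (u i) w)"
  using assms(2)
proof (induction I rule: infinite_finite_induct)
  case (insert i I)
  then show ?case
    using ctangent_sum[OF ctangent_points[OF w], of I u a]
    by (simp add: cmetric_add[OF ctangent_scale _ w] cmetric_scale w)
qed (simp_all add: cmetric_zero w)

lemma T10_zero: "p \<in> points M \<Longrightarrow> (\<lambda>f. 0) \<in> T10 M J p"
  using cJ_scale[OF ctangent_zero, of p 0] by (simp add: T10_def ctangent_zero)

lemma T10_add: "u \<in> T10 M J p \<Longrightarrow> v \<in> T10 M J p \<Longrightarrow> (\<lambda>f. u f + v f) \<in> T10 M J p"
  using T10_lincomb[of u p v 1 1] by simp

lemma T10_diff: "u \<in> T10 M J p \<Longrightarrow> v \<in> T10 M J p \<Longrightarrow> (\<lambda>f. u f - v f) \<in> T10 M J p"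
  using T10_lincomb[of u p v 1 "-1"] by simp

lemma T10_scale: "u \<in> T10 M J p \<Longrightarrow> (\<lambda>f. a * u f) \<in> T10 M J p"
  using T10_lincomb[of u p u a 0] by simp

lemma T10_sum:
  assumes "p \<in> points M" "\<And>i. i \<in> I \<Longrightarrow> u i \<in> T10 M J p"
  shows "(\<lambda>f. \<Sum>i\<in>I. a i * u i f) \<in> T10 M J p"
  using assms(2)
  by (induction I rule: infinite_finite_induct) (simp_all add: T10_zero[OF assms(1)] T10_add T10_scale)

lemma smooth_cfield_zero: "openin (mtop M) U \<Longrightarrow> smooth_cfield M U (\<lambda>q f. 0)"
proof -
  assume U: "openin (mtop M) U"
  then have "smooth_field M U (\<lambda>q f. 0)"
    using openin_subset[OF U] by (auto simp: smooth_field_def intro: tangent_zero)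
  then show ?thesis by (simp add: smooth_cfield_def)
qed

lemma smooth_cfield_sum:
  assumes "openin (mtop M) U" "\<And>i. i \<in> I \<Longrightarrow> csmooth_fun M U (a i)" "\<And>i. i \<in> I \<Longrightarrow> smooth_cfield M U (X i)"
  shows "smooth_cfield M U (\<lambda>q f. \<Sum>i\<in>I. a i q * X i q f)"
  using assms(2,3)
  by (induction I rule: infinite_finite_induct)
    (simp_all add: smooth_cfield_zero assms(1) smooth_cfield_add smooth_cfield_scale)

end

section \<open>Dimension counts and Gram-Schmidt\<close>

text \<open>Pairing a linear relation with \<open>w j\<close> isolates its j-th coefficient times
  \<open>c\<close>, so the vectors are independent.\<close>

lemma orthogonal_card_le:
  fixes G :: "'v::euclidean_space \<Rightarrow> 'v \<Rightarrow> real"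
  assumes lin: "\<And>v. linear (\<lambda>u. G u v)" and "finite I" "c \<noteq> 0"
    and orth: "\<And>i j. i \<in> I \<Longrightarrow> j \<in> I \<Longrightarrow> G (w i) (w j) = (if i = j then c else 0)"
  shows "card I \<le> DIM('v)"
proof -
  have inj: "inj_on w I"
    using orth assms(3) by (intro inj_onI) metis
  have "independent (w ` I)"
  proof (rule ccontr)
    assume "\<not> independent (w ` I)"
    then obtain u v where u: "v \<in> w ` I" "u v \<noteq> 0" "(\<Sum>x\<in>w ` I. u x *\<^sub>R x) = 0"
      using dependent_finite[of "w ` I"] assms(2) by blast
    then obtain j where j: "j \<in> I" "v = w j" by blast
    have "0 = G (\<Sum>x\<in>w ` I. u x *\<^sub>R x) v" using linear_0[OF lin[of v]] u by simp
    also have "\<dots> = (\<Sum>i\<in>I. u (w i) * G (w i) v)"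
      by (simp add: sum.reindex[OF inj] linear_sum[OF lin] linear_scale[OF lin])
    also have "\<dots> = (\<Sum>i\<in>I. if i = j then u v * c else 0)"
      using orth j by (intro sum.cong) auto
    also have "\<dots> = u v * c" using j assms(2) by simp
    finally show False using u(2) assms(3) by simp
  qed
  then show ?thesis
    using independent_card_le[of "w ` I"] card_image[OF inj] by simp
qed

context almost_herm
begin

text \<open>Spanning is left out and the length \<open>k\<close> is free, so that families can be
  built one vector at a time; for \<open>k = n\<close> spanning is recovered by dimension.\<close>

definition orthonormal_at :: "nat \<Rightarrow> 'a \<Rightarrow> (nat \<Rightarrow> 'a ctvec) \<Rightarrow> bool" where
  "orthonormal_at k p e \<longleftrightarrow> (\<forall>i\<in>{1..k}. e i \<in> T10 M J p) \<and>
     (\<forall>i\<in>{1..k}. \<forall>j\<in>{1..k}. cmetric g p (e i) (vcnj (e j)) = (if i = j then 1 else 0))"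

lemma dir_deriv_linear:
  assumes "(U, \<phi>) \<in> atlas M" "p \<in> U"
  shows "linear (\<lambda>w. dir_deriv M (U, \<phi>) p w f)"
  using dir_deriv_lincomb[OF assms, of 1 _ 1] dir_deriv_lincomb[OF assms, of _ _ 0 0]
  by (intro linearI) simp_all

lemma dir_deriv_vec:
  assumes "(U, \<phi>) \<in> atlas M" "p \<in> U"
  shows dir_deriv_plus: "dir_deriv M (U, \<phi>) p (u + w) = (\<lambda>f. dir_deriv M (U, \<phi>) p u f + dir_deriv M (U, \<phi>) p w f)"
    and dir_deriv_scaleR: "dir_deriv M (U, \<phi>) p (a *\<^sub>R u) = (\<lambda>f. a * dir_deriv M (U, \<phi>) p u f)"
  using dir_deriv_lincomb[OF assms, of 1 u 1 w] dir_deriv_lincomb[OF assms, of a u 0 0] by simp_all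

text \<open>The real and imaginary parts of a unitary family are orthogonal.\<close>

lemma orthonormal_le:
  assumes p: "p \<in> points M" and e: "orthonormal_at k p e"
  shows "k \<le> n"
proof -
  obtain U \<phi> where c: "(U, \<phi>) \<in> atlas M" "p \<in> U" using p by (rule chart_at)
  let ?L = "dir_deriv M (U, \<phi>) p"
  have LT: "?L w \<in> tangent_space M p" for w using tangent_space_chart[OF c] by blast
  define b where "b = (\<lambda>(i, s). if s then vRe (e i) else vIm (e i))"
  let ?I = "{1..k} \<times> (UNIV :: bool set)"
  have eT: "vRe (e i) \<in> tangent_space M p" "vIm (e i) \<in> tangent_space M p" if "i \<in> {1..k}" for i
    using e that T10_ctangent by (auto simp: orthonormal_at_def ctangent_space_def)
  then have bT: "b s \<in> tangent_space M p" if "s \<in> ?I" for s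
    using that by (auto simp: b_def)
  \<comment> \<open>Here <e_i, conj e_j> is the Kronecker delta and <e_i, e_j> is 0. The sum and the
    difference of these two equations separate the four real products; this is the origin of
    1/2.\<close>
  have gb: "g p (vRe (e i)) (vRe (e j)) = (if i = j then 1/2 else 0) \<and>
      g p (vIm (e i)) (vIm (e j)) = (if i = j then 1/2 else 0) \<and>
      g p (vRe (e i)) (vIm (e j)) = 0 \<and> g p (vIm (e i)) (vRe (e j)) = 0"
    if "i \<in> {1..k}" "j \<in> {1..k}" for i j
  proof -
    have "cmetric g p (e i) (vcnj (e j)) = (if i = j then 1 else 0)" "cmetric g p (e i) (e j) = 0"
      using e that by (auto simp: orthonormal_at_def cmetric_T10)
    then show ?thesis
      using eT[OF that(1)] eT[OF that(2)]
      by (auto simp: cmetric_def vIm_vcnj g_minus_right complex_eq_iff split: if_splits)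
  qed
  define w where "w = (\<lambda>s. inv ?L (b s))"
  have w: "b s = ?L (w s)" if "s \<in> ?I" for s
    using bT[OF that] tangent_space_chart[OF c] by (simp add: w_def f_inv_into_f)
  have "card ?I \<le> DIM('e)"
  proof (rule orthogonal_card_le[where G="\<lambda>u v. g p (?L u) (?L v)" and c="1/2" and w=w])
    show "linear (\<lambda>u. g p (?L u) (?L v))" for v
      by (intro linearI) (simp_all add: dir_deriv_vec[OF c] g_add g_scale LT)
    show "g p (?L (w s)) (?L (w t)) = (if s = t then 1/2 else 0)" if "s \<in> ?I" "t \<in> ?I" for s t
      using that gb[of "fst s" "fst t"] unfolding w[OF that(1), symmetric] w[OF that(2), symmetric]
      by (cases s; cases t) (auto simp: b_def split: if_splits)
  qed auto
  then show ?thesis using dim_eq by (simp add: card_cartesian_product)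
qed

text \<open>A real vector is twice the real part of its (1,0)-projection. Hence the real and
  imaginary parts of a family spanning the (1,0)-vectors span a real space of dimension 2n, and 2n
  is at most 2k. It supplies a vector outside the span as long as a family has fewer than n
  members.\<close>

lemma spanning_ge:
  assumes p: "p \<in> points M" and e: "\<And>i. i \<in> {1..k} \<Longrightarrow> e i \<in> T10 M J p"
    and span: "\<And>v. v \<in> T10 M J p \<Longrightarrow> \<exists>a. v = (\<lambda>f. \<Sum>i=1..k. a i * e i f)"
  shows "n \<le> k"
proof -
  obtain U \<phi> where c: "(U, \<phi>) \<in> atlas M" "p \<in> U" using p by (rule chart_at)
  let ?L = "dir_deriv M (U, \<phi>) p"
  have LT: "?L w \<in> tangent_space M p" for w using tangent_space_chart[OF c] by blast
  have eT: "vRe (e i) \<in> tangent_space M p" "vIm (e i) \<in> tangent_space M p" if "i \<in> {1..k}" for i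
    using e that T10_ctangent by (auto simp: ctangent_space_def)
  define x where "x = (\<lambda>i. inv ?L (vRe (e i)))"
  have x: "vRe (e i) = ?L (x i)" if "i \<in> {1..k}" for i
    using eT(1)[OF that] tangent_space_chart[OF c] by (simp add: x_def f_inv_into_f)
  define y where "y = (\<lambda>i. inv ?L (vIm (e i)))"
  have y: "vIm (e i) = ?L (y i)" if "i \<in> {1..k}" for i
    using eT(2)[OF that] tangent_space_chart[OF c] by (simp add: y_def f_inv_into_f)
  let ?W = "x ` {1..k} \<union> y ` {1..k}"
  have "w \<in> span ?W" for w
  proof -
    \<comment> \<open>\<open>proj10\<close> takes a field, so the real vector is wrapped as a
      constant function, of which only the value at \<open>p\<close> enters.\<close>
    define X where "X = (\<lambda>_::'a. \<lambda>f. complex_of_real (?L w f))"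
    have re: "vRe (X p) = ?L w" "vIm (X p) = (\<lambda>f. 0)" by (simp_all add: X_def vRe_def vIm_def)
    have X: "X p \<in> ctangent_space M p" by (simp add: ctangent_space_def re LT tangent_zero p)
    have J0: "J p (\<lambda>f. 0) = (\<lambda>f. 0)"
      using J_lincomb[OF LT LT, where a=0 and b=0] by simp
    obtain a where a: "proj10 J X p = (\<lambda>f. \<Sum>i=1..k. a i * e i f)"
      using span[OF proj10_T10[of X, OF X]] by blast
    have "?L w f = 2 * Re (proj10 J X p f)" for f
      using re J0 by (simp add: proj10_def cJ_def X_def Complex_eq)
    then have "?L w f = (\<Sum>i=1..k. 2 * Re (a i) * vRe (e i) f + (- 2 * Im (a i)) * vIm (e i) f)" for f
      unfolding a by (simp add: vRe_def vIm_def sum_distrib_left algebra_simps)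
    also have "\<dots> f = (\<Sum>i=1..k. 2 * Re (a i) * ?L (x i) f + (- 2 * Im (a i)) * ?L (y i) f)" for f
      by (intro sum.cong) (simp_all add: x y)
    also have "\<dots> f = ?L (\<Sum>i=1..k. (2 * Re (a i)) *\<^sub>R x i + (- 2 * Im (a i)) *\<^sub>R y i) f" for f
      by (simp add: linear_sum[OF dir_deriv_linear[OF c, of f]] linear_diff[OF dir_deriv_linear[OF c, of f]]
        linear_scale[OF dir_deriv_linear[OF c, of f]])
    finally have "?L w = ?L (\<Sum>i=1..k. (2 * Re (a i)) *\<^sub>R x i + (- 2 * Im (a i)) *\<^sub>R y i)" by blast
    then have "w = (\<Sum>i=1..k. (2 * Re (a i)) *\<^sub>R x i + (- 2 * Im (a i)) *\<^sub>R y i)"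
      by (rule injD[OF dir_deriv_inj[OF c]])
    also have "\<dots> \<in> span ?W"
      by (intro span_sum span_add span_scale span_base) auto
    finally show ?thesis .
  qed
  then have "dim (UNIV :: 'e set) \<le> card ?W" by (intro dim_le_card) auto
  also have "\<dots> \<le> k + k"
    using card_Un_le[of "x ` {1..k}" "y ` {1..k}"] card_image_le[of "{1..k}" x] card_image_le[of "{1..k}" y] by simp
  finally show ?thesis using dim_eq by simp
qed

text \<open>The projection step of Gram-Schmidt.\<close>

lemma residual:
  assumes "p \<in> points M" and e: "orthonormal_at k p e" and v: "v \<in> T10 M J p"
  defines "r \<equiv> (\<lambda>f. v f - (\<Sum>i=1..k. cmetric g p v (vcnj (e i)) * e i f))"
  shows residual_T10: "r \<in> T10 M J p"
    and residual_orthogonal: "j \<in> {1..k} \<Longrightarrow> cmetric g p r (vcnj (e j)) = 0"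
proof -
  have eT: "e i \<in> T10 M J p" if "i \<in> {1..k}" for i using e that by (auto simp: orthonormal_at_def)
  have S: "(\<lambda>f. \<Sum>i=1..k. cmetric g p v (vcnj (e i)) * e i f) \<in> T10 M J p"
    by (rule T10_sum[OF assms(1)]) (rule eT)
  show "r \<in> T10 M J p" unfolding r_def using T10_diff[OF v S] .
  assume j: "j \<in> {1..k}"
  have ej: "vcnj (e j) \<in> ctangent_space M p" using eT[OF j] T10_ctangent ctangent_vcnj by blast
  have "cmetric g p r (vcnj (e j)) = cmetric g p v (vcnj (e j)) -
      (\<Sum>i=1..k. cmetric g p v (vcnj (e i)) * cmetric g p (e i) (vcnj (e j)))"
    unfolding r_def using cmetric_diff[OF T10_ctangent[OF v] T10_ctangent[OF S] ej]
      cmetric_sum[OF ej, of "{1..k}" e] eT T10_ctangent by simp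
  also have "(\<Sum>i=1..k. cmetric g p v (vcnj (e i)) * cmetric g p (e i) (vcnj (e j))) =
      (\<Sum>i=1..k. if i = j then cmetric g p v (vcnj (e j)) else 0)"
    using e j by (intro sum.cong) (auto simp: orthonormal_at_def)
  also have "\<dots> = cmetric g p v (vcnj (e j))" using j by simp
  finally show "cmetric g p r (vcnj (e j)) = 0" by simp
qed

text \<open>The normalisation step of Gram-Schmidt. It both enlarges a family that is too short and
  shows that a family of length n cannot leave a nonzero residual.\<close>

lemma orthonormal_extend:
  assumes p: "p \<in> points M" and e: "orthonormal_at k p e" and r: "r \<in> T10 M J p"
    and orth: "\<And>j. j \<in> {1..k} \<Longrightarrow> cmetric g p r (vcnj (e j)) = 0"
    and pos: "0 < Re (cmetric g p r (vcnj r))"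
  shows "orthonormal_at (Suc k) p
    (e(Suc k := \<lambda>f. complex_of_real (inverse (sqrt (Re (cmetric g p r (vcnj r))))) * r f))"
    (is "orthonormal_at _ _ (e(_ := ?u))")
proof -
  let ?N = "Re (cmetric g p r (vcnj r))" and ?c = "complex_of_real (inverse (sqrt (Re (cmetric g p r (vcnj r)))))"
  note rC = T10_ctangent[OF r]
  have u: "?u \<in> T10 M J p" by (rule T10_scale[OF r])
  have vu: "vcnj ?u = (\<lambda>f. ?c * vcnj r f)" by (auto simp: vcnj_def)
  have uz: "cmetric g p ?u z = ?c * cmetric g p r z" if "z \<in> ctangent_space M p" for z
    using cmetric_scale[OF rC that] .
  have N: "cmetric g p r (vcnj r) = complex_of_real ?N"
    using cmetric_vcnj_eq[OF rC] by simp
  have "sqrt ?N * sqrt ?N = ?N" "sqrt ?N \<noteq> 0" using pos by auto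
  then have "inverse (sqrt ?N) * (inverse (sqrt ?N) * ?N) = 1"
    by (simp add: field_simps)
  then have uu: "cmetric g p ?u (vcnj ?u) = 1"
    unfolding vu using uz[OF ctangent_scale[OF ctangent_vcnj[OF rC]]]
      cmetric_scale_right[OF rC ctangent_vcnj[OF rC]] N
    by (metis of_real_1 of_real_mult)
  have ue: "cmetric g p ?u (vcnj (e j)) = 0" "cmetric g p (e j) (vcnj ?u) = 0" if j: "j \<in> {1..k}" for j
  proof -
    have ej: "e j \<in> ctangent_space M p" using e j by (auto simp: orthonormal_at_def T10_ctangent)
    show 0: "cmetric g p ?u (vcnj (e j)) = 0"
      using uz[OF ctangent_vcnj[OF ej]] orth[OF j] by simp
    have "cmetric g p (e j) (vcnj ?u) = cnj (cmetric g p (vcnj (e j)) ?u)"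
      using cmetric_cnj[OF ctangent_vcnj[OF ej] T10_ctangent[OF u]] by simp
    also have "cmetric g p (vcnj (e j)) ?u = cmetric g p ?u (vcnj (e j))"
      by (rule cmetric_sym[OF ctangent_vcnj[OF ej] T10_ctangent[OF u]])
    finally show "cmetric g p (e j) (vcnj ?u) = 0" using 0 by simp
  qed
  show ?thesis
    using e u uu ue unfolding orthonormal_at_def by (auto simp: atLeastAtMostSuc_conv)
qed

text \<open>A nonzero residual could be normalised and appended, giving n + 1 orthonormal vectors
  against \<open>orthonormal_le\<close>.\<close>

lemma orthonormal_span:
  assumes p: "p \<in> points M" and e: "orthonormal_at n p e" and v: "v \<in> T10 M J p"
  shows "v = (\<lambda>f. \<Sum>i=1..n. cmetric g p v (vcnj (e i)) * e i f)"
proof -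
  let ?r = "\<lambda>f. v f - (\<Sum>i=1..n. cmetric g p v (vcnj (e i)) * e i f)"
  note r = residual_T10[OF assms] and o = residual_orthogonal[OF assms]
  have "?r = (\<lambda>f. 0)"
    using orthonormal_le[OF p orthonormal_extend[OF p e r o]] cmetric_vcnj_pos[OF T10_ctangent[OF r]]
    by fastforce
  then show ?thesis by (simp add: fun_eq_iff)
qed

text \<open>Gram-Schmidt carried out on fields: a vector at \<open>p\<close> outside the span is
  extended to a field, and the neighbourhood shrinks at each step to where the residual stays
  nonzero.\<close>

lemma orthonormal_fields_exist:
  assumes p: "p \<in> points M" and "k \<le> n"
  shows "\<exists>W e. openin (mtop M) W \<and> p \<in> W \<and> (\<forall>i\<in>{1..k}. smooth_cfield M W (e i)) \<and>
    (\<forall>q\<in>W. orthonormal_at k q (\<lambda>i. e i q))"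
  using assms(2)
proof (induction k)
  case 0
  have "\<forall>q\<in>points M. orthonormal_at 0 q (\<lambda>i f. 0)" by (simp add: orthonormal_at_def)
  then show ?case using p openin_topspace by (intro exI[of _ "points M"] exI[of _ "\<lambda>i q f. 0"]) auto
next
  case (Suc k)
  then have "k \<le> n" by simp
  from Suc.IH[OF this] obtain W e where *: "openin (mtop M) W \<and> p \<in> W \<and>
      (\<forall>i\<in>{1..k}. smooth_cfield M W (e i)) \<and> (\<forall>q\<in>W. orthonormal_at k q (\<lambda>i. e i q))"
    by blast
  then have W: "openin (mtop M) W" "p \<in> W"
    and e: "\<And>i. i \<in> {1..k} \<Longrightarrow> smooth_cfield M W (e i)"
    and on: "\<And>q. q \<in> W \<Longrightarrow> orthonormal_at k q (\<lambda>i. e i q)" by blast+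
  obtain v where v: "v \<in> T10 M J p" "v \<noteq> (\<lambda>f. \<Sum>i=1..k. cmetric g p v (vcnj (e i p)) * e i p f)"
  proof -
    have "\<not> (\<forall>v\<in>T10 M J p. \<exists>a. v = (\<lambda>f. \<Sum>i=1..k. a i * e i p f))"
    proof
      assume "\<forall>v\<in>T10 M J p. \<exists>a. v = (\<lambda>f. \<Sum>i=1..k. a i * e i p f)"
      then have "n \<le> k"
        using on[OF W(2)] unfolding orthonormal_at_def by (intro spanning_ge[OF p, of k "\<lambda>i. e i p"]) blast+
      then show False using Suc.prems by simp
    qed
    then obtain v where "v \<in> T10 M J p" "\<not> (\<exists>a. v = (\<lambda>f. \<Sum>i=1..k. a i * e i p f))" by blast
    then show thesis by (intro that[of v]) auto
  qed
  obtain U V where V: "openin (mtop M) U" "p \<in> U" "smooth_cfield M U V" "V p = v"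
    using ctangent_extend[OF T10_ctangent[OF v(1)]] .
  \<comment> \<open>The extension \<open>V\<close> is of type (1,0) only at \<open>p\<close>.
    Projecting makes it so everywhere and does not change the value at \<open>p\<close>.\<close>
  define X where "X = proj10 J V"
  have Xp: "X p = v" using proj_T10(1)[of V p] v(1) V(4) by (simp add: X_def)
  define UW where "UW = U \<inter> W"
  have UW: "openin (mtop M) UW" "p \<in> UW" using V W by (auto simp: UW_def)
  have X: "smooth_cfield M UW X"
    using smooth_cfield_subset[OF smooth_cfield_proj10[OF V(1,3)]] by (simp add: X_def UW_def)
  have X10: "X q \<in> T10 M J q" if "q \<in> UW" for q
    using proj10_T10[of V q] smooth_cfield_ctangent[OF V(3)] that by (simp add: X_def UW_def)
  have eUW: "smooth_cfield M UW (e i)" if "i \<in> {1..k}" for i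
    using smooth_cfield_subset[OF e[OF that]] by (simp add: UW_def)
  have onUW: "orthonormal_at k q (\<lambda>i. e i q)" "q \<in> points M" if "q \<in> UW" for q
    using that on openin_subset[OF UW(1)] by (auto simp: UW_def)
  define R where "R = (\<lambda>q f. X q f - (\<Sum>i=1..k. cmetric g q (X q) (vcnj (e i q)) * e i q f))"
  have R: "smooth_cfield M UW R"
    unfolding R_def using eUW
    by (intro smooth_cfield_diff smooth_cfield_sum UW X csmooth_fun_cmetric smooth_cfield_vcnj)
  have R_app: "(\<lambda>f. X q f - (\<Sum>i=1..k. cmetric g q (X q) (vcnj (e i q)) * e i q f)) = R q" for q
    by (simp add: R_def)
  note R10 = residual_T10[OF onUW(2) onUW(1) X10, unfolded R_app]
    and Rorth = residual_orthogonal[OF onUW(2) onUW(1) X10, unfolded R_app]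
  define N where "N = (\<lambda>q. Re (cmetric g q (R q) (vcnj (R q))))"
  have N: "smooth_fun M UW N"
    using csmooth_fun_cmetric[OF UW(1) R smooth_cfield_vcnj[OF UW(1) R]] by (simp add: csmooth_fun_def N_def)
  \<comment> \<open>The residual is nonzero at \<open>p\<close> by the choice of \<open>v\<close>,
    hence of positive length on this open set, where it can be normalised smoothly.\<close>
  define W' where "W' = {q \<in> UW. 0 < N q}"
  have W': "openin (mtop M) W'" unfolding W'_def by (rule openin_pos[OF UW(1) N])
  have W'sub: "W' \<subseteq> UW" "W' \<subseteq> W" by (auto simp: W'_def UW_def)
  have "R p \<noteq> (\<lambda>f. 0)" using v(2) by (auto simp: R_def Xp fun_eq_iff)
  then have pW': "p \<in> W'"
    using cmetric_vcnj_pos[OF T10_ctangent[OF R10[OF UW(2) UW(2) UW(2)]]] UW(2) by (simp add: W'_def N_def)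
  define u where "u = (\<lambda>q f. complex_of_real (inverse (sqrt (N q))) * R q f)"
  have "smooth_fun M W' (\<lambda>q. inverse (sqrt (N q)))"
    by (rule smooth_fun_inverse_sqrt[OF W' smooth_fun_subset[OF N]]) (auto simp: W'_def)
  then have "smooth_cfield M W' u" unfolding u_def
    by (intro smooth_cfield_scale W' smooth_cfield_subset[OF R W'sub(1)])
      (simp_all only: csmooth_fun_def Re_complex_of_real Im_complex_of_real smooth_fun_const[OF W'] simp_thms)
  then have "\<forall>i\<in>{1..Suc k}. smooth_cfield M W' ((e(Suc k := u)) i)"
    using e smooth_cfield_subset[OF _ W'sub(2)] by (auto simp: atLeastAtMostSuc_conv)
  moreover have "orthonormal_at (Suc k) q (\<lambda>i. (e(Suc k := u)) i q)" if q: "q \<in> W'" for q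
  proof -
    have q': "q \<in> UW" "0 < N q" using q by (auto simp: W'_def)
    have "orthonormal_at (Suc k) q ((\<lambda>i. e i q)(Suc k := u q))"
      using orthonormal_extend[OF onUW(2,1)[OF q'(1)] R10[OF q'(1) q'(1) q'(1)] Rorth[OF q'(1) q'(1) q'(1)]]
        q'(2) by (simp add: u_def N_def)
    moreover have "(\<lambda>i. e i q)(Suc k := u q) = (\<lambda>i. (e(Suc k := u)) i q)" by auto
    ultimately show ?thesis by simp
  qed
  ultimately show ?case using W' pW' by blast
qed

lemma orthonormal_unitary_frame:
  assumes "openin (mtop M) W" "\<And>i. i \<in> {1..n} \<Longrightarrow> smooth_cfield M W (e i)"
    "\<And>q. q \<in> W \<Longrightarrow> orthonormal_at n q (\<lambda>i. e i q)"
  shows "unitary_frame n M J g W e"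
  unfolding unitary_frame_def
proof (intro conjI ballI)
  show "smooth_field10 M J W (e i)" if "i \<in> {1..n}" for i
    using assms(2)[OF that] assms(3) that by (auto simp: smooth_field10_def orthonormal_at_def)
  show "\<exists>a. v = (\<lambda>f. \<Sum>i = 1..n. a i * e i p f)" if "p \<in> W" "v \<in> T10 M J p" for p v
  proof -
    have "p \<in> points M" using openin_subset[OF assms(1)] that(1) by blast
    from orthonormal_span[OF this assms(3)[OF that(1)] that(2)] show ?thesis
      by (rule exI[of _ "\<lambda>i. cmetric g p v (vcnj (e i p))"])
  qed
  show "cmetric g p (e i p) (vcnj (e j p)) = (if i = j then 1 else 0)"
    if "p \<in> W" "i \<in> {1..n}" "j \<in> {1..n}" for p i j
    using assms(3)[OF that(1)] that by (auto simp: orthonormal_at_def)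
qed (rule assms(1))

lemma unitary_frame_exists:
  assumes "p \<in> points M"
  shows "\<exists>e U. p \<in> U \<and> unitary_frame n M J g U e"
  using orthonormal_fields_exist[OF assms order_refl] orthonormal_unitary_frame by metis

end

section \<open>The difference of the two connections\<close>

context smooth_mfd
begin

section \<open>Lie brackets of complex fields\<close>

lemma lie_bracket_apply: "smooth_near M p f \<Longrightarrow>
    lie_bracket M X Y p f = vapply (X p) (\<lambda>q. Y q f) - vapply (Y p) (\<lambda>q. X q f)"
  by (simp add: lie_bracket_def)

text \<open>The bracket is defined by its action on real functions. In an iterated bracket it meets
  functions such as \<open>X q f\<close>, which are complex.\<close>

lemma vapply_lie_bracket:
  assumes W: "openin (mtop M) W" "p \<in> W" and X: "smooth_cfield M W X" and Y: "smooth_cfield M W Y"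
    and h: "csmooth_fun M W h"
  shows "vapply (lie_bracket M X Y p) h =
    vapply (X p) (\<lambda>q. vapply (Y q) h) - vapply (Y p) (\<lambda>q. vapply (X q) h)"
proof -
  have s: "smooth_fun M W (\<lambda>q. Re (h q))" "smooth_fun M W (\<lambda>q. Im (h q))"
    using h by (auto simp: csmooth_fun_def)
  note near = s[THEN smooth_nearI[OF W]]
  have *: "vapply (X p) (\<lambda>q. vapply (Y q) h) =
      vapply (X p) (\<lambda>q. Y q (\<lambda>q. Re (h q))) + \<i> * vapply (X p) (\<lambda>q. Y q (\<lambda>q. Im (h q)))"
    if X: "smooth_cfield M W X" and Y: "smooth_cfield M W Y" for X Y
  proof -
    note Xp = smooth_cfield_ctangent[OF X W(2)]
    note Yh = csmooth_fun_apply[OF W(1) order_refl Y s(1)] csmooth_fun_apply[OF W(1) order_refl Y s(2)]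
    show ?thesis
      unfolding vapply_def[of "Y _" h] vapply_add[OF Xp W Yh(1) csmooth_fun_i[OF W(1) Yh(2)]]
        vapply_i[OF Xp W Yh(2)] ..
  qed
  show ?thesis
    unfolding *[OF X Y] *[OF Y X]
    by (simp add: vapply_def[of "lie_bracket _ _ _ _"] lie_bracket_apply near algebra_simps)
qed

text \<open>Each double bracket expands into four third-order derivatives of \<open>f\<close>; the
  twelve terms cancel in pairs.\<close>

lemma jacobi:
  assumes W: "openin (mtop M) W" "p \<in> W"
    and F: "smooth_cfield M W X" "smooth_cfield M W Y" "smooth_cfield M W Z"
    and f: "smooth_fun M W f"
    and L: "\<And>A B. smooth_cfield M W A \<Longrightarrow> smooth_cfield M W B \<Longrightarrow> smooth_cfield M W (lie_bracket M A B)"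
  shows "lie_bracket M X (lie_bracket M Y Z) p f + lie_bracket M Y (lie_bracket M Z X) p f
    + lie_bracket M Z (lie_bracket M X Y) p f = 0"
proof -
  have near: "smooth_near M q f" if "q \<in> W" for q using smooth_nearI[OF W(1) that f] .
  have *: "lie_bracket M A (lie_bracket M B C) p f =
      vapply (A p) (\<lambda>q. vapply (B q) (\<lambda>r. C r f)) - vapply (A p) (\<lambda>q. vapply (C q) (\<lambda>r. B r f))
      - (vapply (B p) (\<lambda>q. vapply (C q) (\<lambda>r. A r f)) - vapply (C p) (\<lambda>q. vapply (B q) (\<lambda>r. A r f)))"
    if A: "smooth_cfield M W A" and B: "smooth_cfield M W B" and C: "smooth_cfield M W C" for A B C
  proof -
    note app = csmooth_fun_apply[OF W(1) order_refl _ f]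
    note vap = csmooth_fun_vapply[OF W(1) order_refl]
    have "vapply (A p) (\<lambda>q. lie_bracket M B C q f) =
        vapply (A p) (\<lambda>q. vapply (B q) (\<lambda>r. C r f) - vapply (C q) (\<lambda>r. B r f))"
      by (rule vapply_cong[OF smooth_cfield_ctangent[OF A W(2)] W]) (simp add: lie_bracket_apply near)
    also have "\<dots> = vapply (A p) (\<lambda>q. vapply (B q) (\<lambda>r. C r f)) - vapply (A p) (\<lambda>q. vapply (C q) (\<lambda>r. B r f))"
      by (rule vapply_diff[OF smooth_cfield_ctangent[OF A W(2)] W vap[OF B app[OF C]] vap[OF C app[OF B]]])
    finally show ?thesis
      using vapply_lie_bracket[OF W B C app[OF A]] by (simp add: lie_bracket_apply near W)
  qed
  show ?thesis unfolding *[OF F(1,2,3)] *[OF F(2,3,1)] *[OF F(3,1,2)] by simp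
qed

end

context almost_herm
begin

lemma g_lincomb_right:
  assumes "u \<in> tangent_space M p" "v \<in> tangent_space M p" "w \<in> tangent_space M p"
  shows "g p w (\<lambda>f. a * u f + b * v f) = a * g p w u + b * g p w v"
  using assms by (simp add: g_sym[of w] tangent_lincomb g_lincomb)

lemma metric_cconn:
  assumes C: "connection M C" "metric_connection M g C" and U: "openin (mtop M) U" "p \<in> U"
    and v: "v \<in> ctangent_space M p" and Y: "smooth_cfield M U Y" and Z: "smooth_cfield M U Z"
  shows "vapply v (\<lambda>q. cmetric g q (Y q) (Z q)) =
    cmetric g p (cconn C p v Y) (Z p) + cmetric g p (Y p) (cconn C p v Z)"
proof -
  have F: "smooth_field M U (\<lambda>q. vRe (Y q))" "smooth_field M U (\<lambda>q. vIm (Y q))"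
      "smooth_field M U (\<lambda>q. vRe (Z q))" "smooth_field M U (\<lambda>q. vIm (Z q))"
    using Y Z by (auto simp: smooth_cfield_def)
  have FT: "vRe (Y p) \<in> tangent_space M p" "vIm (Y p) \<in> tangent_space M p"
      "vRe (Z p) \<in> tangent_space M p" "vIm (Z p) \<in> tangent_space M p"
    using smooth_cfield_ctangent[OF Y U(2)] smooth_cfield_ctangent[OF Z U(2)] by (auto simp: ctangent_space_def)
  have vT: "vRe v \<in> tangent_space M p" "vIm v \<in> tangent_space M p"
    using v by (auto simp: ctangent_space_def)
  have near: "smooth_near M p (\<lambda>q. g q (A q) (B q))" if "smooth_field M U A" "smooth_field M U B" for A B
  proof (rule smooth_nearI[OF U])
    show "smooth_fun M U (\<lambda>q. g q (A q) (B q))"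
      using g_metric U(1) that unfolding riemannian_metric_def by blast
  qed
  have m: "u (\<lambda>q. g q (A q) (B q)) = g p (C p u A) (B p) + g p (A p) (C p u B)"
    if "smooth_field M U A" "smooth_field M U B" "u \<in> tangent_space M p" for u A B
    using C(2) U that unfolding metric_connection_def by blast
  have CT: "C p u A \<in> tangent_space M p" if "smooth_field M U A" "u \<in> tangent_space M p" for u A
    using connection_tangent[OF C(1) U(1) that(1) U(2) that(2)] .
  have re: "u (\<lambda>q. Re (cmetric g q (Y q) (Z q))) =
      g p (C p u (\<lambda>q. vRe (Y q))) (vRe (Z p)) + g p (vRe (Y p)) (C p u (\<lambda>q. vRe (Z q)))
      - (g p (C p u (\<lambda>q. vIm (Y q))) (vIm (Z p)) + g p (vIm (Y p)) (C p u (\<lambda>q. vIm (Z q))))"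
    if "u \<in> tangent_space M p" for u
    using tangent_diff[OF that near[OF F(1,3)] near[OF F(2,4)]] m[OF F(1,3) that] m[OF F(2,4) that]
    by (simp add: cmetric_def)
  have im: "u (\<lambda>q. Im (cmetric g q (Y q) (Z q))) =
      g p (C p u (\<lambda>q. vRe (Y q))) (vIm (Z p)) + g p (vRe (Y p)) (C p u (\<lambda>q. vIm (Z q)))
      + (g p (C p u (\<lambda>q. vIm (Y q))) (vRe (Z p)) + g p (vIm (Y p)) (C p u (\<lambda>q. vRe (Z q))))"
    if "u \<in> tangent_space M p" for u
    using tangent_add[OF that near[OF F(1,4)] near[OF F(2,3)]] m[OF F(1,4) that] m[OF F(2,3) that]
    by (simp add: cmetric_def)
  have va: "vapply v h = Complex (vRe v (\<lambda>q. Re (h q))) (vIm v (\<lambda>q. Re (h q)))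
      + \<i> * Complex (vRe v (\<lambda>q. Im (h q))) (vIm v (\<lambda>q. Im (h q)))" for h
    by (simp add: vapply_def vRe_def vIm_def)
  show ?thesis
    unfolding va re[OF vT(1)] re[OF vT(2)] im[OF vT(1)] im[OF vT(2)]
    unfolding cmetric_def vRe_cconn vIm_cconn
    using CT[OF F(1) vT(1)] CT[OF F(1) vT(2)] CT[OF F(2) vT(1)] CT[OF F(2) vT(2)]
      CT[OF F(3) vT(1)] CT[OF F(3) vT(2)] CT[OF F(4) vT(1)] CT[OF F(4) vT(2)]
    by (simp only: g_lincomb g_lincomb_right FT) (simp add: complex_eq_iff algebra_simps)
qed

lemma cconn_cJ:
  assumes C: "connection M C" "complex_connection M J C" and U: "openin (mtop M) U" "p \<in> U"
    and v: "v \<in> ctangent_space M p" and Y: "smooth_cfield M U Y"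
  shows "cconn C p v (\<lambda>q. cJ J q (Y q)) = cJ J p (cconn C p v Y)"
proof -
  have F: "smooth_field M U (\<lambda>q. vRe (Y q))" "smooth_field M U (\<lambda>q. vIm (Y q))"
    using Y by (auto simp: smooth_cfield_def)
  have vT: "vRe v \<in> tangent_space M p" "vIm v \<in> tangent_space M p"
    using v by (auto simp: ctangent_space_def)
  have j: "C p u (\<lambda>q. J q (A q)) = J p (C p u A)" if "smooth_field M U A" "u \<in> tangent_space M p" for A u
    using C(2) U that unfolding complex_connection_def by blast
  have CT: "C p u A \<in> tangent_space M p" if "smooth_field M U A" "u \<in> tangent_space M p" for u A
    using connection_tangent[OF C(1) U(1) that(1) U(2) that(2)] .
  show ?thesis
    by (rule ctvec_eqI)
      (simp_all only: vRe_cconn vIm_cconn vRe_cJ vIm_cJ j F vT J_lincomb CT)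
qed

end

section \<open>The difference tensor and its relation to d omega\<close>

locale canonical_levi_civita = almost_herm M n J g
  for M :: "('a, 'e::euclidean_space) mfd" and n J g +
  fixes nabla D :: "'a conn"
  assumes canonical: "canonical_connection M J g nabla"
    and levi_civita: "levi_civita_connection M g D"
begin

lemma nabla: "connection M nabla" "metric_connection M g nabla" "complex_connection M J nabla"
  and D: "connection M D" "metric_connection M g D"
  using canonical levi_civita unfolding canonical_connection_def levi_civita_connection_def by blast+

definition diff_conn :: "'a \<Rightarrow> 'a ctvec \<Rightarrow> ('a \<Rightarrow> 'a ctvec) \<Rightarrow> 'a ctvec" where
  "diff_conn p v Y = (\<lambda>f. cconn D p v Y f - cconn nabla p v Y f)"

text \<open>The overview's A, built from E = \<open>diff_conn\<close>. The middle argument is a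
  field because connections differentiate fields; the outer two enter pointwise and
  linearly.\<close>

definition diff_form :: "'a \<Rightarrow> 'a ctvec \<Rightarrow> ('a \<Rightarrow> 'a ctvec) \<Rightarrow> 'a ctvec \<Rightarrow> complex" where
  "diff_form p v Y z = cmetric g p (diff_conn p v Y) z"

context
  fixes U assumes U: "openin (mtop M) U"
begin

context
  fixes p v assumes p: "p \<in> U" and v: "v \<in> ctangent_space M p"
begin

lemma diff_conn_ctangent: "smooth_cfield M U Y \<Longrightarrow> diff_conn p v Y \<in> ctangent_space M p"
  unfolding diff_conn_def
  using ctangent_diff[OF cconn_ctangent[OF D(1) U _ p v] cconn_ctangent[OF nabla(1) U _ p v]] .

lemma diff_form_eq: "smooth_cfield M U Y \<Longrightarrow> z \<in> ctangent_space M p \<Longrightarrow>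
    diff_form p v Y z = cmetric g p (cconn D p v Y) z - cmetric g p (cconn nabla p v Y) z"
  unfolding diff_form_def diff_conn_def
  using cmetric_diff[OF cconn_ctangent[OF D(1) U _ p v] cconn_ctangent[OF nabla(1) U _ p v]] .

text \<open>Both connections are metric and compute the derivative of the same function <Y,Z>; the
  two formulas are subtracted.\<close>

lemma diff_form_skew:
  assumes "smooth_cfield M U Y" "smooth_cfield M U Z"
  shows "diff_form p v Y (Z p) = - diff_form p v Z (Y p)"
proof -
  note YZ = smooth_cfield_ctangent[OF assms(1) p] smooth_cfield_ctangent[OF assms(2) p]
  have *: "cmetric g p (cconn C p v Y) (Z p) + cmetric g p (cconn C p v Z) (Y p) =
      vapply v (\<lambda>q. cmetric g q (Y q) (Z q))" if "connection M C" "metric_connection M g C" for C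
    using metric_cconn[OF that U p v assms] cmetric_sym[OF YZ(1) cconn_ctangent[OF that(1) U assms(2) p v]] by simp
  show ?thesis
    using *[OF D] *[OF nabla(1,2)] by (simp add: diff_form_eq assms YZ algebra_simps)
qed

lemma diff_form_cong:
  assumes "smooth_cfield M U Y" "\<And>q. q \<in> U \<Longrightarrow> Y' q = Y q"
  shows "diff_form p v Y' z = diff_form p v Y z"
  using assms cconn_cong[OF D(1) U assms(1) p v, of Y'] cconn_cong[OF nabla(1) U assms(1) p v, of Y']
  by (simp add: diff_form_def diff_conn_def)

lemma diff_form_cnj:
  assumes "smooth_cfield M U Y" "z \<in> ctangent_space M p"
  shows "diff_form p (vcnj v) (\<lambda>q. vcnj (Y q)) (vcnj z) = cnj (diff_form p v Y z)"
proof -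
  have "diff_conn p (vcnj v) (\<lambda>q. vcnj (Y q)) = vcnj (diff_conn p v Y)"
    using cconn_cnj[OF D(1) U assms(1) p v] cconn_cnj[OF nabla(1) U assms(1) p v]
    by (simp add: diff_conn_def vcnj_def)
  then show ?thesis
    using cmetric_cnj[OF diff_conn_ctangent[OF assms(1)] assms(2)] by (simp add: diff_form_def)
qed

lemma diff_form_lincomb_right:
  assumes "smooth_cfield M U Y" "z \<in> ctangent_space M p" "w \<in> ctangent_space M p"
  shows "diff_form p v Y (\<lambda>f. a * z f + b * w f) = a * diff_form p v Y z + b * diff_form p v Y w"
  using cmetric_lincomb[OF assms(2,3) diff_conn_ctangent[OF assms(1)]]
  by (simp add: diff_form_def cmetric_sym[OF diff_conn_ctangent[OF assms(1)]] ctangent_lincomb assms)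

lemma diff_form_lincomb_left:
  assumes "smooth_cfield M U Y" "z \<in> ctangent_space M p" "w \<in> ctangent_space M p"
  shows "diff_form p (\<lambda>f. a * v f + b * w f) Y z = a * diff_form p v Y z + b * diff_form p w Y z"
proof -
  have "diff_conn p (\<lambda>f. a * v f + b * w f) Y = (\<lambda>f. a * diff_conn p v Y f + b * diff_conn p w Y f)"
    unfolding diff_conn_def cconn_dir[OF D(1) U assms(1) p v assms(3)]
      cconn_dir[OF nabla(1) U assms(1) p v assms(3)] by (auto simp: algebra_simps)
  moreover have "diff_conn p w Y \<in> ctangent_space M p"
    unfolding diff_conn_def
    using ctangent_diff[OF cconn_ctangent[OF D(1) U assms(1) p assms(3)] cconn_ctangent[OF nabla(1) U assms(1) p assms(3)]] .
  ultimately show ?thesis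
    using cmetric_lincomb[OF diff_conn_ctangent[OF assms(1)] _ assms(2)] by (simp add: diff_form_def)
qed

end

lemma smooth_cfield_diff_conn:
  assumes "smooth_cfield M U X" "smooth_cfield M U Y"
  shows "smooth_cfield M U (\<lambda>q. diff_conn q (X q) Y)"
  unfolding diff_conn_def
  using smooth_cfield_diff[OF U smooth_cfield_cconn[OF D(1) U assms] smooth_cfield_cconn[OF nabla(1) U assms]] .

text \<open>The conjugate of E(X,Y) is itself a smooth field on \<open>U\<close> and thus an
  admissible \<open>Z\<close>; against it the form is the squared Hermitian length of
  E(X,Y).\<close>

lemma diff_conn_zeroI:
  assumes p: "p \<in> U" and X: "smooth_cfield M U X" and Y: "smooth_cfield M U Y"
    and "\<And>Z. smooth_cfield M U Z \<Longrightarrow> diff_form p (X p) Y (Z p) = 0"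
  shows "diff_conn p (X p) Y = (\<lambda>f. 0)"
  using assms(4)[OF smooth_cfield_vcnj[OF U smooth_cfield_diff_conn[OF X Y]]]
    cmetric_vcnj_zero[OF diff_conn_ctangent[OF p smooth_cfield_ctangent[OF X p] Y]]
  by (simp add: diff_form_def)

lemma lie_bracket_D:
  assumes "p \<in> U" "smooth_cfield M U X" "smooth_cfield M U Y"
  shows "lie_bracket M X Y p = (\<lambda>f. cconn D p (X p) Y f - cconn D p (Y p) X f)"
proof -
  have "torsion M D X Y p = (\<lambda>f. 0)"
    using levi_civita U assms unfolding levi_civita_connection_def by blast
  then show ?thesis by (simp add: torsion_def fun_eq_iff)
qed

text \<open>Torsion-freeness of \<open>D\<close> yields the tangency and smoothness of Lie brackets without
  computing in charts.\<close>

lemma smooth_cfield_lie_bracket: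
  assumes "smooth_cfield M U X" "smooth_cfield M U Y"
  shows "smooth_cfield M U (lie_bracket M X Y)"
  by (rule smooth_cfield_cong[OF _ smooth_cfield_diff[OF U smooth_cfield_cconn[OF D(1) U assms]
          smooth_cfield_cconn[OF D(1) U assms(2,1)]]])
    (simp add: lie_bracket_D assms)

lemma diff_form_canonical:
  assumes p: "p \<in> U" and X: "smooth_cfield M U X" and Y: "smooth_cfield M U Y"
    and X10: "\<And>q. q \<in> U \<Longrightarrow> X q \<in> T10 M J q" and Y01: "\<And>q. q \<in> U \<Longrightarrow> Y q \<in> T01 M J q"
  shows "diff_form p (X p) Y z = diff_form p (Y p) X z"
proof -
  \<comment> \<open>The canonical condition is stated for two (1,0)-fields, the second to be
    conjugated; a (0,1)-field is the conjugate of its conjugate.\<close>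
  let ?Y = "\<lambda>q. vcnj (Y q)"
  have "smooth_field10 M J U X" "smooth_field10 M J U ?Y"
    using X X10 Y01 smooth_cfield_vcnj[OF U Y] by (auto simp: smooth_field10_def T01_vcnj)
  then have "torsion M nabla X (\<lambda>q. vcnj (?Y q)) p = (\<lambda>f. 0)"
    using canonical U p unfolding canonical_connection_def by blast
  then have "torsion M nabla X Y p = (\<lambda>f. 0)" by simp
  then have "diff_conn p (X p) Y = diff_conn p (Y p) X"
    using lie_bracket_D[OF p X Y]
    by (auto simp: torsion_def diff_conn_def fun_eq_iff algebra_simps dest!: spec)
  then show ?thesis by (simp add: diff_form_def)
qed

text \<open>The derivative terms of d omega are computed with \<open>nabla\<close>, which preserves
  both \<open>g\<close> and \<open>J\<close>, and the bracket terms with \<open>D\<close>, which is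
  torsion free. Moving \<open>J\<close> to the other factor by skewness makes the two groups combine
  into differences \<open>D - nabla\<close>.\<close>

lemma d_omega_diff_form:
  assumes p: "p \<in> U" and X: "smooth_cfield M U X" and Y: "smooth_cfield M U Y" and Z: "smooth_cfield M U Z"
  shows "d_omega M J g X Y Z p =
      diff_form p (X p) Y (cJ J p (Z p)) - diff_form p (Y p) X (cJ J p (Z p))
    + (diff_form p (Y p) Z (cJ J p (X p)) - diff_form p (Z p) Y (cJ J p (X p)))
    + (diff_form p (Z p) X (cJ J p (Y p)) - diff_form p (X p) Z (cJ J p (Y p)))"
proof -
  have 1: "vapply (X p) (\<lambda>q. cmetric g q (cJ J q (Y q)) (Z q)) =
      - cmetric g p (cconn nabla p (X p) Y) (cJ J p (Z p)) + cmetric g p (cconn nabla p (X p) Z) (cJ J p (Y p))"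
    if X: "smooth_cfield M U X" and Y: "smooth_cfield M U Y" and Z: "smooth_cfield M U Z" for X Y Z
  proof -
    note Xp = smooth_cfield_ctangent[OF X p] and Yp = smooth_cfield_ctangent[OF Y p]
      and Zp = smooth_cfield_ctangent[OF Z p]
    note cT = cconn_ctangent[OF nabla(1) U _ p Xp]
    show ?thesis
      using metric_cconn[OF nabla(1,2) U p Xp smooth_cfield_cJ[OF U Y] Z]
        cconn_cJ[OF nabla(1,3) U p Xp Y] cmetric_cJ_skew[OF cT[OF Y] Zp]
        cmetric_sym[OF cJ_ctangent[OF Yp] cT[OF Z]] by simp
  qed
  have 2: "cmetric g p (cJ J p (lie_bracket M X Y p)) (Z p) =
      - (cmetric g p (cconn D p (X p) Y) (cJ J p (Z p)) - cmetric g p (cconn D p (Y p) X) (cJ J p (Z p)))"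
    if X: "smooth_cfield M U X" and Y: "smooth_cfield M U Y" and Z: "smooth_cfield M U Z" for X Y Z
    unfolding lie_bracket_D[OF p X Y, symmetric]
    using cmetric_cJ_skew[OF smooth_cfield_ctangent[OF smooth_cfield_lie_bracket[OF X Y] p] smooth_cfield_ctangent[OF Z p]]
      cmetric_diff[OF cconn_ctangent[OF D(1) U Y p smooth_cfield_ctangent[OF X p]]
        cconn_ctangent[OF D(1) U X p smooth_cfield_ctangent[OF Y p]] cJ_ctangent[OF smooth_cfield_ctangent[OF Z p]]]
    by (simp add: lie_bracket_D[OF p X Y])
  show ?thesis
    unfolding d_omega_def Let_def fundamental_form_def 1[OF X Y Z] 1[OF Y Z X] 1[OF Z X Y]
      2[OF X Y Z] 2[OF Y Z X] 2[OF Z X Y]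
    by (simp add: diff_form_eq[OF p] smooth_cfield_ctangent[OF _ p] cJ_ctangent X Y Z)
qed

end

end

section \<open>The quasi Kaehler condition\<close>

definition smooth_field01 :: "('a, 'e::euclidean_space) mfd \<Rightarrow>
    ('a \<Rightarrow> 'a tvec \<Rightarrow> 'a tvec) \<Rightarrow> 'a set \<Rightarrow> ('a \<Rightarrow> 'a ctvec) \<Rightarrow> bool" where
  "smooth_field01 M J U X \<longleftrightarrow> smooth_cfield M U X \<and> (\<forall>p\<in>U. X p \<in> T01 M J p)"

locale quasi_canonical = canonical_levi_civita M n J g nabla D
  for M :: "('a, 'e::euclidean_space) mfd" and n J g nabla D +
  assumes quasi: "quasi_kaehler n M J g"
begin

context
  fixes U assumes U: "openin (mtop M) U"
begin

abbreviation field10 where "field10 \<equiv> smooth_field10 M J U"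
abbreviation field01 where "field01 \<equiv> smooth_field01 M J U"

lemma field10D: "field10 X \<Longrightarrow> smooth_cfield M U X" "field10 X \<Longrightarrow> q \<in> U \<Longrightarrow> X q \<in> T10 M J q"
  and field01D: "field01 X \<Longrightarrow> smooth_cfield M U X" "field01 X \<Longrightarrow> q \<in> U \<Longrightarrow> X q \<in> T01 M J q"
  by (auto simp: smooth_field10_def smooth_field01_def)

lemma field10_vcnj: "field10 X \<Longrightarrow> field01 (\<lambda>q. vcnj (X q))"
  and field01_vcnj: "field01 X \<Longrightarrow> field10 (\<lambda>q. vcnj (X q))"
  using U by (auto simp: smooth_field10_def smooth_field01_def smooth_cfield_vcnj T10_vcnj T01_vcnj)

lemma field10_proj: "smooth_cfield M U X \<Longrightarrow> field10 (proj10 J X)"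
  and field01_proj: "smooth_cfield M U X \<Longrightarrow> field01 (proj01 J X)"
  using U by (auto simp: smooth_field10_def smooth_field01_def smooth_cfield_proj10 smooth_cfield_proj01
      proj10_T10 proj01_T01 smooth_cfield_ctangent)

text \<open>Projected fields agree with the original ones on \<open>U\<close> only. The expression
  through \<open>diff_form\<close> reduces the claim to the locality of the two connections.\<close>

lemma d_omega_cong:
  assumes p: "p \<in> U" and F: "smooth_cfield M U X" "smooth_cfield M U Y" "smooth_cfield M U Z"
    and eq: "\<And>q. q \<in> U \<Longrightarrow> X' q = X q" "\<And>q. q \<in> U \<Longrightarrow> Y' q = Y q" "\<And>q. q \<in> U \<Longrightarrow> Z' q = Z q"
  shows "d_omega M J g X' Y' Z' p = d_omega M J g X Y Z p"
proof -
  have F': "smooth_cfield M U X'" "smooth_cfield M U Y'" "smooth_cfield M U Z'"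
    using F eq smooth_cfield_cong[of U] by metis+
  show ?thesis
    unfolding d_omega_diff_form[OF U p F] d_omega_diff_form[OF U p F'] eq[OF p]
    by (simp add: diff_form_cong[OF U p _ F(1) eq(1)] diff_form_cong[OF U p _ F(2) eq(2)]
      diff_form_cong[OF U p _ F(3) eq(3)] smooth_cfield_ctangent[OF _ p] F)
qed

lemma diff_form_zero_field:
  assumes p: "p \<in> U" and v: "v \<in> ctangent_space M p" and Y: "smooth_cfield M U Y"
    and z: "z \<in> ctangent_space M p"
  shows "diff_form p (\<lambda>f. 0) Y z = 0" "diff_form p v Y (\<lambda>f. 0) = 0"
  using diff_form_lincomb_left[OF U p v Y z v, of 0 0] diff_form_lincomb_right[OF U p v Y z z, of 0 0]
  by simp_all

text \<open>Skewness moves the zero field to the last slot, where linearity is pointwise.\<close>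

lemma diff_form_zero_mid:
  assumes p: "p \<in> U" and v: "v \<in> ctangent_space M p" and Z: "smooth_cfield M U Z"
  shows "diff_form p v (\<lambda>q f. 0) (Z p) = 0"
  using diff_form_skew[OF U p v smooth_cfield_zero[OF U] Z]
    diff_form_zero_field(2)[OF p v Z smooth_cfield_ctangent[OF Z p]] by simp

lemma d_omega_zero:
  assumes p: "p \<in> U" and F: "smooth_cfield M U X" "smooth_cfield M U Y" "smooth_cfield M U Z"
    and "(\<forall>q\<in>U. X q = (\<lambda>f. 0)) \<or> (\<forall>q\<in>U. Y q = (\<lambda>f. 0)) \<or> (\<forall>q\<in>U. Z q = (\<lambda>f. 0))"
  shows "d_omega M J g X Y Z p = 0"
proof -
  have J0: "cJ J p (\<lambda>f. 0) = (\<lambda>f. 0)"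
    using cJ_scale[OF smooth_cfield_ctangent[OF F(1) p], of 0] by simp
  note T = smooth_cfield_ctangent[OF F(1) p] smooth_cfield_ctangent[OF F(2) p] smooth_cfield_ctangent[OF F(3) p]
  note JF = smooth_cfield_cJ[OF U F(1)] smooth_cfield_cJ[OF U F(2)] smooth_cfield_cJ[OF U F(3)]
  have 0: "diff_form p v W z = 0" if "\<forall>q\<in>U. W q = (\<lambda>f. 0)" "v \<in> ctangent_space M p" "smooth_cfield M U Z" "z = Z p" for W v z Z
    using diff_form_cong[OF U p that(2) smooth_cfield_zero[OF U], of W] diff_form_zero_mid[OF p that(2,3)] that by simp
  show ?thesis
    unfolding d_omega_diff_form[OF U p F]
    using assms(5)
  proof (elim disjE)
    assume a: "\<forall>q\<in>U. X q = (\<lambda>f. 0)"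
    show "diff_form p (X p) Y (cJ J p (Z p)) - diff_form p (Y p) X (cJ J p (Z p)) +
      (diff_form p (Y p) Z (cJ J p (X p)) - diff_form p (Z p) Y (cJ J p (X p))) +
      (diff_form p (Z p) X (cJ J p (Y p)) - diff_form p (X p) Z (cJ J p (Y p))) = 0"
      using a p diff_form_zero_field[OF p] T F J0 cJ_ctangent 0[OF a _ JF(3)] 0[OF a _ JF(2)] by simp
  next
    assume a: "\<forall>q\<in>U. Y q = (\<lambda>f. 0)"
    show "diff_form p (X p) Y (cJ J p (Z p)) - diff_form p (Y p) X (cJ J p (Z p)) +
      (diff_form p (Y p) Z (cJ J p (X p)) - diff_form p (Z p) Y (cJ J p (X p))) +
      (diff_form p (Z p) X (cJ J p (Y p)) - diff_form p (X p) Z (cJ J p (Y p))) = 0"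
      using a p diff_form_zero_field[OF p] T F J0 cJ_ctangent 0[OF a _ JF(3)] 0[OF a _ JF(1)] by simp
  next
    assume a: "\<forall>q\<in>U. Z q = (\<lambda>f. 0)"
    show "diff_form p (X p) Y (cJ J p (Z p)) - diff_form p (Y p) X (cJ J p (Z p)) +
      (diff_form p (Y p) Z (cJ J p (X p)) - diff_form p (Z p) Y (cJ J p (X p))) +
      (diff_form p (Z p) X (cJ J p (Y p)) - diff_form p (X p) Z (cJ J p (Y p))) = 0"
      using a p diff_form_zero_field[OF p] T F J0 cJ_ctangent 0[OF a _ JF(2)] 0[OF a _ JF(1)] by simp
  qed
qed

text \<open>For these types \<open>dbar_omega\<close> is d omega itself. In its expression through
  A, the terms that exchange \<open>X\<close> with \<open>Y\<close> or \<open>Z\<close> cancel by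
  the canonical condition; what remains is \<i> times the difference of the two sides.\<close>

lemma diff_form_quasi:
  assumes p: "p \<in> U" and X: "field10 X" and Y: "field01 Y" and Z: "field01 Z"
  shows "diff_form p (Y p) Z (X p) = diff_form p (Z p) Y (X p)"
proof -
  note F = field10D(1)[OF X] field01D(1)[OF Y] field01D(1)[OF Z]
  note T = field10D(2)[OF X] field01D(2)[OF Y] field01D(2)[OF Z]
  note TC = smooth_cfield_ctangent[OF F(1) p] smooth_cfield_ctangent[OF F(2) p] smooth_cfield_ctangent[OF F(3) p]
  have "dbar_omega M J g X Y Z p = 0"
    using quasi U F p unfolding quasi_kaehler_def by blast
  \<comment> \<open>Each of these two summands of \<open>dbar_omega\<close> contains a projection of
    \<open>X\<close>, \<open>Y\<close> or \<open>Z\<close> to the wrong type, hence a zero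
    field.\<close>
  moreover have "d_omega M J g (proj01 J X) (proj10 J Y) (proj01 J Z) p = 0"
      "d_omega M J g (proj01 J X) (proj01 J Y) (proj10 J Z) p = 0"
    using T by (auto intro!: d_omega_zero[OF p] smooth_cfield_proj10 smooth_cfield_proj01 U F simp: proj_T10)
  moreover have "d_omega M J g (proj10 J X) (proj01 J Y) (proj01 J Z) p = d_omega M J g X Y Z p"
    by (rule d_omega_cong[OF p F]) (simp_all add: proj_T10 proj_T01 T)
  ultimately have 0: "d_omega M J g X Y Z p = 0" by (simp add: dbar_omega_def)
  have cY: "diff_form p (X p) Y z = diff_form p (Y p) X z" for z
    by (rule diff_form_canonical[OF U p F(1,2) T(1,2)])
  have cZ: "diff_form p (X p) Z z = diff_form p (Z p) X z" for z
    by (rule diff_form_canonical[OF U p F(1,3) T(1,3)])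
  have JX: "diff_form p v W (cJ J p (X p)) = \<i> * diff_form p v W (X p)"
    if "v \<in> ctangent_space M p" "smooth_cfield M U W" for v W
    using diff_form_lincomb_right[OF U p that TC(1) TC(1), of \<i> 0] by (simp add: T10_cJ[OF T(1)[OF p]])
  show ?thesis
    using 0 unfolding d_omega_diff_form[OF U p F] cY cZ by (simp add: JX TC F)
qed

lemma diff_form_quasi':
  assumes p: "p \<in> U" and X: "field01 X" and Y: "field10 Y" and Z: "field10 Z"
  shows "diff_form p (Y p) Z (X p) = diff_form p (Z p) Y (X p)"
proof -
  note F = field01D(1)[OF X] field10D(1)[OF Y] field10D(1)[OF Z]
  note TC = smooth_cfield_ctangent[OF F(1) p] smooth_cfield_ctangent[OF F(2) p] smooth_cfield_ctangent[OF F(3) p]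
  have "cnj (diff_form p (Y p) Z (X p)) = cnj (diff_form p (Z p) Y (X p))"
    using diff_form_quasi[OF p field01_vcnj[OF X] field10_vcnj[OF Y] field10_vcnj[OF Z]]
    by (simp add: diff_form_cnj[OF U p] TC F)
  then show ?thesis by simp
qed

section \<open>Components of A by type\<close>

text \<open>The algebra behind the Koszul formula: a form skew in its last two arguments is
  recovered from its antisymmetrisation in the first two, summed over the three ways to place the
  arguments.\<close>

lemma koszul:
  assumes p: "p \<in> U" and F: "smooth_cfield M U X" "smooth_cfield M U Y" "smooth_cfield M U Z"
  shows "2 * diff_form p (X p) Y (Z p) = (diff_form p (X p) Y (Z p) - diff_form p (Y p) X (Z p))
    - (diff_form p (Y p) Z (X p) - diff_form p (Z p) Y (X p))
    + (diff_form p (Z p) X (Y p) - diff_form p (X p) Z (Y p))"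
  using diff_form_skew[OF U p smooth_cfield_ctangent[OF F(1) p] F(2,3)]
    diff_form_skew[OF U p smooth_cfield_ctangent[OF F(2) p] F(1,3)]
    diff_form_skew[OF U p smooth_cfield_ctangent[OF F(3) p] F(1,2)] by simp

lemma canonical_swap:
  assumes p: "p \<in> U" and "field10 X" "field01 Y"
  shows "diff_form p (X p) Y z = diff_form p (Y p) X z"
  by (rule diff_form_canonical[OF U p field10D(1)[OF assms(2)] field01D(1)[OF assms(3)]
        field10D(2)[OF assms(2)] field01D(2)[OF assms(3)]])

text \<open>In \<open>koszul\<close> each difference either exchanges arguments of opposite types,
  and vanishes by the canonical condition, or exchanges two of equal type against a third of the
  other type, and vanishes by the quasi Kaehler condition. The third claim follows from the second
  by skewness.\<close>

lemma diff_form_mixed: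
  assumes p: "p \<in> U"
  shows "field10 X \<Longrightarrow> field01 Y \<Longrightarrow> field01 Z \<Longrightarrow> diff_form p (X p) Y (Z p) = 0"
    and "field10 X \<Longrightarrow> field10 Y \<Longrightarrow> field01 Z \<Longrightarrow> diff_form p (X p) Y (Z p) = 0"
    and "field10 X \<Longrightarrow> field01 Y \<Longrightarrow> field10 Z \<Longrightarrow> diff_form p (X p) Y (Z p) = 0"
proof -
  show 1: "diff_form p (X p) Y (Z p) = 0" if "field10 X" "field01 Y" "field01 Z" for X Y Z
    using koszul[OF p field10D(1)[OF that(1)] field01D(1)[OF that(2)] field01D(1)[OF that(3)]]
      canonical_swap[OF p that(1,2)] canonical_swap[OF p that(1,3)] diff_form_quasi[OF p that] by simp
  show 2: "diff_form p (X p) Y (Z p) = 0" if "field10 X" "field10 Y" "field01 Z" for X Y Z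
    using koszul[OF p field10D(1)[OF that(1)] field10D(1)[OF that(2)] field01D(1)[OF that(3)]]
      canonical_swap[OF p that(1,3)] canonical_swap[OF p that(2,3)] diff_form_quasi'[OF p that(3,1,2)] by simp
  show "diff_form p (X p) Y (Z p) = 0" if "field10 X" "field01 Y" "field10 Z"
    using 2[OF that(1,3,2)] diff_form_skew[OF U p smooth_cfield_ctangent[OF field10D(1)[OF that(1)] p] field01D(1)[OF that(2)] field10D(1)[OF that(3)]] by simp
qed

lemma diff_form_split_right:
  assumes p: "p \<in> U" and v: "v \<in> ctangent_space M p" and Y: "smooth_cfield M U Y" and Z: "smooth_cfield M U Z"
  shows "diff_form p v Y (Z p) = diff_form p v Y (proj10 J Z p) + diff_form p v Y (proj01 J Z p)"
  using diff_form_lincomb_right[OF U p v Y, where z="proj10 J Z p" and w="proj01 J Z p" and a=1 and b=1] proj_sum[of Z p]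
    smooth_cfield_ctangent[OF smooth_cfield_proj10[OF U Z] p] smooth_cfield_ctangent[OF smooth_cfield_proj01[OF U Z] p]
  by simp

lemma diff_form_split_left:
  assumes p: "p \<in> U" and X: "smooth_cfield M U X" and Y: "smooth_cfield M U Y" and z: "z \<in> ctangent_space M p"
  shows "diff_form p (X p) Y z = diff_form p (proj10 J X p) Y z + diff_form p (proj01 J X p) Y z"
  using diff_form_lincomb_left[OF U p _ Y z, where v="proj10 J X p" and w="proj01 J X p" and a=1 and b=1] proj_sum[of X p]
    smooth_cfield_ctangent[OF smooth_cfield_proj10[OF U X] p] smooth_cfield_ctangent[OF smooth_cfield_proj01[OF U X] p]
  by simp

lemma diff_form_eq_0_cnj:
  assumes p: "p \<in> U" and X: "smooth_cfield M U X" and Y: "smooth_cfield M U Y" and Z: "smooth_cfield M U Z"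
    and "diff_form p (vcnj (X p)) (\<lambda>q. vcnj (Y q)) (vcnj (Z p)) = 0"
  shows "diff_form p (X p) Y (Z p) = 0"
  using assms(5) by (simp add: diff_form_cnj[OF U p] smooth_cfield_ctangent[OF _ p] X Y Z)

lemma diff_conn_10_01:
  assumes p: "p \<in> U" and X: "field10 X" and Y: "field01 Y"
  shows "diff_conn p (X p) Y = (\<lambda>f. 0)"
proof (rule diff_conn_zeroI[OF U p field10D(1)[OF X] field01D(1)[OF Y]])
  fix Z assume Z: "smooth_cfield M U Z"
  show "diff_form p (X p) Y (Z p) = 0"
    using diff_form_split_right[OF p smooth_cfield_ctangent[OF field10D(1)[OF X] p] field01D(1)[OF Y] Z]
      diff_form_mixed(1)[OF p X Y field01_proj[OF Z]] diff_form_mixed(3)[OF p X Y field10_proj[OF Z]] by simp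
qed

lemma diff_conn_01_10:
  assumes p: "p \<in> U" and X: "field10 X" and Y: "field01 Y"
  shows "diff_conn p (Y p) X = (\<lambda>f. 0)"
proof (rule diff_conn_zeroI[OF U p field01D(1)[OF Y] field10D(1)[OF X]])
  fix Z assume "smooth_cfield M U Z"
  show "diff_form p (Y p) X (Z p) = 0"
    using canonical_swap[OF p X Y, of "Z p"] diff_conn_10_01[OF assms]
      cmetric_zero[OF smooth_cfield_ctangent[OF \<open>smooth_cfield M U Z\<close> p]] by (simp add: diff_form_def)
qed

section \<open>Comparison of the two curvatures\<close>

lemma cconn_diff_conn:
  "cconn D p v Y = (\<lambda>f. cconn nabla p v Y f + diff_conn p v Y f)"
  by (simp add: diff_conn_def)

text \<open>\<open>nabla\<close> commutes with \<open>J\<close>, so it preserves the eigenspaces of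
  \<open>J\<close>.\<close>

lemma nabla_field10:
  assumes X: "smooth_cfield M U X" and Y: "field10 Y"
  shows "field10 (\<lambda>q. cconn nabla q (X q) Y)"
  unfolding smooth_field10_def
proof (intro conjI ballI)
  show "smooth_cfield M U (\<lambda>q. cconn nabla q (X q) Y)"
    by (rule smooth_cfield_cconn[OF nabla(1) U X field10D(1)[OF Y]])
  fix q assume q: "q \<in> U"
  note Xq = smooth_cfield_ctangent[OF X q] and Y' = field10D(1)[OF Y]
  have "cJ J q (cconn nabla q (X q) Y) = cconn nabla q (X q) (\<lambda>q. cJ J q (Y q))"
    using cconn_cJ[OF nabla(1,3) U q Xq Y'] by simp
  also have "\<dots> = cconn nabla q (X q) (\<lambda>q f. \<i> * Y q f + 0 * Y q f)"
    by (rule cconn_cong[OF nabla(1) U _ q Xq])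
      (use smooth_cfield_lincomb[OF U _ _ Y' Y', of "\<lambda>q. \<i>" "\<lambda>q. 0"] U T10_cJ field10D(2)[OF Y] in auto)
  also have "\<dots> = (\<lambda>f. \<i> * cconn nabla q (X q) Y f)"
    using cconn_lincomb[OF nabla(1) U Y' Y' q Xq, of \<i> 0] by simp
  finally show "cconn nabla q (X q) Y \<in> T10 M J q"
    using cconn_ctangent[OF nabla(1) U Y' q Xq] by (simp add: T10_def)
qed

lemma nabla_field01:
  assumes X: "smooth_cfield M U X" and Y: "field01 Y"
  shows "field01 (\<lambda>q. cconn nabla q (X q) Y)"
proof -
  have "field01 (\<lambda>q. vcnj (cconn nabla q (vcnj (X q)) (\<lambda>q. vcnj (Y q))))"
    by (rule field10_vcnj[OF nabla_field10[OF smooth_cfield_vcnj[OF U X] field01_vcnj[OF Y]]])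
  moreover have "vcnj (cconn nabla q (vcnj (X q)) (\<lambda>q. vcnj (Y q))) = cconn nabla q (X q) Y" if "q \<in> U" for q
    using cconn_cnj[OF nabla(1) U field01D(1)[OF Y] that smooth_cfield_ctangent[OF X that]] by simp
  ultimately show ?thesis
    unfolding smooth_field01_def using smooth_cfield_cong[of U "\<lambda>q. vcnj (cconn nabla q (vcnj (X q)) (\<lambda>q. vcnj (Y q)))"
        "\<lambda>q. cconn nabla q (X q) Y"] by simp
qed

text \<open>The metric property trades every second derivative for a derivative of a function.\<close>

lemma curv4_connection:
  assumes C: "connection M C" "metric_connection M g C" and p: "p \<in> U"
    and X: "smooth_cfield M U X" and X': "smooth_cfield M U X'" and Y: "smooth_cfield M U Y" and Y': "smooth_cfield M U Y'"
  shows "curv4 M g C Y Y' X X' p =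
      vapply (X p) (\<lambda>q. cmetric g q (cconn C q (X' q) Y) (Y' q)) - cmetric g p (cconn C p (X' p) Y) (cconn C p (X p) Y')
    - (vapply (X' p) (\<lambda>q. cmetric g q (cconn C q (X q) Y) (Y' q)) - cmetric g p (cconn C p (X p) Y) (cconn C p (X' p) Y'))
    - cmetric g p (cconn C p (lie_bracket M X X' p) Y) (Y' p)"
proof -
  note Xp = smooth_cfield_ctangent[OF X p] and X'p = smooth_cfield_ctangent[OF X' p]
    and Yp = smooth_cfield_ctangent[OF Y p] and Y'p = smooth_cfield_ctangent[OF Y' p]
    and Lp = smooth_cfield_ctangent[OF smooth_cfield_lie_bracket[OF U X X'] p]
  note G = smooth_cfield_cconn[OF C(1) U X' Y] and H = smooth_cfield_cconn[OF C(1) U X Y]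
  note CT = cconn_ctangent[OF C(1) U _ p]
  have "curv4 M g C Y Y' X X' p =
      cmetric g p (cconn C p (X p) (\<lambda>q. cconn C q (X' q) Y)) (Y' p)
    - cmetric g p (cconn C p (X' p) (\<lambda>q. cconn C q (X q) Y)) (Y' p)
    - cmetric g p (cconn C p (lie_bracket M X X' p) Y) (Y' p)"
    unfolding curv4_def curvature_def
    by (simp add: cmetric_diff[OF ctangent_diff[OF CT[OF G Xp] CT[OF H X'p]] CT[OF Y Lp] Y'p]
      cmetric_diff[OF CT[OF G Xp] CT[OF H X'p] Y'p])
  then show ?thesis
    using metric_cconn[OF C U p Xp G Y'] metric_cconn[OF C U p X'p H Y'] by simp
qed

text \<open>In \<open>curv4_connection\<close> the replacement of \<open>D\<close> by
  \<open>nabla\<close> changes a single term, <D_X Y, D_(conj X) conj Y>. All others contain E(conj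
  X, Y) or E(X, conj Y), which are zero, or pair the (0,1)-vector E(X,Y) with a
  (0,1)-vector.\<close>

lemma curvature_difference:
  assumes p: "p \<in> U" and X: "field10 X" and Y: "field10 Y"
  shows "curv4 M g D Y (bar Y) X (bar X) p - curv4 M g nabla Y (bar Y) X (bar X) p =
    cmetric g p (diff_conn p (X p) Y) (vcnj (diff_conn p (X p) Y))"
proof -
  have bar_eq: "bar A = (\<lambda>q. vcnj (A q))" for A :: "'a \<Rightarrow> 'a ctvec" by (rule ext) (simp add: bar_def)
  have Xb: "field01 (bar X)" and Yb: "field01 (bar Y)"
    using X Y by (simp_all add: bar_eq field10_vcnj)
  note F = field10D(1)[OF X] field01D(1)[OF Xb] field10D(1)[OF Y] field01D(1)[OF Yb]
  note T = F[THEN smooth_cfield_ctangent, OF p]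
  let ?E = "diff_conn p (X p) Y" and ?E' = "diff_conn p (bar X p) (bar Y)"
  have E': "?E' = vcnj ?E"
    using cconn_cnj[OF D(1) U F(3) p T(1)] cconn_cnj[OF nabla(1) U F(3) p T(1)]
    by (simp add: diff_conn_def bar_eq vcnj_def)
  \<comment> \<open>Stated on all of \<open>U\<close>, since this equality is differentiated below;
    likewise for the next equality under \<open>cmetric\<close>.\<close>
  have G: "cconn D q (bar X q) Y = cconn nabla q (bar X q) Y" if "q \<in> U" for q
    using diff_conn_01_10[OF that Y Xb] by (simp add: cconn_diff_conn)
  have G': "cconn D p (X p) (bar Y) = cconn nabla p (X p) (bar Y)"
    using diff_conn_10_01[OF p X Yb] by (simp add: cconn_diff_conn)
  have H: "cmetric g q (cconn D q (X q) Y) (bar Y q) = cmetric g q (cconn nabla q (X q) Y) (bar Y q)" if "q \<in> U" for q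
    using diff_form_mixed(2)[OF that X Y Yb]
    by (simp add: diff_form_eq[OF U that smooth_cfield_ctangent[OF F(1) that]] F smooth_cfield_ctangent[OF F(4) that])
  have vH: "vapply (bar X p) (\<lambda>q. cmetric g q (cconn D q (X q) Y) (bar Y q)) =
      vapply (bar X p) (\<lambda>q. cmetric g q (cconn nabla q (X q) Y) (bar Y q))"
    by (rule vapply_cong[OF T(2) U p H])
  have vG: "vapply (X p) (\<lambda>q. cmetric g q (cconn D q (bar X q) Y) (bar Y q)) =
      vapply (X p) (\<lambda>q. cmetric g q (cconn nabla q (bar X q) Y) (bar Y q))"
    by (rule vapply_cong[OF T(1) U p]) (simp add: G)
  let ?L = "lie_bracket M X (bar X)"
  note L = smooth_cfield_lie_bracket[OF U F(1,2)]
  \<comment> \<open>The bracket has no definite type. E vanishes on its (0,1)-part with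
    \<open>Y\<close>; on its (1,0)-part the pairing with \<open>bar Y\<close> is a mixed component
    of A.\<close>
  have "diff_form p (?L p) Y (bar Y p) = 0"
  proof -
    have "diff_form p (proj01 J ?L p) Y (bar Y p) = 0"
      using diff_conn_01_10[OF p Y field01_proj[OF L]] cmetric_zero[OF T(4)] by (simp add: diff_form_def)
    then show ?thesis
      using diff_form_split_left[OF p L F(3) T(4)] diff_form_mixed(2)[OF p field10_proj[OF L] Y Yb] by simp
  qed
  then have Leq: "cmetric g p (cconn D p (?L p) Y) (bar Y p) = cmetric g p (cconn nabla p (?L p) Y) (bar Y p)"
    by (simp add: diff_form_eq[OF U p smooth_cfield_ctangent[OF L p]] F T)
  note N1 = nabla_field10[OF F(1) Y] and N2 = nabla_field01[OF F(2) Yb]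
  note NC = smooth_cfield_ctangent[OF field10D(1)[OF N1] p] smooth_cfield_ctangent[OF field01D(1)[OF N2] p]
  note EC = diff_conn_ctangent[OF U p T(1) F(3)] diff_conn_ctangent[OF U p T(2) F(4)]
  \<comment> \<open>\<open>nabla\<close> preserves types, so the derivative of \<open>bar Y\<close>
    is again a (0,1)-field and may serve as the third argument of A.\<close>
  have c1: "cmetric g p ?E (cconn nabla p (bar X p) (bar Y)) = 0"
    using diff_form_mixed(2)[OF p X Y N2] by (simp add: diff_form_def)
  have "diff_form p (bar X p) (bar Y) (cconn nabla p (X p) Y) = 0"
    by (rule diff_form_eq_0_cnj[OF p F(2,4) field10D(1)[OF N1]])
      (use diff_form_mixed(2)[OF p X Y field10_vcnj[OF N1]] in \<open>simp add: bar_eq\<close>)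
  then have c2: "cmetric g p (cconn nabla p (X p) Y) ?E' = 0"
    by (simp add: diff_form_def cmetric_sym[OF NC(1) EC(2)])
  have HH: "cmetric g p (cconn D p (X p) Y) (cconn D p (bar X p) (bar Y)) =
      cmetric g p (cconn nabla p (X p) Y) (cconn nabla p (bar X p) (bar Y)) + cmetric g p ?E ?E'"
    unfolding cconn_diff_conn
    using c1 c2 by (simp add: cmetric_add[OF NC(1) EC(1) ctangent_add[OF NC(2) EC(2)]]
      cmetric_add_right[OF NC(2) EC(2)] NC EC)
  show ?thesis
    unfolding curv4_connection[OF D p F] curv4_connection[OF nabla(1,2) p F] vH vG Leq HH G[OF p] G'
    by (simp add: E')
qed

end

end

section \<open>Equality of the scalar curvatures\<close>

context quasi_canonical
begin

lemma in_points: "openin (mtop M) U \<Longrightarrow> p \<in> U \<Longrightarrow> p \<in> points M"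
  using openin_subset by blast

lemma frame_trace_difference:
  assumes e: "unitary_frame n M J g U e" and p: "p \<in> U"
  shows "frame_trace n M g D e p - frame_trace n M g nabla e p =
    (\<Sum>l=1..n. \<Sum>m=1..n. cmetric g p (diff_conn p (e m p) (e l)) (vcnj (diff_conn p (e m p) (e l))))"
proof -
  have U: "openin (mtop M) U" and F: "\<And>i. i \<in> {1..n} \<Longrightarrow> smooth_field10 M J U (e i)"
    using e by (auto simp: unitary_frame_def)
  show ?thesis
    unfolding frame_trace_def sum_subtractf[symmetric]
    by (intro sum.cong refl) (rule curvature_difference[OF U p F F], assumption+)
qed

lemma frame_trace_le:
  assumes e: "unitary_frame n M J g U e" and p: "p \<in> U"
  shows "Re (frame_trace n M g nabla e p) \<le> Re (frame_trace n M g D e p)"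
    and "Re (frame_trace n M g nabla e p) = Re (frame_trace n M g D e p) \<Longrightarrow>
      l \<in> {1..n} \<Longrightarrow> m \<in> {1..n} \<Longrightarrow> diff_conn p (e m p) (e l) = (\<lambda>f. 0)"
proof -
  have U: "openin (mtop M) U" and F: "\<And>i. i \<in> {1..n} \<Longrightarrow> smooth_cfield M U (e i)"
    using e by (auto simp: unitary_frame_def smooth_field10_def)
  let ?N = "\<lambda>l m. Re (cmetric g p (diff_conn p (e m p) (e l)) (vcnj (diff_conn p (e m p) (e l))))"
  have EC: "diff_conn p (e m p) (e l) \<in> ctangent_space M p" if "l \<in> {1..n}" "m \<in> {1..n}" for l m
    using diff_conn_ctangent[OF U p smooth_cfield_ctangent[OF F[OF that(2)] p] F[OF that(1)]] .
  have nonneg: "0 \<le> ?N l m" if "l \<in> {1..n}" "m \<in> {1..n}" for l m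
    by (rule cmetric_vcnj_nonneg[OF EC[OF that]])
  have eq: "Re (frame_trace n M g D e p) - Re (frame_trace n M g nabla e p) = (\<Sum>l=1..n. \<Sum>m=1..n. ?N l m)"
    using arg_cong[OF frame_trace_difference[OF e p], of Re] by simp
  have "0 \<le> (\<Sum>l=1..n. \<Sum>m=1..n. ?N l m)"
    by (intro sum_nonneg nonneg)
  then show "Re (frame_trace n M g nabla e p) \<le> Re (frame_trace n M g D e p)" using eq by linarith
  assume "Re (frame_trace n M g nabla e p) = Re (frame_trace n M g D e p)"
    and l: "l \<in> {1..n}" and m: "m \<in> {1..n}"
  then have "(\<Sum>l=1..n. \<Sum>m=1..n. ?N l m) = 0" using eq by simp
  then have "\<forall>l\<in>{1..n}. (\<Sum>m=1..n. ?N l m) = 0"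
    by (subst (asm) sum_nonneg_eq_0_iff) (auto intro!: sum_nonneg nonneg)
  then have "(\<Sum>m=1..n. ?N l m) = 0" using l by blast
  then have "\<forall>m\<in>{1..n}. ?N l m = 0"
    by (subst (asm) sum_nonneg_eq_0_iff) (auto intro!: nonneg l simp del: atLeastAtMost_iff)
  then have "?N l m = 0" using m by blast
  then show "diff_conn p (e m p) (e l) = (\<lambda>f. 0)"
    using cmetric_vcnj_pos[OF EC[OF l m]] by fastforce
qed

text \<open>The frame selected in \<open>scalar_curv\<close> depends only on the point, so it serves both connections.\<close>

lemma scalar_curv_frame:
  assumes "p \<in> points M"
  obtains e U where "unitary_frame n M J g U e" "p \<in> U"
    "\<forall>C. scalar_curv n M J g C p = Re (frame_trace n M g C e p)"
proof -
  let ?e = "SOME e. \<exists>U. p \<in> U \<and> unitary_frame n M J g U e"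
  have "\<exists>U. p \<in> U \<and> unitary_frame n M J g U ?e"
    by (rule someI_ex[OF unitary_frame_exists[OF assms]])
  then obtain U where "p \<in> U" "unitary_frame n M J g U ?e" by blast
  then show thesis by (intro that[of U ?e]) (simp_all add: scalar_curv_def)
qed

lemma scalar_curv_le:
  assumes "p \<in> points M"
  shows "scalar_curv n M J g nabla p \<le> scalar_curv n M J g D p"
proof (rule scalar_curv_frame[OF assms])
  fix e U assume e: "unitary_frame n M J g U e" and p: "p \<in> U"
    and S: "\<forall>C. scalar_curv n M J g C p = Re (frame_trace n M g C e p)"
  show ?thesis using frame_trace_le(1)[OF e p] by (simp add: S)
qed

lemma diff_form_sum_left:
  assumes U: "openin (mtop M) U" and p: "p \<in> U" and Y: "smooth_cfield M U Y" and z: "z \<in> ctangent_space M p"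
    and u: "\<And>i. i \<in> I \<Longrightarrow> u i \<in> ctangent_space M p"
  shows "diff_form p (\<lambda>f. \<Sum>i\<in>I. a i * u i f) Y z = (\<Sum>i\<in>I. a i * diff_form p (u i) Y z)"
  using u
proof (induction I rule: infinite_finite_induct)
  case (insert i I)
  have "(\<lambda>f. \<Sum>i\<in>I. a i * u i f) \<in> ctangent_space M p"
    by (rule ctangent_sum[OF in_points[OF U p]]) (use insert.prems in auto)
  then show ?case
    using insert diff_form_lincomb_left[OF U p _ Y z, of "u i" "\<lambda>f. \<Sum>i\<in>I. a i * u i f" "a i" 1] by simp
qed (simp_all add: diff_form_zero_field[OF U p ctangent_zero[OF in_points[OF U p]] Y z])

lemma diff_form_sum_right:
  assumes U: "openin (mtop M) U" and p: "p \<in> U" and Y: "smooth_cfield M U Y" and v: "v \<in> ctangent_space M p"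
    and u: "\<And>i. i \<in> I \<Longrightarrow> u i \<in> ctangent_space M p"
  shows "diff_form p v Y (\<lambda>f. \<Sum>i\<in>I. a i * u i f) = (\<Sum>i\<in>I. a i * diff_form p v Y (u i))"
proof -
  note E = diff_conn_ctangent[OF U p v Y] and S = ctangent_sum[OF in_points[OF U p], of I u a]
  show ?thesis
    using cmetric_sum[OF E, of I u a] u
    by (simp add: diff_form_def cmetric_sym[OF E] S)
qed

text \<open>By skewness the field argument of \<open>diff_form\<close> can be exchanged with its last argument, which
  enters pointwise; so the values on a frame suffice and no Leibniz rule is needed.\<close>

lemma diff_conn_zero_of_frame:
  assumes e: "unitary_frame n M J g U e" and p: "p \<in> U"
    and z: "\<And>l m. l \<in> {1..n} \<Longrightarrow> m \<in> {1..n} \<Longrightarrow> diff_conn p (e m p) (e l) = (\<lambda>f. 0)"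
    and X: "smooth_cfield M U X" and Y: "smooth_cfield M U Y"
  shows "diff_conn p (X p) Y = (\<lambda>f. 0)"
proof -
  have U: "openin (mtop M) U" and F10: "\<And>i. i \<in> {1..n} \<Longrightarrow> smooth_field10 M J U (e i)"
    and span: "\<And>v. v \<in> T10 M J p \<Longrightarrow> \<exists>a. v = (\<lambda>f. \<Sum>i=1..n. a i * e i p f)"
    using e p by (auto simp: unitary_frame_def)
  note F = field10D(1)[OF U F10] and FC = smooth_cfield_ctangent[OF field10D(1)[OF U F10] p]
  \<comment> \<open>Linearity in the first slot, which is pointwise, passes from the frame to every
    (1,0)-vector.\<close>
  have 1: "diff_form p v (e l) w = 0" if v: "v \<in> T10 M J p" and l: "l \<in> {1..n}" and w: "w \<in> ctangent_space M p" for v l w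
  proof -
    obtain a where a: "v = (\<lambda>f. \<Sum>i=1..n. a i * e i p f)" using span[OF v] by blast
    have "diff_form p v (e l) w = (\<Sum>i=1..n. a i * diff_form p (e i p) (e l) w)"
      unfolding a by (rule diff_form_sum_left[OF U p F[OF l] w FC])
    also have "\<dots> = 0"
      by (rule sum.neutral) (simp add: diff_form_def z[OF l] cmetric_zero[OF w])
    finally show ?thesis .
  qed
  have 2: "diff_form p v Y w = 0" if v: "v \<in> T10 M J p" and w: "w \<in> T10 M J p" and Y: "smooth_cfield M U Y" for v w Y
  proof -
    obtain a where a: "w = (\<lambda>f. \<Sum>i=1..n. a i * e i p f)" using span[OF w] by blast
    have "diff_form p v Y w = (\<Sum>i=1..n. a i * diff_form p v Y (e i p))"
      unfolding a by (rule diff_form_sum_right[OF U p Y T10_ctangent[OF v] FC])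
    also have "\<dots> = 0"
      using 1[OF v _ smooth_cfield_ctangent[OF Y p]] diff_form_skew[OF U p T10_ctangent[OF v] Y F]
      by (intro sum.neutral) simp
    finally show ?thesis .
  qed
  \<comment> \<open>The (1,0)-part of \<open>Z\<close> is covered by the frame. For its (0,1)-part,
    skewness brings in E(X, \<open>proj01 J Z\<close>), which is zero by type alone.\<close>
  have 3: "diff_form p (X p) Y (Z p) = 0"
    if X: "smooth_field10 M J U X" and Y: "smooth_cfield M U Y" and Z: "smooth_cfield M U Z" for X Y Z
  proof -
    note Xp = field10D(2)[OF U X p] and XC = smooth_cfield_ctangent[OF field10D(1)[OF U X] p]
    note Z10 = field10_proj[OF U Z] and Z01 = field01_proj[OF U Z]
    have "diff_form p (X p) Y (proj01 J Z p) = - diff_form p (X p) (proj01 J Z) (Y p)"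
      by (rule diff_form_skew[OF U p XC Y field01D(1)[OF U Z01]])
    also have "diff_form p (X p) (proj01 J Z) (Y p) = 0"
      using diff_conn_10_01[OF U p X Z01] cmetric_zero[OF smooth_cfield_ctangent[OF Y p]]
      by (simp add: diff_form_def)
    finally show ?thesis
      using diff_form_split_right[OF U p XC Y Z] 2[OF Xp field10D(2)[OF U Z10 p] Y] by simp
  qed
  show ?thesis
  proof (rule diff_conn_zeroI[OF U p X Y])
    fix Z assume Z: "smooth_cfield M U Z"
    note X01 = field01_proj[OF U X]
    \<comment> \<open>Conjugation reduces the (0,1)-part of \<open>X\<close> to the case just
      settled.\<close>
    have "diff_form p (proj01 J X p) Y (Z p) = 0"
      by (rule diff_form_eq_0_cnj[OF U p field01D(1)[OF U X01] Y Z])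
        (rule 3[OF field01_vcnj[OF U X01] smooth_cfield_vcnj[OF U Y] smooth_cfield_vcnj[OF U Z]])
    then show "diff_form p (X p) Y (Z p) = 0"
      using diff_form_split_left[OF U p X Y smooth_cfield_ctangent[OF Z p]]
        3[OF field10_proj[OF U X] Y Z] by simp
  qed
qed

end

section \<open>Consequences of equal scalar curvatures\<close>

locale equal_scalar_curv = quasi_canonical M n J g nabla D
  for M :: "('a, 'e::euclidean_space) mfd" and n J g nabla D +
  assumes equal: "\<And>p. p \<in> points M \<Longrightarrow> scalar_curv n M J g nabla p = scalar_curv n M J g D p"
begin

text \<open>Equality at \<open>p\<close> forces every squared length in the trace at
  \<open>p\<close> to vanish, and the values on a frame determine E at \<open>p\<close>.\<close>

lemma D_eq_nabla:
  assumes U: "openin (mtop M) U" and p: "p \<in> U" and X: "smooth_cfield M U X" and Y: "smooth_cfield M U Y"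
  shows "cconn D p (X p) Y = cconn nabla p (X p) Y"
proof (rule scalar_curv_frame[OF in_points[OF U p]])
  note pM = in_points[OF U p]
  fix e V assume e: "unitary_frame n M J g V e" and V: "p \<in> V"
    and S: "\<forall>C. scalar_curv n M J g C p = Re (frame_trace n M g C e p)"
  \<comment> \<open>The chosen frame lives on its own neighbourhood \<open>V\<close>, the fields on
    \<open>U\<close>; all arguments of E need a common domain.\<close>
  have UV: "openin (mtop M) (U \<inter> V)" "p \<in> U \<inter> V" using U V p e by (auto simp: unitary_frame_def)
  have "unitary_frame n M J g (U \<inter> V) e"
    using e UV(1) unfolding unitary_frame_def smooth_field10_def
    by (auto intro: smooth_cfield_subset)
  moreover have "diff_conn p (e m p) (e l) = (\<lambda>f. 0)" if "l \<in> {1..n}" "m \<in> {1..n}" for l m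
    using frame_trace_le(2)[OF e V _ that] equal[OF pM] by (simp add: S)
  ultimately have "diff_conn p (X p) Y = (\<lambda>f. 0)"
    by (rule diff_conn_zero_of_frame[OF _ UV(2)]) (auto intro: smooth_cfield_subset X Y)
  then show ?thesis by (simp add: diff_conn_def fun_eq_iff)
qed

lemma lie_bracket_nabla:
  assumes "openin (mtop M) U" "p \<in> U" "smooth_cfield M U X" "smooth_cfield M U Y"
  shows "lie_bracket M X Y p = (\<lambda>f. cconn nabla p (X p) Y f - cconn nabla p (Y p) X f)"
  unfolding lie_bracket_D[OF assms] D_eq_nabla[OF assms] D_eq_nabla[OF assms(1,2,4,3)] ..

text \<open>Once the brackets are written through \<open>nabla\<close> and \<open>J\<close> is
  pulled out of the derivatives, the terms of the Nijenhuis tensor cancel in pairs by J^2 =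
  -1.\<close>

lemma integrable: "J_integrable M J"
  unfolding J_integrable_def
proof (intro allI impI ballI)
  fix U X Y p assume "openin (mtop M) U \<and> smooth_cfield M U X \<and> smooth_cfield M U Y" and p: "p \<in> U"
  then have U: "openin (mtop M) U" and X: "smooth_cfield M U X" and Y: "smooth_cfield M U Y" by auto
  let ?JX = "\<lambda>q. cJ J q (X q)" and ?JY = "\<lambda>q. cJ J q (Y q)"
  note JX = smooth_cfield_cJ[OF U X] and JY = smooth_cfield_cJ[OF U Y]
  note T = smooth_cfield_ctangent[OF _ p]
  note CT = cconn_ctangent[OF nabla(1) U _ p T]
  have cJ_diff: "cJ J p (\<lambda>f. u f - v f) = (\<lambda>f. cJ J p u f - cJ J p v f)"
    if "u \<in> ctangent_space M p" "v \<in> ctangent_space M p" for u v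
    using cJ_lincomb[OF that, of 1 "-1"] by simp
  have NJ: "cconn nabla p v ?JX = cJ J p (cconn nabla p v X)" "cconn nabla p v ?JY = cJ J p (cconn nabla p v Y)"
    if "v \<in> ctangent_space M p" for v
    by (rule cconn_cJ[OF nabla(1,3) U p that X], rule cconn_cJ[OF nabla(1,3) U p that Y])
  note NJ' = NJ(2)[OF T[OF X]] NJ(2)[OF T[OF JX]] NJ(1)[OF T[OF Y]] NJ(1)[OF T[OF JY]]
  show "nijenhuis M J X Y p = (\<lambda>f. 0)"
    unfolding nijenhuis_def Let_def lie_bracket_nabla[OF U p JX JY] lie_bracket_nabla[OF U p JX Y]
      lie_bracket_nabla[OF U p X JY] lie_bracket_nabla[OF U p X Y] NJ'
    by (simp add: cJ_diff cJ_cJ cJ_ctangent CT[OF X Y] CT[OF Y X] CT[OF Y JX] CT[OF X JY])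
qed

text \<open>The second derivatives in the cyclic sum are regrouped by their outer direction. As
  \<open>nabla\<close> is torsion free, the group with outer direction A is the double bracket
  [A,[B,C]], and the sum is the Jacobi expression.\<close>

lemma bianchi:
  assumes U: "openin (mtop M) U" and p: "p \<in> U"
    and X: "smooth_cfield M U X" and Y: "smooth_cfield M U Y" and Z: "smooth_cfield M U Z"
  shows "curvature M nabla X Y Z p f + curvature M nabla Y Z X p f + curvature M nabla Z X Y p f = 0"
proof -
  have *: "cconn nabla p (A p) (\<lambda>q. cconn nabla q (B q) C) f - cconn nabla p (A p) (\<lambda>q. cconn nabla q (C q) B) f
      - cconn nabla p (lie_bracket M B C p) A f = lie_bracket M A (lie_bracket M B C) p f"
    if A: "smooth_cfield M U A" and B: "smooth_cfield M U B" and C: "smooth_cfield M U C" for A B C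
  proof -
    note L = smooth_cfield_lie_bracket[OF U B C] and Ap = smooth_cfield_ctangent[OF A p]
    note BC = smooth_cfield_cconn[OF nabla(1) U B C] and CB = smooth_cfield_cconn[OF nabla(1) U C B]
    have "cconn nabla p (A p) (lie_bracket M B C) =
        cconn nabla p (A p) (\<lambda>q f. 1 * cconn nabla q (B q) C f + (-1) * cconn nabla q (C q) B f)"
      by (rule cconn_cong[OF nabla(1) U _ p Ap])
        (simp_all add: lie_bracket_nabla[OF U _ B C] smooth_cfield_diff[OF U BC CB])
    also have "\<dots> = (\<lambda>f. 1 * cconn nabla p (A p) (\<lambda>q. cconn nabla q (B q) C) f
        + (-1) * cconn nabla p (A p) (\<lambda>q. cconn nabla q (C q) B) f)"
      by (rule cconn_lincomb[OF nabla(1) U BC CB p Ap])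
    finally show ?thesis unfolding lie_bracket_nabla[OF U p A L] by simp
  qed
  have eq: "curvature M nabla X Y Z p f + curvature M nabla Y Z X p f + curvature M nabla Z X Y p f =
      lie_bracket M X (lie_bracket M Y Z) p f + lie_bracket M Y (lie_bracket M Z X) p f
    + lie_bracket M Z (lie_bracket M X Y) p f"
    unfolding *[OF X Y Z, symmetric] *[OF Y Z X, symmetric] *[OF Z X Y, symmetric]
    by (simp add: curvature_def)
  show ?thesis
  \<comment> \<open>The Jacobi identity needs an open set on which \<open>f\<close> is smooth. If
    there is none around \<open>p\<close>, every bracket has the default value 0 at
    \<open>f\<close>.\<close>
  proof (cases "smooth_near M p f")
    case True
    then obtain W where W: "openin (mtop M) W" "p \<in> W" "smooth_fun M W f" unfolding smooth_near_def by blast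
    have V: "openin (mtop M) (U \<inter> W)" "p \<in> U \<inter> W" using U p W by auto
    show ?thesis unfolding eq
      by (rule jacobi[OF V _ _ _ smooth_fun_subset[OF W(3)] smooth_cfield_lie_bracket[OF V(1)]])
        (auto intro: smooth_cfield_subset X Y Z)
  next
    case False
    then show ?thesis unfolding eq by (simp add: lie_bracket_def)
  qed
qed

text \<open>Each of the three terms is a \<open>nabla\<close>-derivative of a (1,0)-field, and
  \<open>nabla\<close> preserves the type.\<close>

lemma curvature_T10:
  assumes U: "openin (mtop M) U" and p: "p \<in> U"
    and X: "smooth_cfield M U X" and Y: "smooth_cfield M U Y" and Z: "smooth_field10 M J U Z"
  shows "curvature M nabla X Y Z p \<in> T10 M J p"
proof -
  note L = smooth_cfield_lie_bracket[OF U X Y]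
  note 10 = nabla_field10[OF U _ Z]
  show ?thesis unfolding curvature_def
    using field10D(2)[OF U nabla_field10[OF U X 10[OF Y]] p] field10D(2)[OF U nabla_field10[OF U Y 10[OF X]] p]
      field10D(2)[OF U 10[OF L] p]
    by (intro T10_diff)
qed

text \<open>Differentiating a constant <Z,W> gives skewness of the first derivatives on all of
  \<open>U\<close>, and this can be differentiated once more. Frame fields have constant products,
  so this case is enough for the components.\<close>

lemma curv4_skew_const:
  assumes U: "openin (mtop M) U" and p: "p \<in> U"
    and F: "smooth_cfield M U X" "smooth_cfield M U Y" "smooth_cfield M U Z" "smooth_cfield M U W"
    and const: "\<And>q. q \<in> U \<Longrightarrow> cmetric g q (Z q) (W q) = c"
  shows "curv4 M g nabla Z W X Y p = - curv4 M g nabla W Z X Y p"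
proof -
  have vc: "vapply v (\<lambda>q. c) = 0" if "v \<in> ctangent_space M q" for v q
    using ctangent_apply_const[OF that] by (simp add: vapply_def)
  have skew: "cmetric g q (cconn nabla q v Z) (W q) = - cmetric g q (cconn nabla q v W) (Z q)"
    if q: "q \<in> U" and v: "v \<in> ctangent_space M q" for q v
  proof -
    have "vapply v (\<lambda>q. cmetric g q (Z q) (W q)) = 0"
      using vapply_cong[OF v U q const] vc[OF v] by simp
    then show ?thesis
      using metric_cconn[OF nabla(1,2) U q v F(3,4)]
        cmetric_sym[OF smooth_cfield_ctangent[OF F(3) q] cconn_ctangent[OF nabla(1) U F(4) q v]]
      by (simp add: add_eq_0_iff2)
  qed
  have V: "vapply (A p) (\<lambda>q. cmetric g q (cconn nabla q (B q) Z) (W q)) =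
      - vapply (A p) (\<lambda>q. cmetric g q (cconn nabla q (B q) W) (Z q))"
    if A: "smooth_cfield M U A" and B: "smooth_cfield M U B" for A B
  proof -
    note Ap = smooth_cfield_ctangent[OF A p]
    have "vapply (A p) (\<lambda>q. cmetric g q (cconn nabla q (B q) Z) (W q)) =
        vapply (A p) (\<lambda>q. 0 - cmetric g q (cconn nabla q (B q) W) (Z q))"
      by (rule vapply_cong[OF Ap U p]) (simp add: skew smooth_cfield_ctangent[OF B])
    also have "\<dots> = vapply (A p) (\<lambda>q. 0) - vapply (A p) (\<lambda>q. cmetric g q (cconn nabla q (B q) W) (Z q))"
      by (rule vapply_diff[OF Ap U p _ csmooth_fun_cmetric[OF U smooth_cfield_cconn[OF nabla(1) U B F(4)] F(3)]])
        (simp add: U)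
    also have "vapply (A p) (\<lambda>q. 0) = 0"
      using ctangent_apply_const[OF Ap, of 0] by (simp add: vapply_def)
    finally show ?thesis by simp
  qed
  note T = F[THEN smooth_cfield_ctangent, OF p]
  note L = smooth_cfield_ctangent[OF smooth_cfield_lie_bracket[OF U F(1,2)] p]
  note CT = cconn_ctangent[OF nabla(1) U _ p]
  show ?thesis
    unfolding curv4_connection[OF U nabla(1,2) p F(1,2,3,4)] curv4_connection[OF U nabla(1,2) p F(1,2,4,3)]
      V[OF F(1,2)] V[OF F(2,1)] skew[OF p L]
    by (simp add: cmetric_sym[OF CT[OF F(4) T(1)] CT[OF F(3) T(2)]] cmetric_sym[OF CT[OF F(4) T(2)] CT[OF F(3) T(1)]])
qed

lemma curv4_zero:
  assumes e: "unitary_frame n M J g U e" and p: "p \<in> U"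
    and ijkl: "i \<in> {1..n}" "j \<in> {1..n}" "k \<in> {1..n}" "l \<in> {1..n}"
  shows "curv4 M g nabla (e i) (bar (e j)) (e k) (e l) p = 0"
proof -
  have U: "openin (mtop M) U" and F10: "\<And>i. i \<in> {1..n} \<Longrightarrow> smooth_field10 M J U (e i)"
    and orth: "\<And>q. q \<in> U \<Longrightarrow> cmetric g q (e i q) (bar (e j) q) = (if i = j then 1 else 0)"
    using e ijkl by (auto simp: unitary_frame_def bar_def)
  note F = field10D(1)[OF U F10]
  have bar_eq: "bar (e j) = (\<lambda>q. vcnj (e j q))" by (rule ext) (simp add: bar_def)
  let ?X = "e k" and ?Y = "e l" and ?Z = "e i" and ?W = "bar (e j)"
  have W: "smooth_cfield M U ?W" unfolding bar_eq by (rule smooth_cfield_vcnj[OF U F[OF ijkl(2)]])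
  note X = F[OF ijkl(3)] and Y = F[OF ijkl(4)] and Z = F[OF ijkl(1)]
  note Zp = field10D(2)[OF U F10[OF ijkl(1)] p]
  note R1 = curvature_T10[OF U p Y W F10[OF ijkl(3)]] and R2 = curvature_T10[OF U p W X F10[OF ijkl(4)]]
  have neg: "x = (-1) * y + (-1) * z" if "x + y + z = 0" for x y z :: complex
  proof -
    have "x = (x + y + z) - y - z" by simp
    then show ?thesis using that by simp
  qed
  \<comment> \<open>The other two terms of the Bianchi identity differentiate the (1,0)-fields
    \<open>e k\<close> and \<open>e l\<close>, hence are of type (1,0).\<close>
  have "curvature M nabla ?X ?Y ?W p = (\<lambda>f. (-1) * curvature M nabla ?Y ?W ?X p f + (-1) * curvature M nabla ?W ?X ?Y p f)"
    by (rule ext, rule neg, rule bianchi[OF U p X Y W])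
  then have "curvature M nabla ?X ?Y ?W p \<in> T10 M J p"
    using T10_lincomb[OF R1 R2, of "-1" "-1"] by simp
  then have "curv4 M g nabla ?W ?Z ?X ?Y p = 0"
    unfolding curv4_def using cmetric_T10[OF _ Zp] by blast
  \<comment> \<open>So far the curvature acts on the conjugate field; skewness in the first pair
    exchanges it with \<open>e i\<close>.\<close>
  then show ?thesis
    using curv4_skew_const[OF U p X Y Z W orth] by simp
qed

end

text \<open>The summands of \<open>dbar_omega\<close> are values of d omega on projected fields,
  which are again smooth.\<close>

lemma almost_kaehler_imp_quasi_kaehler:
  assumes "almost_kaehler n M J g"
  shows "quasi_kaehler n M J g"
proof -
  interpret almost_herm M n J g using assms by unfold_locales (simp add: almost_kaehler_def)
  have "dbar_omega M J g X Y Z p = 0"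
    if "openin (mtop M) U" "smooth_cfield M U X" "smooth_cfield M U Y" "smooth_cfield M U Z" "p \<in> U" for U X Y Z p
  proof -
    have d: "d_omega M J g A B C p = 0"
      if "smooth_cfield M U A" "smooth_cfield M U B" "smooth_cfield M U C" for A B C
      using assms that \<open>openin (mtop M) U\<close> \<open>p \<in> U\<close> unfolding almost_kaehler_def omega_closed_def by blast
    show ?thesis unfolding dbar_omega_def
      using that(1-4) by (simp add: d smooth_cfield_proj10 smooth_cfield_proj01)
  qed
  then show ?thesis using almost_hermitian unfolding quasi_kaehler_def by blast
qed

theorem theorem1p1:
  fixes M :: "('a, 'e::euclidean_space) mfd"
    and n :: nat
    and J :: "'a \<Rightarrow> 'a tvec \<Rightarrow> 'a tvec"
    and g :: "'a \<Rightarrow> 'a tvec \<Rightarrow> 'a tvec \<Rightarrow> real"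
    and nabla D :: "'a conn"
  assumes "almost_hermitian n M J g"
    and "canonical_connection M J g nabla"
    and "levi_civita_connection M g D"
  shows "(quasi_kaehler n M J g \<longrightarrow>
            (\<forall>p\<in>points M. scalar_curv n M J g nabla p \<le> scalar_curv n M J g D p) \<and>
            ((\<forall>p\<in>points M. scalar_curv n M J g nabla p = scalar_curv n M J g D p) \<longrightarrow>
               (\<forall>U e. unitary_frame n M J g U e \<longrightarrow>
                  (\<forall>p\<in>U. \<forall>i\<in>{1..n}. \<forall>j\<in>{1..n}. \<forall>k\<in>{1..n}. \<forall>l\<in>{1..n}.
                     curv4 M g nabla (e i) (bar (e j)) (e k) (e l) p = 0))))
       \<and> (almost_kaehler n M J g \<and> (\<forall>p\<in>points M. scalar_curv n M J g nabla p = scalar_curv n M J g D p) \<longrightarrow> kaehler n M J g)"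
proof -
  have quasi: "quasi_canonical M n J g nabla D" if "quasi_kaehler n M J g"
    using assms that by unfold_locales
  have equal: "equal_scalar_curv M n J g nabla D"
    if "quasi_kaehler n M J g" "\<forall>p\<in>points M. scalar_curv n M J g nabla p = scalar_curv n M J g D p"
    using quasi[OF that(1)] that(2) by (simp add: equal_scalar_curv_def equal_scalar_curv_axioms_def)
  show ?thesis
  proof (intro conjI impI ballI allI)
    show "scalar_curv n M J g nabla p \<le> scalar_curv n M J g D p"
      if "quasi_kaehler n M J g" "p \<in> points M" for p
      by (rule quasi_canonical.scalar_curv_le[OF quasi[OF that(1)] that(2)])
    show "curv4 M g nabla (e i) (bar (e j)) (e k) (e l) p = 0"
      if "quasi_kaehler n M J g" "\<forall>p\<in>points M. scalar_curv n M J g nabla p = scalar_curv n M J g D p"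
        "unitary_frame n M J g U e" "p \<in> U" "i \<in> {1..n}" "j \<in> {1..n}" "k \<in> {1..n}" "l \<in> {1..n}"
      for U e p i j k l
      by (rule equal_scalar_curv.curv4_zero[OF equal[OF that(1,2)] that(3-8)])
    show "kaehler n M J g"
      if "almost_kaehler n M J g \<and> (\<forall>p\<in>points M. scalar_curv n M J g nabla p = scalar_curv n M J g D p)"
    proof -
      have ak: "almost_kaehler n M J g"
        and eq: "\<forall>p\<in>points M. scalar_curv n M J g nabla p = scalar_curv n M J g D p" using that by auto
      have "J_integrable M J"
        by (rule equal_scalar_curv.integrable[OF equal[OF almost_kaehler_imp_quasi_kaehler[OF ak] eq]])
      then show ?thesis using ak by (simp add: kaehler_def almost_kaehler_def)
    qed
  qed
qed

end
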